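(* Let $a_0, \dots, a_k$ be positive integers with $a_0 \mid a_i$ for each $i \in \{1, \dots, k\}$. Let $\mathcal{Q} := \mathcal{Q}(a_0,\dots,a_k)$ be the set of primes $p$ such that $p \equiv 1 \pmod{a_0}$ and $p \not\equiv 1 \pmod{a_i}$ for every $i \in \{1,\dots,k\}$. Then the relative density of $\mathcal{Q}$ exists and satisfies \[ \mathbf{r}(\mathcal{Q}) \geq \frac{1}{\varphi(a_0)} \prod_{i=1}^k \left(1 - \frac{\varphi(a_0)}{\varphi(a_i)}\right). \]
   Context: The relative density of a set of primes $\mathcal{P}$ is $\mathbf{r}(\mathcal{P}) := \lim_{x\to+\infty} \#(\mathcal{P}\cap[1,x])/\pi(x)$, when the limit exists, where $\pi(x)$ is the number of primes not exceeding $x$. $\varphi$ is Euler's totient function. *)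

theory Defs
  imports "HOL-Analysis.Analysis" "HOL-Number_Theory.Number_Theory"
begin

definition prime_count :: "real \<Rightarrow> real" where
  "prime_count x = real (card {p::nat. prime p \<and> real p \<le> x})"

definition count_in :: "nat set \<Rightarrow> real \<Rightarrow> real" where
  "count_in P x = real (card {p::nat. p \<in> P \<and> prime p \<and> real p \<le> x})"

definition has_rel_density :: "nat set \<Rightarrow> real \<Rightarrow> bool" where
  "has_rel_density P r \<longleftrightarrow> ((\<lambda>x. count_in P x / prime_count x) \<longlongrightarrow> r) at_top"

definition rel_density :: "nat set \<Rightarrow> real" where
  "rel_density P = (THE r. has_rel_density P r)"

end

theory Submission
  imports Defs "HOL-Complex_Analysis.Complex_Analysis" "HOL-Probability.Probability"
begin

text \<open>
  The product \<open>F\<close> of the \<open>L\<close>-functions of all characters modulo \<open>m\<close> satisfies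
  \<open>- F'/F = \<phi>(m) \<Sum> (log p) p\<^sup>-\<^sup>s + (holomorphic for Re s > 1/2)\<close>, the sum being over the primes
  \<open>p \<equiv> 1 (mod m)\<close>. Landau's positivity argument shows that \<open>F\<close> has a simple pole at \<open>1\<close>, the
  inequality \<open>3 + 4 cos t + cos 2t \<ge> 0\<close> that it has no other zeros or poles on \<open>Re s = 1\<close>, and a
  Tauberian theorem yields the density \<open>1/\<phi>(m)\<close> for this class of primes. In the Tauberian theorem
  the weights are smoothed by the Fejer kernel; Levy's continuity theorem turns the convergence of
  the Fourier transforms of the smoothed weights into weak convergence, and hence into convergence
  of the sums over multiplicative windows.

  The sieved set is a Boolean combination of classes \<open>1 (mod d)\<close>, so its density exists. The lower
  bound follows one modulus at a time, since conditioning on \<open>p \<equiv> 1 (mod a\<^sub>i)\<close> cannot raise the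
  probability of avoiding the other classes. It suffices to raise the modulus \<open>m\<close> by one prime \<open>q\<close>:
  the congruences that do not involve a higher power of \<open>q\<close> than \<open>m\<close> does are independent of this step,
  and the remaining ones can only hold within the class \<open>1 (mod q m)\<close>.
\<close>

section \<open>Characters modulo m\<close>

text \<open>Only the class of 1 matters, so every character enters with coefficient 1 and just the
  product of all \<open>L\<close>-functions has to be studied on the line Re s = 1, never a single
  one. The trigonometric inequality says nothing at t = 0, where its three terms sit at the same
  point: there a zero of one factor could cancel the pole of the principal one. Positivity excludes
  this. It is extracted from a differential equation H' = - N H, where N is a series with
  nonnegative Dirichlet coefficients, so the argument never takes a logarithm of F.

  The Fejer kernel suits the Tauberian step because it is nonnegative and has a compactly supported
  Fourier transform. Nonnegativity gives measures; compact support means that only a bounded piece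
  of the line Re s = 1 is seen, where continuity gives all bounds.

  In the sieve the congruences are dependent as soon as moduli share prime factors.
  Inclusion-exclusion over least common multiples computes densities but hides their signs;
  comparing the moduli m and q m shows that the dependence can act in one direction only.\<close>

definition dchars :: "nat \<Rightarrow> (nat \<Rightarrow> complex) set" where
  "dchars m = {\<xi>. (\<forall>a b. \<xi> (a * b) = \<xi> a * \<xi> b) \<and> (\<forall>a. \<xi> (a mod m) = \<xi> a) \<and>
     (\<forall>a. \<xi> a = 0 \<longleftrightarrow> \<not> coprime a m)}"

text \<open>Functions on the units modulo \<open>m\<close>, extended by zero. Multiplying the
  argument by a unit acts on this space with finite order, these operators commute, and characters
  arise as the eigenvalues of their common eigenvectors.\<close>

definition class_funs :: "nat \<Rightarrow> (nat \<Rightarrow> complex) set" where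
  "class_funs m = {f. (\<forall>a. f (a mod m) = f a) \<and> (\<forall>a. \<not> coprime a m \<longrightarrow> f a = 0)}"

text \<open>Discrete Fourier projection: if \<open>g ^ d\<close> is 1 modulo \<open>m\<close> and
  \<open>w ^ d = 1\<close>, this is \<open>d\<close> times the projection onto the functions with f
  (g x) = f x / w.\<close>

definition eproj :: "nat \<Rightarrow> nat \<Rightarrow> complex \<Rightarrow> (nat \<Rightarrow> complex) \<Rightarrow> nat \<Rightarrow> complex" where
  "eproj d g w f x = (\<Sum>j<d. w ^ j * f (g ^ j * x))"

definition unity_root :: "nat \<Rightarrow> nat \<Rightarrow> complex" where
  "unity_root d l = cis (2 * pi * real l / real d)"

lemma unity_root_power: "d > 0 \<Longrightarrow> unity_root d l ^ d = 1"
  unfolding unity_root_def Complex.DeMoivre by (simp add: cis_multiple_2pi)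

lemma unity_root_power_commute: "unity_root d l ^ j = unity_root d j ^ l"
  unfolding unity_root_def Complex.DeMoivre by (simp add: mult_ac)

lemma unity_root_neq_1:
  assumes "0 < l" "l < d"
  shows "unity_root d l \<noteq> 1"
proof
  assume "unity_root d l = 1"
  then have "cos (2 * pi * real l / real d) = 1"
    by (simp add: unity_root_def complex_eq_iff)
  then obtain k :: int where "2 * pi * real l / real d = of_int k * 2 * pi"
    using cos_one_2pi_int by auto
  then have "real l = of_int k * real d" using assms by (simp add: field_simps)
  then have eq: "int l = k * int d" by (metis of_int_eq_iff of_int_mult of_int_of_nat_eq)
  then have "int d dvd int l" by simp
  then show False using assms by (meson dvd_imp_le linorder_not_less of_nat_dvd_iff)
qed

lemma sum_unity_root:
  assumes "j < d"
  shows "(\<Sum>l<d. unity_root d l ^ j) = (if j = 0 then of_nat d else 0)"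
proof (cases "j = 0")
  case False
  then have "unity_root d j \<noteq> 1" using unity_root_neq_1 assms by auto
  then have "(\<Sum>l<d. unity_root d j ^ l) = 0"
    using geometric_sum[of "unity_root d j" d] unity_root_power[of d j] assms by simp
  then show ?thesis using False by (simp add: unity_root_power_commute[of d _ j])
qed auto

lemma eproj_in: "f \<in> class_funs m \<Longrightarrow> coprime g m \<Longrightarrow> eproj d g w f \<in> class_funs m"
  unfolding class_funs_def eproj_def
proof (intro CollectI conjI allI impI)
  fix a assume *: "f \<in> {f. (\<forall>a. f (a mod m) = f a) \<and> (\<forall>a. \<not> coprime a m \<longrightarrow> f a = 0)}" "coprime g m"
  have "f (g ^ j * (a mod m)) = f (g ^ j * a)" for j
  proof -
    have "f ((g ^ j * (a mod m)) mod m) = f ((g ^ j * a) mod m)" by (simp add: mod_mult_right_eq)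
    then show ?thesis using * by simp
  qed
  then show "(\<Sum>j<d. w ^ j * f (g ^ j * (a mod m))) = (\<Sum>j<d. w ^ j * f (g ^ j * a))" by simp
  show "(\<Sum>j<d. w ^ j * f (g ^ j * a)) = 0" if "\<not> coprime a m"
    using * that by (intro sum.neutral) simp
qed

lemma class_funs_cong: "f \<in> class_funs m \<Longrightarrow> [a = b] (mod m) \<Longrightarrow> f a = f b"
  unfolding class_funs_def cong_def by (metis (mono_tags, lifting) mem_Collect_eq)

text \<open>Fourier inversion: the power sums of the roots of unity vanish except for
  \<open>j = 0\<close>. It serves to find a root whose component of a nonzero \<open>f\<close> is
  nonzero.\<close>

lemma eproj_sum:
  assumes "d > 0"
  shows "(\<Sum>l<d. eproj d g (unity_root d l) f x) = of_nat d * f x"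
proof -
  have "(\<Sum>l<d. eproj d g (unity_root d l) f x) = (\<Sum>j<d. (\<Sum>l<d. unity_root d l ^ j) * f (g ^ j * x))"
    unfolding eproj_def by (subst sum.swap) (simp add: sum_distrib_right)
  also have "\<dots> = (\<Sum>j<d. if j = 0 then of_nat d * f x else 0)"
    by (intro sum.cong refl) (auto simp: sum_unity_root)
  also have "\<dots> = of_nat d * f x" using assms by simp
  finally show ?thesis .
qed

lemma eproj_eigen:
  assumes f: "f \<in> class_funs m" and g: "[g ^ d = 1] (mod m)" and w: "w ^ d = 1" and d: "d > 0"
  shows "w * eproj d g w f (g * x) = eproj d g w f x"
proof -
  let ?t = "\<lambda>j. w ^ j * f (g ^ j * x)"
  have "[g ^ d * x = 1 * x] (mod m)" using g by (rule cong_mult) simp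
  then have td: "?t d = ?t 0" using class_funs_cong[OF f] w by simp
  have "w * eproj d g w f (g * x) = (\<Sum>j<d. ?t (Suc j))"
    unfolding eproj_def by (simp add: sum_distrib_left mult_ac)
  also have "\<dots> = (\<Sum>j<Suc d. ?t j) - ?t 0" by (subst sum.lessThan_Suc_shift) simp
  also have "\<dots> = (\<Sum>j<d. ?t j)" using td by simp
  finally show ?thesis by (simp add: eproj_def)
qed

lemma eproj_preserves_eigen:
  assumes "\<And>x. f (h * x) = c * f x"
  shows "eproj d g w f (h * x) = c * eproj d g w f x"
  unfolding eproj_def sum_distrib_left
  by (intro sum.cong refl) (metis assms mult.left_commute)

text \<open>One \<open>g\<close> is added at a time. Some projection of the current vector is
  nonzero, since the projections sum to a multiple of it, and it stays an eigenvector for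
  \<open>n\<close> and for the earlier elements because translations commute. The eigenvalue
  \<open>c\<close> at \<open>n\<close> is thus kept throughout.\<close>

lemma common_eigenvector:
  assumes m: "m > 0" and A: "finite A" "\<And>g. g \<in> A \<Longrightarrow> coprime g m"
    and f: "f \<in> class_funs m" "f \<noteq> (\<lambda>_. 0)" "\<And>x. f (n * x) = c * f x"
  shows "\<exists>f \<in> class_funs m. f \<noteq> (\<lambda>_. 0) \<and> (\<forall>x. f (n * x) = c * f x) \<and>
     (\<forall>g\<in>A. \<exists>z. \<forall>x. f (g * x) = z * f x)"
  using A
proof (induction A rule: finite_induct)
  case empty
  then show ?case using f by auto
next
  case (insert g A)
  then obtain f' where f': "f' \<in> class_funs m" "f' \<noteq> (\<lambda>_. 0)" "\<And>x. f' (n * x) = c * f' x"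
    "\<And>h. h \<in> A \<Longrightarrow> \<exists>z. \<forall>x. f' (h * x) = z * f' x" by auto
  define d where "d = totient m"
  have d: "d > 0" using m by (simp add: d_def)
  have gm: "coprime g m" using insert by auto
  have gd: "[g ^ d = 1] (mod m)" using euler_theorem[of g m] gm by (simp add: d_def)
  obtain x0 where x0: "f' x0 \<noteq> 0" using f'(2) by auto
  have "(\<Sum>l<d. eproj d g (unity_root d l) f' x0) \<noteq> 0" using x0 d by (simp add: eproj_sum)
  then obtain l where l: "eproj d g (unity_root d l) f' x0 \<noteq> 0"
    by (meson sum.neutral)
  define w where "w = unity_root d l"
  have w: "w ^ d = 1" using d by (simp add: w_def unity_root_power)
  then have w0: "w \<noteq> 0" using d by (auto simp: power_0_left)
  define F where "F = eproj d g w f'"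
  have "F \<in> class_funs m" unfolding F_def by (rule eproj_in[OF f'(1) gm])
  moreover have "F \<noteq> (\<lambda>_. 0)" using l by (auto simp: F_def w_def)
  moreover have "F (n * x) = c * F x" for x
    unfolding F_def by (rule eproj_preserves_eigen) (rule f'(3))
  moreover have "\<exists>z. \<forall>x. F (h * x) = z * F x" if "h \<in> A" for h
    using f'(4)[OF that] eproj_preserves_eigen[of f' h] unfolding F_def by blast
  moreover have "F (g * x) = inverse w * F x" for x
    using eproj_eigen[OF f'(1) gd w d, of x] w0 by (simp add: F_def field_simps)
  ultimately show ?case by blast
qed

text \<open>If 1 were the only eigenvalue of translation by \<open>n\<close>, the indicator of the
  class of 1 would be a multiple of its projection for \<open>w = 1\<close> and hence invariant, but
  the translation moves it when \<open>n\<close> is not 1 modulo \<open>m\<close>.\<close>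

lemma separating_eigenvector:
  assumes m: "m > 0" and n: "coprime n m" "\<not> [n = 1] (mod m)"
  shows "\<exists>f \<in> class_funs m. \<exists>c. f \<noteq> (\<lambda>_. 0) \<and> c \<noteq> 1 \<and> (\<forall>x. f (n * x) = c * f x)"
proof (rule ccontr)
  assume neg: "\<not> ?thesis"
  define d where "d = totient m"
  have d: "d > 0" using m by (simp add: d_def)
  have nd: "[n ^ d = 1] (mod m)" using euler_theorem[of n m] n by (simp add: d_def)
  define \<delta> :: "nat \<Rightarrow> complex" where "\<delta> x = (if [x = 1] (mod m) then 1 else 0)" for x
  have \<delta>: "\<delta> \<in> class_funs m"
  proof -
    have "coprime a m" if "[a = 1] (mod m)" for a
      using cong_imp_coprime[OF cong_sym[OF that]] by simp
    then show ?thesis by (auto simp: class_funs_def \<delta>_def cong_def)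
  qed
  have zero: "eproj d n (unity_root d l) \<delta> x = 0" if l: "0 < l" "l < d" for l x
  proof (rule ccontr)
    assume nz: "eproj d n (unity_root d l) \<delta> x \<noteq> 0"
    let ?w = "unity_root d l"
    have w: "?w ^ d = 1" using d by (simp add: unity_root_power)
    then have w0: "?w \<noteq> 0" using d by (auto simp: power_0_left)
    have "inverse ?w \<noteq> 1" using unity_root_neq_1[OF l] by (simp add: inverse_eq_1_iff)
    moreover have "eproj d n ?w \<delta> (n * y) = inverse ?w * eproj d n ?w \<delta> y" for y
      using eproj_eigen[OF \<delta> nd w d, of y] w0 by (simp add: field_simps)
    moreover have "eproj d n ?w \<delta> \<noteq> (\<lambda>_. 0)" using nz by auto
    ultimately show False using neg eproj_in[OF \<delta> n(1)] by blast
  qed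
  have one: "of_nat d * \<delta> x = eproj d n 1 \<delta> x" for x
  proof -
    have "of_nat d * \<delta> x = (\<Sum>l<d. eproj d n (unity_root d l) \<delta> x)"
      using eproj_sum[OF d] by simp
    also have "\<dots> = (\<Sum>l<d. if l = 0 then eproj d n (unity_root d 0) \<delta> x else 0)"
      by (intro sum.cong refl) (auto simp: zero)
    also have "\<dots> = eproj d n 1 \<delta> x" using d by (simp add: unity_root_def)
    finally show ?thesis .
  qed
  have "of_nat d * \<delta> (n * 1) = of_nat d * \<delta> 1"
    using eproj_eigen[OF \<delta> nd, of 1 1] d by (simp add: one)
  then show False using n d by (simp add: \<delta>_def)
qed

text \<open>The eigenvalues of a common eigenvector form a character: composing translations
  multiplies them, and at \<open>n\<close> the value is the prescribed
  \<open>c \<noteq> 1\<close>.\<close>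

lemma separating_char:
  assumes m: "m > 0" and n: "coprime n m" "\<not> [n = 1] (mod m)"
  shows "\<exists>\<xi> \<in> dchars m. \<xi> n \<noteq> 1"
proof -
  obtain f0 c where f0: "f0 \<in> class_funs m" "f0 \<noteq> (\<lambda>_. 0)" and c: "c \<noteq> 1"
    and f0c: "\<And>x. f0 (n * x) = c * f0 x"
    using separating_eigenvector[OF assms] by metis
  have "\<exists>f \<in> class_funs m. f \<noteq> (\<lambda>_. 0) \<and> (\<forall>x. f (n * x) = c * f x) \<and>
     (\<forall>g\<in>{g. g < m \<and> coprime g m}. \<exists>z. \<forall>x. f (g * x) = z * f x)"
    by (rule common_eigenvector[OF m _ _ f0 f0c]) simp_all
  then obtain f where f: "f \<in> class_funs m" "f \<noteq> (\<lambda>_. 0)" "\<And>x. f (n * x) = c * f x"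
    and eig: "\<And>g. g \<in> {g. g < m \<and> coprime g m} \<Longrightarrow> \<exists>z. \<forall>x. f (g * x) = z * f x"
    by blast
  have eig': "\<exists>z. \<forall>x. f (g * x) = z * f x" for g
  proof (cases "coprime g m")
    case True
    then have "g mod m \<in> {g. g < m \<and> coprime g m}" using m by simp
    then obtain z where "\<And>x. f ((g mod m) * x) = z * f x" using eig by metis
    moreover have "f ((g mod m) * x) = f (g * x)" for x
      by (rule class_funs_cong[OF f(1)]) (simp add: cong_def mod_mult_left_eq)
    ultimately show ?thesis by auto
  next
    case False
    then have "f (g * x) = 0 * f x" for x using f(1) by (simp add: class_funs_def)
    then show ?thesis by blast
  qed
  then obtain z where z: "\<And>g x. f (g * x) = z g * f x" by metis
  obtain x0 where x0: "f x0 \<noteq> 0" using f(2) by auto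
  have z_eq: "z g = f (g * x0) / f x0" for g using z[of g x0] x0 by simp
  have "z (a * b) = z a * z b" for a b
    using z[of "a * b" x0] z[of a "b * x0"] z[of b x0] x0 by (simp add: mult.assoc)
  moreover have "z (a mod m) = z a" for a
    unfolding z_eq using class_funs_cong[OF f(1), of "a mod m * x0" "a * x0"]
    by (simp add: cong_def mod_mult_left_eq)
  moreover have "z a = 0" if "\<not> coprime a m" for a
    unfolding z_eq using f(1) that by (simp add: class_funs_def)
  moreover have "z a \<noteq> 0" if "coprime a m" for a
  proof -
    have "[a ^ totient m * x0 = 1 * x0] (mod m)"
      by (intro cong_mult cong_refl euler_theorem that)
    then have "f (a ^ totient m * x0) = f x0" using class_funs_cong[OF f(1)] by simp
    then have "z (a ^ totient m) = 1" using z_eq x0 by simp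
    moreover obtain b where "a ^ totient m = a * b" using m
      by (metis totient_gt_0_iff gr0_implies_Suc power_Suc)
    ultimately show ?thesis using \<open>\<And>a b. z (a * b) = z a * z b\<close> by force
  qed
  moreover have "z n = c" using f(3)[of x0] x0 z_eq by simp
  ultimately show ?thesis using c unfolding dchars_def by blast
qed

section \<open>Finiteness and orthogonality of the characters\<close>

definition char0 :: "nat \<Rightarrow> nat \<Rightarrow> complex" where
  "char0 m a = (if coprime a m then 1 else 0)"

lemma char0_in: "m > 0 \<Longrightarrow> char0 m \<in> dchars m"
  unfolding dchars_def char0_def by auto

lemma dchars_mult: "\<xi> \<in> dchars m \<Longrightarrow> \<xi> (a * b) = \<xi> a * \<xi> b"
  and dchars_mod: "\<xi> \<in> dchars m \<Longrightarrow> \<xi> (a mod m) = \<xi> a"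
  and dchars_eq_0: "\<xi> \<in> dchars m \<Longrightarrow> \<xi> a = 0 \<longleftrightarrow> \<not> coprime a m"
  by (auto simp: dchars_def)

lemma dchars_1: assumes "\<xi> \<in> dchars m" shows "\<xi> (Suc 0) = 1"
  using dchars_mult[OF assms, of "Suc 0" "Suc 0"] dchars_eq_0[OF assms, of "Suc 0"] by simp

lemma dchars_cong: "\<xi> \<in> dchars m \<Longrightarrow> [a = b] (mod m) \<Longrightarrow> \<xi> a = \<xi> b"
  by (metis cong_def dchars_mod)

lemma dchars_power: "\<xi> \<in> dchars m \<Longrightarrow> \<xi> (a ^ k) = \<xi> a ^ k"
  by (induction k) (auto simp: dchars_mult dchars_1)

lemma dchars_root: assumes "\<xi> \<in> dchars m" "coprime a m" shows "\<xi> a ^ totient m = 1"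
  using dchars_cong[OF assms(1) euler_theorem[OF assms(2)]] dchars_power[OF assms(1)] dchars_1[OF assms(1)]
  by simp

lemma dchars_norm:
  assumes "\<xi> \<in> dchars m" "m > 0" shows "norm (\<xi> a) \<le> 1"
proof (cases "coprime a m")
  case True
  have "norm (\<xi> a) ^ totient m = 1" using dchars_root[OF assms(1) True] by (metis norm_one norm_power)
  then show ?thesis using assms(2) 
    using power_eq_imp_eq_base[of "norm (\<xi> a)" "totient m" 1] by simp
next
  case False
  then have "\<xi> a = 0" using dchars_eq_0[OF assms(1)] by simp
  then show ?thesis by simp
qed

text \<open>A character is determined by its values below \<open>m\<close>, each of which is 0 or a
  root of unity of order dividing \<open>totient m\<close>.\<close>

lemma finite_dchars: assumes m: "m > 0" shows "finite (dchars m)"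
proof -
  let ?R = "insert 0 {z::complex. z ^ totient m = 1}"
  have "(\<lambda>\<xi>. restrict \<xi> {..<m}) ` dchars m \<subseteq> PiE {..<m} (\<lambda>_. ?R)"
  proof (rule image_subsetI)
    fix \<xi> assume \<xi>: "\<xi> \<in> dchars m"
    have "\<xi> a \<in> ?R" for a
      using dchars_root[OF \<xi>, of a] dchars_eq_0[OF \<xi>, of a] by auto
    then show "restrict \<xi> {..<m} \<in> PiE {..<m} (\<lambda>_. ?R)" by auto
  qed
  moreover have "finite ?R" using m
    by (intro finite.insertI finite_roots_unity) (simp add: Suc_le_eq)
  ultimately have "finite ((\<lambda>\<xi>. restrict \<xi> {..<m}) ` dchars m)"
    by (meson finite_PiE finite_lessThan finite_subset)
  moreover have "inj_on (\<lambda>\<xi>. restrict \<xi> {..<m}) (dchars m)"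
  proof (intro inj_onI ext)
    fix \<xi> \<psi> a assume *: "\<xi> \<in> dchars m" "\<psi> \<in> dchars m" "restrict \<xi> {..<m} = restrict \<psi> {..<m}"
    have "\<xi> (a mod m) = \<psi> (a mod m)" using *(3) m by (metis lessThan_iff mod_less_divisor restrict_apply')
    then show "\<xi> a = \<psi> a" using * dchars_mod by metis
  qed
  ultimately show ?thesis by (rule finite_imageD)
qed

text \<open>Multiplication by a character \<open>\<psi>\<close> with
  \<open>\<psi> n \<noteq> 1\<close> permutes the characters and multiplies the sum by
  \<open>\<psi> n\<close>, so the sum is 0. The number of characters is identified afterwards, in
  \<open>card_dchars\<close>.\<close>

lemma dchars_sum_chars_aux:
  assumes m: "m > 0"
  shows "(\<Sum>\<xi>\<in>dchars m. \<xi> n) = (if [n = 1] (mod m) then of_nat (card (dchars m)) else 0)"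
proof (cases "[n = 1] (mod m)")
  case True
  have "\<xi> n = 1" if "\<xi> \<in> dchars m" for \<xi>
    using dchars_cong[OF that True] dchars_1[OF that] by simp
  then have "(\<Sum>\<xi>\<in>dchars m. \<xi> n) = (\<Sum>\<xi>\<in>dchars m. 1)" by (intro sum.cong refl)
  then show ?thesis using True by simp
next
  case False
  show ?thesis
  proof (cases "coprime n m")
    case True
    then obtain \<psi> where \<psi>: "\<psi> \<in> dchars m" "\<psi> n \<noteq> 1" using separating_char[OF m True False] by auto
    let ?h = "\<lambda>\<xi> a. \<psi> a * \<xi> a :: complex"
    have sub: "?h ` dchars m \<subseteq> dchars m" using \<psi>(1) by (auto simp: dchars_def)
    have inj: "inj_on ?h (dchars m)"
    proof (intro inj_onI ext)
      fix \<xi> \<xi>' a assume *: "\<xi> \<in> dchars m" "\<xi>' \<in> dchars m" "?h \<xi> = ?h \<xi>'"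
      show "\<xi> a = \<xi>' a"
        using fun_cong[OF *(3), of a] dchars_eq_0[OF *(1), of a] dchars_eq_0[OF *(2), of a] dchars_eq_0[OF \<psi>(1), of a]
        by (cases "coprime a m") auto
    qed
    then have img: "?h ` dchars m = dchars m" using sub finite_dchars[OF m] by (simp add: endo_inj_surj)
    have "(\<Sum>\<xi>\<in>dchars m. \<xi> n) = (\<Sum>\<xi>\<in>?h ` dchars m. \<xi> n)" using img by simp
    also have "\<dots> = \<psi> n * (\<Sum>\<xi>\<in>dchars m. \<xi> n)"
      by (subst sum.reindex[OF inj]) (simp add: sum_distrib_left)
    finally show ?thesis using \<psi>(2) False by simp
  next
    case f2: False
    then have "\<xi> n = 0" if "\<xi> \<in> dchars m" for \<xi> using dchars_eq_0[OF that] by simp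
    then have "(\<Sum>\<xi>\<in>dchars m. \<xi> n) = 0" by (intro sum.neutral) simp
    then show ?thesis using False by simp
  qed
qed

lemma dchars_sum_residues:
  assumes m: "m > 0" and \<xi>: "\<xi> \<in> dchars m"
  shows "(\<Sum>a<m. \<xi> a) = (if \<xi> = char0 m then of_nat (totient m) else 0)"
proof (cases "\<xi> = char0 m")
  case True
  have "(\<Sum>a<m. char0 m a) = of_nat (card {a\<in>{..<m}. coprime a m})"
    unfolding char0_def by (subst sum.inter_filter[symmetric]) auto
  \<comment> \<open>\<open>totatives m\<close> lies in {1..m}; reduction modulo \<open>m\<close>
    changes it only for \<open>m = 1\<close>, where the totative 1 corresponds to the residue
    0.\<close>
  also have "{a\<in>{..<m}. coprime a m} = (\<lambda>a. a mod m) ` totatives m" 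
  proof (cases "m = 1")
    case False
    then have "m > 1" using m by simp
    then have "{a\<in>{..<m}. coprime a m} = totatives m"
    proof (intro equalityI subsetI)
      fix a assume a: "a \<in> {a \<in> {..<m}. coprime a m}"
      then have "a \<noteq> 0" using \<open>m > 1\<close> by (cases "a = 0") auto
      then show "a \<in> totatives m" using a by (simp add: totatives_def)
    next
      fix a assume "a \<in> totatives m"
      then show "a \<in> {a \<in> {..<m}. coprime a m}"
        using totatives_less[OF _ \<open>m > 1\<close>] by (simp add: totatives_def)
    qed
    moreover have "\<forall>a\<in>totatives m. a mod m = a" using \<open>m > 1\<close> by (metis mod_less totatives_less)
    ultimately show ?thesis by simp
  qed auto
  also have "card \<dots> = totient m"
    unfolding totient_def
  proof (rule card_image, rule inj_onI)
    fix x y assume "x \<in> totatives m" "y \<in> totatives m" "x mod m = y mod m"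
    then show "x = y"
    proof (cases "m = 1")
      case False
      then have "m > 1" using m by simp
      then have "x < m" "y < m"
        using \<open>x \<in> totatives m\<close> \<open>y \<in> totatives m\<close> totatives_less by auto
      then show ?thesis using \<open>x mod m = y mod m\<close> by simp
    qed auto
  qed
  finally show ?thesis using True by simp
next
  case False
  then obtain b where "\<xi> b \<noteq> char0 m b" by blast
  then have b: "coprime b m" "\<xi> b \<noteq> 1" using dchars_eq_0[OF \<xi>, of b] by (auto simp: char0_def split: if_splits)
  have inj: "inj_on (\<lambda>a. b * a mod m) {..<m}"
  proof (rule inj_onI)
    fix x y assume *: "x \<in> {..<m}" "y \<in> {..<m}" "b * x mod m = b * y mod m"
    then have "[x = y] (mod m)" using cong_mult_lcancel_nat[of b m x y] b(1) by (simp add: cong_def)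
    then show "x = y" using * by (simp add: cong_def)
  qed
  have img: "(\<lambda>a. b * a mod m) ` {..<m} = {..<m}"
    by (rule endo_inj_surj[OF _ _ inj]) (use m in auto)
  have "(\<Sum>a<m. \<xi> a) = (\<Sum>a\<in>(\<lambda>a. b * a mod m) ` {..<m}. \<xi> a)" using img by simp
  also have "\<dots> = \<xi> b * (\<Sum>a<m. \<xi> a)"
    by (subst sum.reindex[OF inj]) (simp add: dchars_mod[OF \<xi>] dchars_mult[OF \<xi>] sum_distrib_left)
  finally show ?thesis using b(2) False by simp
qed

text \<open>Double counting of all values \<open>\<xi> a\<close>: in one order only the residue of 1
  contributes, in the other only the principal character.\<close>

lemma card_dchars: assumes m: "m > 0" shows "card (dchars m) = totient m"
proof -
  have "(\<Sum>a<m. \<Sum>\<xi>\<in>dchars m. \<xi> a) = (\<Sum>a<m. if a = 1 mod m then of_nat (card (dchars m)) else 0)"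
    by (intro sum.cong refl) (auto simp: dchars_sum_chars_aux[OF m] cong_def)
  also have "\<dots> = of_nat (card (dchars m))" using m by simp
  finally have 1: "(\<Sum>a<m. \<Sum>\<xi>\<in>dchars m. \<xi> a) = of_nat (card (dchars m))" .
  have "(\<Sum>a<m. \<Sum>\<xi>\<in>dchars m. \<xi> a) = (\<Sum>\<xi>\<in>dchars m. if \<xi> = char0 m then of_nat (totient m) else 0)"
    by (subst sum.swap) (simp add: dchars_sum_residues[OF m] cong: sum.cong)
  also have "\<dots> = of_nat (totient m)" using finite_dchars[OF m] char0_in[OF m] by simp
  finally show ?thesis using 1 by (metis of_nat_eq_iff)
qed

lemma dchars_sum_chars:
  assumes m: "m > 0"
  shows "(\<Sum>\<xi>\<in>dchars m. \<xi> n) = (if [n = 1] (mod m) then of_nat (totient m) else 0)"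
  using dchars_sum_chars_aux[OF m] card_dchars[OF m] by simp

section \<open>Abel summation and the zeta function\<close>

lemma uniform_limit_suminf_local:
  fixes f :: "nat \<Rightarrow> complex \<Rightarrow> complex"
  assumes "summable M" "\<And>n w. w \<in> S \<Longrightarrow> norm (f n w) \<le> M n"
  shows "uniform_limit S (\<lambda>N w. \<Sum>n<N. f n w) (\<lambda>w. \<Sum>n. f n w) sequentially"
  by (rule Weierstrass_m_test) (use assms in auto)

text \<open>The majorant may depend on the point, as it must: on the half-planes in question the
  series are dominated only on discs that stay away from the boundary.\<close>

lemma holomorphic_suminf_local:
  fixes f :: "nat \<Rightarrow> complex \<Rightarrow> complex"
  assumes "open S" and holo: "\<And>n. f n holomorphic_on S"
    and bound: "\<And>z. z \<in> S \<Longrightarrow> \<exists>d>0. \<exists>M. cball z d \<subseteq> S \<and> summable M \<and> (\<forall>n. \<forall>w\<in>cball z d. norm (f n w) \<le> M n)"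
  shows "(\<lambda>z. \<Sum>n. f n z) holomorphic_on S"
proof (rule holomorphic_uniform_sequence[OF \<open>open S\<close>, of "\<lambda>N z. \<Sum>n<N. f n z"])
  show "(\<lambda>z. \<Sum>n<N. f n z) holomorphic_on S" for N
    by (intro holomorphic_intros holo)
  fix z assume "z \<in> S"
  then obtain d M where "d > 0" "cball z d \<subseteq> S" "summable M" "\<And>n w. w \<in> cball z d \<Longrightarrow> norm (f n w) \<le> M n"
    using bound by metis
  then show "\<exists>d>0. cball z d \<subseteq> S \<and> uniform_limit (cball z d) (\<lambda>N z. \<Sum>n<N. f n z) (\<lambda>z. \<Sum>n. f n z) sequentially"
    using uniform_limit_suminf_local[of M "cball z d" f] by blast
qed

lemma Re_le_cball:
  assumes "w \<in> cball z (d::real)" shows "Re z - d \<le> Re w" "norm w \<le> norm z + d"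
proof -
  have "\<bar>Re (z - w)\<bar> \<le> d" using abs_Re_le_cmod[of "z - w"] assms by (simp add: dist_norm)
  then show "Re z - d \<le> Re w" by simp
  have "norm w \<le> norm z + norm (w - z)" by (metis add_diff_cancel_left' norm_triangle_ineq diff_add_cancel add.commute)
  then show "norm w \<le> norm z + d" using assms by (simp add: dist_norm norm_minus_commute)
qed

lemma cball_subset_halfplane:
  assumes "d < Re z - a" shows "cball z d \<subseteq> {s. Re s > a}"
  using Re_le_cball(1) assms by fastforce

lemma open_Re_gt: "open {s. Re s > a}"
  by (rule open_halfspace_Re_gt)

lemma norm_of_real_powr: "x > 0 \<Longrightarrow> norm (complex_of_real x powr s) = x powr Re s"
  by (simp add: norm_powr_real_powr)

lemma norm_of_nat_powr: "n > 0 \<Longrightarrow> norm (of_nat n powr s :: complex) = real n powr Re s"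
  using norm_of_real_powr[of "real n" s] by simp

lemma norm_of_nat_powr_le: "Re s > 0 \<Longrightarrow> norm (of_nat n powr (-s) :: complex) \<le> real n powr (- Re s)"
  by (cases "n = 0") (simp_all add: norm_of_nat_powr)

lemma powr_diff_bound:
  assumes a: "1 \<le> a" "a \<le> x" "x \<le> a + 1" and s: "Re s > 0"
  shows "norm (complex_of_real x powr (-s) - complex_of_real a powr (-s)) \<le> norm s * a powr (- Re s - 1)"
proof -
  let ?S = "closed_segment (complex_of_real a) (complex_of_real x)"
  have S: "\<exists>t. z = of_real t \<and> a \<le> t \<and> t \<le> x" if "z \<in> ?S" for z
    using that a by (auto simp: closed_segment_of_real closed_segment_eq_real_ivl)
  have "norm (complex_of_real x powr (-s) - complex_of_real a powr (-s))
      \<le> norm s * a powr (- Re s - 1) * norm (complex_of_real x - complex_of_real a)"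
  proof (rule field_differentiable_bound[where f' = "\<lambda>z. - s * z powr (- s - 1)" and S = ?S])
    fix z assume "z \<in> ?S"
    then obtain t where t: "z = of_real t" "a \<le> t" "t \<le> x" using S by blast
    show "((\<lambda>z. z powr (-s)) has_field_derivative - s * z powr (- s - 1)) (at z within ?S)"
      using t a by (intro has_field_derivative_at_within[OF has_field_derivative_powr]) auto
    have "norm (z powr (- s - 1)) = t powr (- Re s - 1)" using t a by (simp add: norm_of_real_powr)
    also have "\<dots> \<le> a powr (- Re s - 1)" using t a s by (intro powr_mono2') auto
    finally show "norm (- s * z powr (- s - 1)) \<le> norm s * a powr (- Re s - 1)"
      by (simp add: norm_mult mult_left_mono)
  qed auto
  also have "norm (complex_of_real x - complex_of_real a) \<le> 1"
    using a by (simp flip: of_real_diff)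
  then have "norm s * a powr (- Re s - 1) * norm (complex_of_real x - complex_of_real a) \<le> norm s * a powr (- Re s - 1)"
    by (simp add: mult_left_le)
  finally show ?thesis .
qed

text \<open>The expression is \<open>s - 1\<close> times the difference between a^(-s) and the
  integral of x^(-s) over [a, a + 1]. Multiplying out avoids the division by \<open>1 - s\<close>,
  so \<open>s = 1\<close> is included.\<close>

lemma powr_integral_bound:
  assumes a: "1 \<le> a" and s: "Re s > 0"
  shows "norm ((s - 1) * complex_of_real a powr (-s) - complex_of_real a powr (1 - s) + complex_of_real (a + 1) powr (1 - s))
     \<le> norm (s - 1) * norm s * a powr (- Re s - 1)"
proof -
  let ?S = "closed_segment (complex_of_real a) (complex_of_real (a + 1))"
  let ?g = "\<lambda>z. z powr (1 - s) + (s - 1) * complex_of_real a powr (-s) * z"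
  have S: "\<exists>t. z = of_real t \<and> a \<le> t \<and> t \<le> a + 1" if "z \<in> ?S" for z
    using that a by (auto simp: closed_segment_of_real closed_segment_eq_real_ivl simp del: of_real_add)
  have "norm (?g (complex_of_real (a + 1)) - ?g (complex_of_real a))
      \<le> norm (s - 1) * norm s * a powr (- Re s - 1) * norm (complex_of_real (a + 1) - complex_of_real a)"
  proof (rule field_differentiable_bound[where f = ?g and f' = "\<lambda>z. (1 - s) * z powr (- s) + (s - 1) * complex_of_real a powr (-s)" and S = ?S])
    fix z assume "z \<in> ?S"
    then obtain t where t: "z = of_real t" "a \<le> t" "t \<le> a + 1" using S by blast
    have "((\<lambda>z. z powr (1-s)) has_field_derivative (1 - s) * z powr (1 - s - 1)) (at z within ?S)"
      using t a by (intro has_field_derivative_at_within[OF has_field_derivative_powr]) auto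
    moreover have "z \<notin> \<real>\<^sub>\<le>\<^sub>0" using t a by auto
    ultimately show "(?g has_field_derivative (1 - s) * z powr (- s) + (s - 1) * complex_of_real a powr (-s)) (at z within ?S)"
      by (auto intro!: derivative_eq_intros)
    have "norm ((1 - s) * z powr (- s) + (s - 1) * complex_of_real a powr (-s)) =
       norm ((s - 1) * (z powr (-s) - complex_of_real a powr (-s)))"
      by (subst norm_minus_cancel[symmetric]) (simp add: algebra_simps)
    also have "\<dots> \<le> norm (s - 1) * (norm s * a powr (- Re s - 1))"
      unfolding norm_mult t(1) by (intro mult_left_mono powr_diff_bound) (use t a s in auto)
    finally show "norm ((1 - s) * z powr (- s) + (s - 1) * complex_of_real a powr (-s)) \<le> norm (s - 1) * norm s * a powr (- Re s - 1)"
      by simp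
  qed auto
  then show ?thesis by (simp add: algebra_simps)
qed

section \<open>Continuation across the line Re s = 1\<close>

definition ks :: "nat \<Rightarrow> complex \<Rightarrow> complex" where
  "ks n s = of_nat (Suc n) powr (-s)"

text \<open>The result of summation by parts, with \<open>R\<close> the partial sums. Differences of
  \<open>ks\<close> gain a factor 1/n, so bounded \<open>R\<close> give convergence for Re s >
  0.\<close>

definition abel_series :: "(nat \<Rightarrow> complex) \<Rightarrow> complex \<Rightarrow> complex" where
  "abel_series R s = (\<Sum>n. R (Suc n) * (ks n s - ks (Suc n) s))"

text \<open>\<open>s - 1\<close> times the difference of (n + 1)^(-s) and the integral of x^(-s)
  over [n + 1, n + 2]. For Re s > 1 the integrals, times \<open>s - 1\<close>, add up to 1, which is
  the leading 1 of \<open>zeta1\<close>.\<close>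

definition zeta_terms :: "nat \<Rightarrow> complex \<Rightarrow> complex" where
  "zeta_terms n s = (s - 1) * ks n s - of_nat (Suc n) powr (1 - s) + of_nat (Suc (Suc n)) powr (1 - s)"

text \<open>This is \<open>(s - 1) \<zeta>(s)\<close>, continued to the half-plane \<open>Re s > 0\<close>.\<close>
definition zeta1 :: "complex \<Rightarrow> complex" where
  "zeta1 s = 1 + (\<Sum>n. zeta_terms n s)"

lemma ks_holomorphic [holomorphic_intros]: "ks n holomorphic_on S"
  unfolding ks_def by (intro holomorphic_intros) 

lemma norm_ks: "norm (ks n s) = real (Suc n) powr (- Re s)"
  unfolding ks_def by (subst norm_of_nat_powr) auto

lemma norm_ks_diff: "Re s > 0 \<Longrightarrow> norm (ks n s - ks (Suc n) s) \<le> norm s * real (Suc n) powr (- Re s - 1)"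
  using powr_diff_bound[of "real (Suc n)" "real (Suc (Suc n))" s]
  by (simp add: ks_def norm_minus_commute add_ac)

lemma norm_zeta_terms: "Re s > 0 \<Longrightarrow> norm (zeta_terms n s) \<le> norm (s - 1) * norm s * real (Suc n) powr (- Re s - 1)"
  using powr_integral_bound[of "real (Suc n)" s]
  by (simp add: zeta_terms_def ks_def add_ac)

lemma summable_Suc_powr: "a < -1 \<Longrightarrow> summable (\<lambda>n. real (Suc n) powr a)"
  by (subst summable_Suc_iff) (simp add: summable_real_powr_iff)

lemma Suc_powr_mono: "a \<le> b \<Longrightarrow> real (Suc n) powr a \<le> real (Suc n) powr b"
  by (intro powr_mono) auto

lemma zeta_terms_holomorphic: "zeta_terms n holomorphic_on S"
  unfolding zeta_terms_def by (intro holomorphic_intros)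

lemma zeta1_holomorphic: "zeta1 holomorphic_on {s. Re s > 0}"
  unfolding zeta1_def
proof (intro holomorphic_intros holomorphic_suminf_local open_Re_gt zeta_terms_holomorphic)
  fix z assume "z \<in> {s. Re s > 0}"
  then have z: "Re z > 0" by simp
  define d where "d = Re z / 2"
  define C where "C = (norm z + d + 1) * (norm z + d)"
  have d: "d > 0" using z by (simp add: d_def)
  have "norm (zeta_terms n w) \<le> C * real (Suc n) powr (- d - 1)" if w: "w \<in> cball z d" for n w
  proof -
    have "Re w \<ge> d" using Re_le_cball(1)[OF w] by (simp add: d_def)
    have "norm (w - 1) \<le> norm w + 1" using norm_triangle_ineq4[of w 1] by simp
    then have "norm (w - 1) \<le> norm z + d + 1" "norm w \<le> norm z + d"
      using Re_le_cball(2)[OF w] by auto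
    then have "norm (w - 1) * norm w \<le> C" unfolding C_def using d by (intro mult_mono) auto
    then have "norm (w - 1) * norm w * real (Suc n) powr (- Re w - 1) \<le> C * real (Suc n) powr (- d - 1)"
      using \<open>Re w \<ge> d\<close> by (intro mult_mono Suc_powr_mono) (auto intro: order_trans[OF _ \<open>_ \<le> C\<close>])
    then show ?thesis using norm_zeta_terms[of w n] \<open>Re w \<ge> d\<close> d by simp
  qed
  moreover have "summable (\<lambda>n. C * real (Suc n) powr (- d - 1))"
    using d by (intro summable_mult summable_Suc_powr) auto
  moreover have "cball z d \<subseteq> {s. Re s > 0}" by (rule cball_subset_halfplane) (use z in \<open>simp add: d_def\<close>)
  ultimately show "\<exists>d>0. \<exists>M. cball z d \<subseteq> {s. Re s > 0} \<and> summable M \<and> (\<forall>n. \<forall>w\<in>cball z d. norm (zeta_terms n w) \<le> M n)"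
    using d by blast
qed

lemma zeta1_1: "zeta1 1 = 1"
  by (simp add: zeta1_def zeta_terms_def del: of_nat_Suc)

lemma abel_series_holomorphic:
  assumes B: "\<And>n. norm (R n) \<le> B"
  shows "abel_series R holomorphic_on {s. Re s > 0}"
  unfolding abel_series_def
proof (intro holomorphic_suminf_local open_Re_gt)
  have B0: "B \<ge> 0" using B[of 0] norm_ge_zero order_trans by blast
  show "(\<lambda>s. R (Suc n) * (ks n s - ks (Suc n) s)) holomorphic_on {s. Re s > 0}" for n
    by (intro holomorphic_intros)
  fix z assume "z \<in> {s. Re s > 0}"
  then have z: "Re z > 0" by simp
  define d where "d = Re z / 2"
  define C where "C = B * (norm z + d)"
  have d: "d > 0" using z by (simp add: d_def)
  have "norm (R (Suc n) * (ks n w - ks (Suc n) w)) \<le> C * real (Suc n) powr (- d - 1)" if w: "w \<in> cball z d" for n w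
  proof -
    have Rw: "Re w \<ge> d" using Re_le_cball(1)[OF w] by (simp add: d_def)
    have "norm (ks n w - ks (Suc n) w) \<le> norm w * real (Suc n) powr (- Re w - 1)"
      using norm_ks_diff[of w n] Rw d by simp
    also have "\<dots> \<le> (norm z + d) * real (Suc n) powr (- d - 1)"
      using Rw d by (intro mult_mono Suc_powr_mono Re_le_cball(2)[OF w]) auto
    finally show ?thesis unfolding norm_mult C_def mult.assoc using B B0 by (intro mult_mono) auto
  qed
  moreover have "summable (\<lambda>n. C * real (Suc n) powr (- d - 1))"
    using d by (intro summable_mult summable_Suc_powr) auto
  moreover have "cball z d \<subseteq> {s. Re s > 0}" by (rule cball_subset_halfplane) (use z in \<open>simp add: d_def\<close>)
  ultimately show "\<exists>d>0. \<exists>M. cball z d \<subseteq> {s. Re s > 0} \<and> summable M \<and> (\<forall>n. \<forall>w\<in>cball z d. norm (R (Suc n) * (ks n w - ks (Suc n) w)) \<le> M n)"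
    using d by blast
qed

lemma summable_ks: 
  assumes "Re s > 1" shows "summable (\<lambda>n. norm (ks n s))" "summable (\<lambda>n. ks n s)"
proof -
  show *: "summable (\<lambda>n. norm (ks n s))" unfolding norm_ks using assms by (intro summable_Suc_powr) auto
  show "summable (\<lambda>n. ks n s)" by (rule summable_norm_cancel[OF *])
qed

lemma ks_tendsto_0:
  assumes "Re s > 0" shows "(\<lambda>n. ks n s) \<longlonglongrightarrow> 0"
proof (rule tendsto_norm_zero_cancel)
  have "(\<lambda>n. real n powr (- Re s)) \<longlonglongrightarrow> 0" using assms by real_asymp
  then show "(\<lambda>n. norm (ks n s)) \<longlonglongrightarrow> 0" unfolding norm_ks by (rule LIMSEQ_Suc)
qed

lemma zeta1_eq:
  assumes s: "Re s > 1"
  shows "zeta1 s = (s - 1) * (\<Sum>n. ks n s)"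
proof -
  let ?p = "\<lambda>n. of_nat (Suc n) powr (1 - s) :: complex"
  have "?p \<longlonglongrightarrow> 0"
  proof (rule tendsto_norm_zero_cancel)
    have "(\<lambda>n. real n powr (1 - Re s)) \<longlonglongrightarrow> 0" using s by real_asymp
    then have "(\<lambda>n. real (Suc n) powr (1 - Re s)) \<longlonglongrightarrow> 0" by (rule LIMSEQ_Suc)
    then show "(\<lambda>n. norm (?p n)) \<longlonglongrightarrow> 0" by (subst norm_of_nat_powr) auto
  qed
  then have "(\<lambda>n. ?p (Suc n) - ?p n) sums (0 - ?p 0)" by (rule telescope_sums)
  moreover have "(\<lambda>n. (s - 1) * ks n s) sums ((s - 1) * (\<Sum>n. ks n s))"
    by (intro sums_mult summable_sums summable_ks s)
  ultimately have "(\<lambda>n. (s - 1) * ks n s + (?p (Suc n) - ?p n)) sums ((s - 1) * (\<Sum>n. ks n s) + (0 - ?p 0))"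
    by (intro sums_add)
  moreover have "(s - 1) * ks n s + (?p (Suc n) - ?p n) = zeta_terms n s" for n
    by (simp add: zeta_terms_def)
  ultimately have "(\<Sum>n. zeta_terms n s) = (s - 1) * (\<Sum>n. ks n s) - 1" by (simp add: sums_iff)
  then show ?thesis by (simp add: zeta1_def)
qed

text \<open>Here \<open>c\<close> will be the mean value of \<open>b\<close>. Subtracting it leaves
  bounded partial sums, so the remainder continues to Re s > 0 and the pole at 1 is carried by
  \<open>c\<close> times the zeta function alone.\<close>

lemma abel_series_eq:
  assumes s: "Re s > 1" and B: "\<And>n. norm (\<Sum>k<n. b k - c) \<le> B" and b: "\<And>n. norm (b n) \<le> 1"
  shows "(\<Sum>n. b n * ks n s) = c * (\<Sum>n. ks n s) + abel_series (\<lambda>n. \<Sum>k<n. b k - c) s"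
proof -
  let ?R = "\<lambda>n. \<Sum>k<n. b k - c"
  have part: "(\<Sum>n<N. (b n - c) * ks n s) = ?R N * ks N s + (\<Sum>n<N. ?R (Suc n) * (ks n s - ks (Suc n) s))" for N
    by (induction N) (simp_all add: algebra_simps)
  have lim0: "(\<lambda>N. ?R N * ks N s) \<longlonglongrightarrow> 0"
  proof (rule Lim_null_comparison)
    show "\<forall>\<^sub>F N in sequentially. norm (?R N * ks N s) \<le> B * norm (ks N s)"
      by (intro always_eventually allI) (simp only: norm_mult, intro mult_right_mono B, simp)
    show "(\<lambda>N. B * norm (ks N s)) \<longlonglongrightarrow> 0"
      using tendsto_norm_zero[OF ks_tendsto_0] s by (intro tendsto_mult_right_zero) auto
  qed
  have sb: "summable (\<lambda>n. b n * ks n s)"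
    by (rule summable_comparison_test'[OF summable_ks(1)[OF s], of 0]) (use b in \<open>simp add: norm_mult mult_left_le_one_le\<close>)
  have "(\<lambda>n. b n * ks n s - c * ks n s) sums ((\<Sum>n. b n * ks n s) - c * (\<Sum>n. ks n s))"
    by (intro sums_diff sums_mult summable_sums sb summable_ks(2) s)
  then have "(\<lambda>N. \<Sum>n<N. (b n - c) * ks n s) \<longlonglongrightarrow> (\<Sum>n. b n * ks n s) - c * (\<Sum>n. ks n s)"
    by (simp add: sums_def algebra_simps)
  then have "(\<lambda>N. (\<Sum>n<N. (b n - c) * ks n s) - ?R N * ks N s) \<longlonglongrightarrow> (\<Sum>n. b n * ks n s) - c * (\<Sum>n. ks n s) - 0"
    by (intro tendsto_diff lim0)
  then have "(\<lambda>n. ?R (Suc n) * (ks n s - ks (Suc n) s)) sums ((\<Sum>n. b n * ks n s) - c * (\<Sum>n. ks n s))"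
    unfolding part by (simp add: sums_def)
  then show ?thesis by (simp add: abel_series_def sums_iff)
qed

section \<open>Dirichlet L-functions\<close>

definition Lser :: "(nat \<Rightarrow> complex) \<Rightarrow> complex \<Rightarrow> complex" where
  "Lser \<xi> s = (\<Sum>n. \<xi> (Suc n) * ks n s)"

definition char_mean :: "nat \<Rightarrow> (nat \<Rightarrow> complex) \<Rightarrow> complex" where
  "char_mean m \<xi> = (\<Sum>a<m. \<xi> a) / of_nat m"

definition char_resid :: "nat \<Rightarrow> (nat \<Rightarrow> complex) \<Rightarrow> nat \<Rightarrow> complex" where
  "char_resid m \<xi> N = (\<Sum>k<N. \<xi> (Suc k) - char_mean m \<xi>)"

text \<open>The \<open>L\<close>-function continued to Re s > 0. For the principal character the
  factor \<open>s - 1\<close> removes the pole; for the others the mean value is 0 and the zeta part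
  disappears.\<close>

definition Lcont :: "nat \<Rightarrow> (nat \<Rightarrow> complex) \<Rightarrow> complex \<Rightarrow> complex" where
  "Lcont m \<xi> s = (if \<xi> = char0 m
     then char_mean m \<xi> * zeta1 s + (s - 1) * abel_series (char_resid m \<xi>) s
     else abel_series (char_resid m \<xi>) s)"

lemma char_mean_eq:
  assumes "m > 0" "\<xi> \<in> dchars m"
  shows "char_mean m \<xi> = (if \<xi> = char0 m then of_nat (totient m) / of_nat m else 0)"
  unfolding char_mean_def using dchars_sum_residues[OF assms] by simp

text \<open>Once the mean is subtracted, the sum over a full period vanishes, so the residual sums
  are periodic and take finitely many values.\<close>

lemma char_resid_bounded:
  assumes m: "m > 0" and \<xi>: "\<xi> \<in> dchars m"
  shows "\<exists>B. \<forall>N. norm (char_resid m \<xi> N) \<le> B"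
proof -
  have "(\<Sum>k<m. \<xi> (Suc k)) = (\<Sum>k<Suc m. \<xi> k) - \<xi> 0" by (subst sum.lessThan_Suc_shift) simp
  also have "\<xi> 0 = \<xi> m" using dchars_mod[OF \<xi>, of m] by simp
  finally have s: "(\<Sum>k<m. \<xi> (Suc k)) = (\<Sum>k<m. \<xi> k)" by simp
  have per: "char_resid m \<xi> (m + N) = char_resid m \<xi> N" for N
  proof -
    have "char_resid m \<xi> (m + N) = char_resid m \<xi> m + (\<Sum>k<N. \<xi> (Suc (m + k)) - char_mean m \<xi>)"
      unfolding char_resid_def
      by (induction N) (simp_all add: add.assoc)
    also have "(\<lambda>k. \<xi> (Suc (m + k))) = (\<lambda>k. \<xi> (Suc k))"
    proof
      fix k
      have "[m + Suc k = Suc k] (mod m)" by (simp add: cong_def del: add_Suc_right)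
      then show "\<xi> (Suc (m + k)) = \<xi> (Suc k)" using dchars_cong[OF \<xi>] by simp
    qed
    also have "char_resid m \<xi> m = 0"
      unfolding char_resid_def sum_subtractf s using m by (simp add: char_mean_def)
    finally show ?thesis by (simp add: char_resid_def)
  qed
  have per': "char_resid m \<xi> (m * q + r) = char_resid m \<xi> r" for q r
    by (induction q) (simp_all add: per add.assoc)
  have "norm (char_resid m \<xi> N) \<le> Max ((\<lambda>N. norm (char_resid m \<xi> N)) ` {..<m})" for N
  proof -
    have "char_resid m \<xi> N = char_resid m \<xi> (N mod m)" using per'[of "N div m" "N mod m"] by simp
    then show ?thesis using m by (auto intro!: Max_ge)
  qed
  then show ?thesis by blast
qed

lemma Lcont_holomorphic:
  assumes m: "m > 0" and \<xi>: "\<xi> \<in> dchars m"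
  shows "Lcont m \<xi> holomorphic_on {s. Re s > 0}"
proof -
  obtain B where "\<And>N. norm (char_resid m \<xi> N) \<le> B" using char_resid_bounded[OF assms] by blast
  from abel_series_holomorphic[OF this] 
  have *: "abel_series (char_resid m \<xi>) holomorphic_on {s. Re s > 0}" .
  show ?thesis
  proof (cases "\<xi> = char0 m")
    case True
    have "(\<lambda>s. char_mean m \<xi> * zeta1 s + (s - 1) * abel_series (char_resid m \<xi>) s) holomorphic_on {s. Re s > 0}"
      by (intro holomorphic_intros * zeta1_holomorphic)
    then show ?thesis using True by (simp add: Lcont_def[abs_def])
  next
    case False
    then show ?thesis using * by (simp add: Lcont_def[abs_def])
  qed
qed

lemma Lcont_eq:
  assumes m: "m > 0" and \<xi>: "\<xi> \<in> dchars m" and s: "Re s > 1"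
  shows "Lcont m \<xi> s = (if \<xi> = char0 m then (s - 1) * Lser \<xi> s else Lser \<xi> s)"
proof -
  obtain B where B: "\<And>N. norm (char_resid m \<xi> N) \<le> B" using char_resid_bounded[OF m \<xi>] by blast
  have L: "Lser \<xi> s = char_mean m \<xi> * (\<Sum>n. ks n s) + abel_series (char_resid m \<xi>) s"
    unfolding Lser_def
    using abel_series_eq[OF s, of "\<lambda>n. \<xi> (Suc n)" "char_mean m \<xi>" B] B dchars_norm[OF \<xi> m]
    by (simp add: char_resid_def[abs_def])
  show ?thesis
  proof (cases "\<xi> = char0 m")
    case True
    then show ?thesis unfolding Lcont_def L zeta1_eq[OF s] by (simp add: algebra_simps)
  next
    case False
    then show ?thesis unfolding Lcont_def L char_mean_eq[OF m \<xi>] by simp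
  qed
qed

lemma Lcont_char0_1: "m > 0 \<Longrightarrow> Lcont m (char0 m) 1 = of_nat (totient m) / of_nat m"
  using char_mean_eq[OF _ char0_in, of m] by (simp add: Lcont_def zeta1_1)

section \<open>Euler products by sieving\<close>

text \<open>The term at \<open>n = 0\<close> is 0 because \<open>0 powr z = 0\<close>; this matters
  for \<open>m = 1\<close>, where the character is 1 at 0.\<close>

definition dterm :: "(nat \<Rightarrow> complex) \<Rightarrow> complex \<Rightarrow> nat \<Rightarrow> complex" where
  "dterm \<xi> s n = \<xi> n * of_nat n powr (- s)"

lemma dterm_0 [simp]: "dterm \<xi> s 0 = 0"
  by (simp add: dterm_def)

lemma norm_dterm_le:
  assumes "m > 0" "\<xi> \<in> dchars m" "Re s \<ge> a"
  shows "norm (dterm \<xi> s n) \<le> real n powr (- a)"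
proof (cases "n = 0")
  case False
  have "norm (dterm \<xi> s n) \<le> 1 * real n powr (- Re s)"
    unfolding dterm_def norm_mult using False dchars_norm[OF assms(2,1)]
    by (intro mult_mono) (simp_all add: norm_of_nat_powr)
  also have "1 * real n powr (- Re s) \<le> real n powr (- a)"
    using False assms(3) by (simp add: powr_mono)
  finally show ?thesis .
qed auto

lemma dterm_mult:
  assumes "\<xi> \<in> dchars m" shows "dterm \<xi> s (q * n) = dterm \<xi> s q * dterm \<xi> s n"
  unfolding dterm_def by (simp add: dchars_mult[OF assms] powr_times_real)

lemma dterm_norm_summable:
  assumes "m > 0" "\<xi> \<in> dchars m" "Re s > 1"
  shows "summable (\<lambda>n. norm (dterm \<xi> s n))"
  by (rule summable_comparison_test'[of "\<lambda>n. real n powr (- Re s)" 0])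
     (use norm_dterm_le[OF assms(1,2), of "Re s" s] assms(3) in \<open>auto simp: summable_real_powr_iff\<close>)

lemma dterm_summable_on:
  assumes "m > 0" "\<xi> \<in> dchars m" "Re s > 1"
  shows "dterm \<xi> s summable_on A"
  using norm_summable_imp_summable_on[OF dterm_norm_summable[OF assms]] summable_on_subset_banach
  by blast

lemma infsum_dterm:
  assumes "m > 0" "\<xi> \<in> dchars m" "Re s > 1"
  shows "infsum (dterm \<xi> s) UNIV = Lser \<xi> s"
proof -
  have sm: "summable (dterm \<xi> s)" using dterm_norm_summable[OF assms] by (rule summable_norm_cancel)
  have "infsum (dterm \<xi> s) UNIV = (\<Sum>n. dterm \<xi> s n)"
    using norm_summable_imp_has_sum[OF dterm_norm_summable[OF assms] summable_sums[OF sm]] by (rule infsumI)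
  also have "\<dots> = (\<Sum>n. dterm \<xi> s (Suc n))" using suminf_split_head[OF sm] by simp
  finally show ?thesis by (simp add: Lser_def dterm_def ks_def)
qed

text \<open>One step of the sieve of Eratosthenes: the remaining multiples of \<open>q\<close> are
  \<open>q\<close> times the remaining integers, so complete multiplicativity makes their sum
  \<open>dterm \<xi> s q\<close> times the whole.\<close>

lemma sieve_prod:
  assumes m: "m > 0" and \<xi>: "\<xi> \<in> dchars m" and s: "Re s > 1"
    and A: "finite A" "\<And>p. p \<in> A \<Longrightarrow> prime p"
  shows "infsum (dterm \<xi> s) {n. \<forall>p\<in>A. \<not> p dvd n} = Lser \<xi> s * (\<Prod>p\<in>A. 1 - dterm \<xi> s p)"
  using A
proof (induction A rule: finite_induct)
  case empty
  then show ?case using infsum_dterm[OF m \<xi> s] by simp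
next
  case (insert q A)
  let ?B = "{n. \<forall>p\<in>A. \<not> p dvd n}" and ?C = "{n. \<forall>p\<in>insert q A. \<not> p dvd n}"
  have q: "prime q" and Ap: "\<And>p. p \<in> A \<Longrightarrow> prime p" using insert by auto
  have img: "?B - ?C = (\<lambda>n. q * n) ` ?B"
  proof (intro equalityI subsetI)
    fix n assume n: "n \<in> ?B - ?C"
    then have "q dvd n" by auto
    then obtain k where k: "n = q * k" by blast
    then have "k \<in> ?B" using n by auto
    then show "n \<in> (\<lambda>n. q * n) ` ?B" using k by blast
  next
    fix n assume "n \<in> (\<lambda>n. q * n) ` ?B"
    then obtain k where k: "n = q * k" "k \<in> ?B" by blast
    have "\<not> p dvd n" if p: "p \<in> A" for p
    proof
      assume "p dvd n"
      then have "p dvd q" using k p Ap[OF p] by (auto simp: prime_dvd_mult_iff)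
      then have "p = q" using q Ap[OF p] primes_dvd_imp_eq by blast
      then show False using p insert by auto
    qed
    then show "n \<in> ?B - ?C" using k by auto
  qed
  have "infsum (dterm \<xi> s) ((\<lambda>n. q * n) ` ?B) = infsum (dterm \<xi> s \<circ> (\<lambda>n. q * n)) ?B"
    by (rule infsum_reindex) (use q in \<open>auto intro!: inj_onI dest: prime_gt_0_nat\<close>)
  also have "\<dots> = dterm \<xi> s q * infsum (dterm \<xi> s) ?B"
    by (simp add: o_def dterm_mult[OF \<xi>] infsum_cmult_right')
  finally have *: "infsum (dterm \<xi> s) (?B - ?C) = dterm \<xi> s q * infsum (dterm \<xi> s) ?B"
    using img by simp
  have CB: "?C \<subseteq> ?B" by auto
  have "infsum (dterm \<xi> s) (?B - ?C) = infsum (dterm \<xi> s) ?B - infsum (dterm \<xi> s) ?C"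
    by (rule infsum_Diff[OF _ _ CB]) (rule dterm_summable_on[OF m \<xi> s])+
  then have "infsum (dterm \<xi> s) ?C = (1 - dterm \<xi> s q) * infsum (dterm \<xi> s) ?B"
    using * by (simp add: algebra_simps)
  also have "infsum (dterm \<xi> s) ?B = Lser \<xi> s * (\<Prod>p\<in>A. 1 - dterm \<xi> s p)"
    using insert by auto
  finally show ?case using insert by (simp add: mult_ac)
qed

definition primes_le :: "nat \<Rightarrow> nat set" where
  "primes_le N = {p. prime p \<and> p \<le> N}"

lemma finite_primes_le [simp]: "finite (primes_le N)"
  by (rule finite_subset[of _ "{..N}"]) (auto simp: primes_le_def)

lemma primes_le_gt_1: "p \<in> primes_le N \<Longrightarrow> p > 1"
  by (auto simp: primes_le_def prime_gt_Suc_0_nat)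

text \<open>After the multiples of all primes up to \<open>N\<close> are removed, only 1 and
  integers above \<open>N\<close> survive, so the error is at most the tail of a convergent series.
  The bound depends only on \<open>a\<close>, which gives uniformity in \<open>s\<close>.\<close>

lemma sieve_bound:
  assumes m: "m > 0" and \<xi>: "\<xi> \<in> dchars m" and s: "Re s \<ge> a" and a: "a > 1" and N: "N \<ge> 2"
  shows "norm (Lser \<xi> s * (\<Prod>p\<in>primes_le N. 1 - dterm \<xi> s p) - 1)
       \<le> (\<Sum>n. real n powr (- a)) - (\<Sum>n\<le>N. real n powr (- a))"
proof -
  let ?B = "{n. \<forall>p\<in>primes_le N. \<not> p dvd n}" and ?g = "\<lambda>n. real n powr (- a)"
  have s1: "Re s > 1" using s a by simp
  have gs: "summable ?g" using a by (simp add: summable_real_powr_iff)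
  then have gson: "?g summable_on A" for A
    using norm_summable_imp_summable_on[of ?g] summable_on_subset_banach by fastforce
  have sub: "?B - {1} \<subseteq> UNIV - {..N}"
  proof
    fix n assume n: "n \<in> ?B - {1}"
    then obtain p where p: "prime p" "p dvd n" using prime_factor_nat[of n] by auto
    \<comment> \<open>This is where \<open>N \<ge> 2\<close> enters: 0 is sieved out as a multiple
      of 2.\<close>
    have "2 \<in> primes_le N" using N by (simp add: primes_le_def)
    then have "n \<noteq> 0" using n by (cases "n = 0") auto
    then have "p \<le> n" using p by (simp add: dvd_imp_le)
    then show "n \<in> UNIV - {..N}" using n p by (force simp: primes_le_def)
  qed
  have 1: "1 \<in> ?B" using primes_le_gt_1 by fastforce
  have "infsum (dterm \<xi> s) (?B - {1}) = infsum (dterm \<xi> s) ?B - infsum (dterm \<xi> s) {1}"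
    by (rule infsum_Diff) (use 1 in \<open>auto intro: dterm_summable_on[OF m \<xi> s1]\<close>)
  also have "infsum (dterm \<xi> s) {1} = 1" using dchars_1[OF \<xi>] by (simp add: dterm_def)
  also have "infsum (dterm \<xi> s) ?B = Lser \<xi> s * (\<Prod>p\<in>primes_le N. 1 - dterm \<xi> s p)"
    by (rule sieve_prod[OF m \<xi> s1]) (auto simp: primes_le_def)
  finally have "norm (Lser \<xi> s * (\<Prod>p\<in>primes_le N. 1 - dterm \<xi> s p) - 1) = norm (infsum (dterm \<xi> s) (?B - {1}))"
    by simp
  also have "\<dots> \<le> infsum (\<lambda>n. ?g n) (?B - {1})"
    by (rule norm_infsum_le[OF has_sum_infsum has_sum_infsum])
       (auto intro: dterm_summable_on[OF m \<xi> s1] gson norm_dterm_le[OF m \<xi> s])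
  also have "\<dots> \<le> infsum ?g (UNIV - {..N})"
    by (rule infsum_mono_neutral) (use sub in \<open>auto intro: gson\<close>)
  also have "\<dots> = infsum ?g UNIV - infsum ?g {..N}"
    by (rule infsum_Diff) (auto intro: gson)
  also have "infsum ?g UNIV = (\<Sum>n. ?g n)"
    by (rule infsumI, rule norm_summable_imp_has_sum) (use gs in \<open>auto simp: summable_sums\<close>)
  finally show ?thesis by simp
qed

lemma sieve_uniform_limit:
  assumes m: "m > 0" and \<xi>: "\<xi> \<in> dchars m" and a: "a > 1"
  shows "uniform_limit {s. Re s > a} (\<lambda>N s. Lser \<xi> s * (\<Prod>p\<in>primes_le N. 1 - dterm \<xi> s p)) (\<lambda>_. 1) sequentially"
proof (rule uniform_limitI)
  fix e :: real assume e: "e > 0"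
  let ?g = "\<lambda>n. real n powr (- a)"
  have gs: "summable ?g" using a by (simp add: summable_real_powr_iff)
  have "(\<lambda>N. (\<Sum>n. ?g n) - (\<Sum>n\<le>N. ?g n)) \<longlonglongrightarrow> (\<Sum>n. ?g n) - (\<Sum>n. ?g n)"
    by (intro tendsto_diff tendsto_const summable_LIMSEQ' gs)
  then have "eventually (\<lambda>N. (\<Sum>n. ?g n) - (\<Sum>n\<le>N. ?g n) < e) sequentially"
    using e by (simp add: order_tendsto_iff)
  then show "\<forall>\<^sub>F N in sequentially. \<forall>s\<in>{s. Re s > a}. dist (Lser \<xi> s * (\<Prod>p\<in>primes_le N. 1 - dterm \<xi> s p)) 1 < e"
    using eventually_ge_at_top[of 2]
  proof eventually_elim
    case (elim N)
    show ?case
    proof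
      fix s assume "s \<in> {s. Re s > a}"
      then show "dist (Lser \<xi> s * (\<Prod>p\<in>primes_le N. 1 - dterm \<xi> s p)) 1 < e"
        using sieve_bound[OF m \<xi> _ a, of s N] elim by (simp add: dist_norm)
    qed
  qed
qed

text \<open>A zero would make the sieved product 0 for every \<open>N\<close>, although it tends to
  1.\<close>

lemma Lser_nonzero:
  assumes m: "m > 0" and \<xi>: "\<xi> \<in> dchars m" and s: "Re s > 1"
  shows "Lser \<xi> s \<noteq> 0"
proof
  assume 0: "Lser \<xi> s = 0"
  obtain a where a: "1 < a" "a < Re s" using s dense by blast
  have "(\<lambda>N. Lser \<xi> s * (\<Prod>p\<in>primes_le N. 1 - dterm \<xi> s p)) \<longlonglongrightarrow> 1"
    by (rule tendsto_uniform_limitI[OF sieve_uniform_limit[OF m \<xi> a(1)]]) (use a in auto)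
  then show False using 0 by (simp add: LIMSEQ_const_iff)
qed

lemma Lser_holomorphic:
  assumes m: "m > 0" and \<xi>: "\<xi> \<in> dchars m"
  shows "Lser \<xi> holomorphic_on {s. Re s > 1}"
proof (cases "\<xi> = char0 m")
  case True
  have "(\<lambda>s. Lcont m \<xi> s / (s - 1)) holomorphic_on {s. Re s > 1}"
    by (intro holomorphic_intros holomorphic_on_subset[OF Lcont_holomorphic[OF m \<xi>]]) auto
  then show ?thesis
  proof (rule holomorphic_transform)
    fix s assume "s \<in> {s. Re s > 1}"
    then have "Re s > 1" "s \<noteq> 1" by auto
    then show "Lcont m \<xi> s / (s - 1) = Lser \<xi> s" using True Lcont_eq[OF m \<xi>, of s] by simp
  qed
next
  case False
  have "Lcont m \<xi> holomorphic_on {s. Re s > 1}"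
    by (rule holomorphic_on_subset[OF Lcont_holomorphic[OF m \<xi>]]) auto
  then show ?thesis by (rule holomorphic_transform) (use False in \<open>auto simp: Lcont_eq[OF m \<xi>]\<close>)
qed

lemma norm_dterm_lt_1:
  assumes m: "m > 0" and \<xi>: "\<xi> \<in> dchars m" and s: "Re s > 0" and p: "p > 1"
  shows "norm (dterm \<xi> s p) < 1"
proof -
  have "norm (dterm \<xi> s p) \<le> real p powr (- Re s)" by (rule norm_dterm_le[OF m \<xi>]) simp
  also have "\<dots> < real p powr 0" by (rule powr_less_mono) (use p s in auto)
  finally show ?thesis using p by simp
qed

section \<open>Logarithmic derivatives of the Euler products\<close>

lemma dterm_deriv:
  assumes "p > 0"
  shows "((\<lambda>s. dterm \<xi> s p) has_field_derivative - of_real (ln (real p)) * dterm \<xi> s p) (at s)"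
proof -
  have "dterm \<xi> s p = \<xi> p * exp (- s * of_real (ln (real p)))" for s
    using assms by (simp add: dterm_def powr_def)
  then show ?thesis by (auto intro!: derivative_eq_intros)
qed

definition euler_logderiv :: "(nat \<Rightarrow> complex) \<Rightarrow> nat \<Rightarrow> complex \<Rightarrow> complex" where
  "euler_logderiv \<xi> p s = of_real (ln (real p)) * (dterm \<xi> s p / (1 - dterm \<xi> s p))"

lemma euler_prod_deriv:
  assumes m: "m > 0" and \<xi>: "\<xi> \<in> dchars m" and s: "Re s > 0" and A: "finite A" "\<And>p. p \<in> A \<Longrightarrow> p > 1"
  shows "((\<lambda>s. \<Prod>p\<in>A. 1 - dterm \<xi> s p) has_field_derivative
     (\<Prod>p\<in>A. 1 - dterm \<xi> s p) * (\<Sum>p\<in>A. euler_logderiv \<xi> p s)) (at s)"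
  using A
proof (induction A rule: finite_induct)
  case (insert q A)
  have q: "1 - dterm \<xi> s q \<noteq> 0" using norm_dterm_lt_1[OF m \<xi> s, of q] insert(4)[of q] by auto
  have dq: "((\<lambda>s. 1 - dterm \<xi> s q) has_field_derivative of_real (ln (real q)) * dterm \<xi> s q) (at s)"
    using DERIV_diff[OF DERIV_const[of 1] dterm_deriv[of q \<xi> s]] insert(4)[of q] by simp
  have "((\<lambda>s. (1 - dterm \<xi> s q) * (\<Prod>p\<in>A. 1 - dterm \<xi> s p)) has_field_derivative
     (of_real (ln (real q)) * dterm \<xi> s q) * (\<Prod>p\<in>A. 1 - dterm \<xi> s p) + 
     ((\<Prod>p\<in>A. 1 - dterm \<xi> s p) * (\<Sum>p\<in>A. euler_logderiv \<xi> p s)) * (1 - dterm \<xi> s q)) (at s)"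
    by (intro DERIV_mult dq insert.IH insert) auto
  also have "(of_real (ln (real q)) * dterm \<xi> s q) = (1 - dterm \<xi> s q) * euler_logderiv \<xi> q s"
    using q by (simp add: euler_logderiv_def)
  finally show ?case using insert by (simp add: algebra_simps)
qed auto

text \<open>The sieved products tend uniformly to 1, so their logarithmic derivatives tend to 0.
  Each of these is the logarithmic derivative of \<open>Lser \<xi>\<close> plus a finite sum of
  \<open>euler_logderiv\<close>.\<close>

lemma Lser_logderiv:
  assumes m: "m > 0" and \<xi>: "\<xi> \<in> dchars m" and s: "Re s > 1"
  shows "(\<lambda>N. \<Sum>p\<in>primes_le N. euler_logderiv \<xi> p s) \<longlonglongrightarrow> - deriv (Lser \<xi>) s / Lser \<xi> s"
proof -
  obtain a where a: "1 < a" "a < Re s" using s dense by blast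
  let ?P = "\<lambda>N s. \<Prod>p\<in>primes_le N. 1 - dterm \<xi> s p"
  let ?E = "\<lambda>N s. Lser \<xi> s * ?P N s" and ?Q = "\<lambda>N. \<Sum>p\<in>primes_le N. euler_logderiv \<xi> p s"
  have Pd: "(?P N has_field_derivative ?P N z * (\<Sum>p\<in>primes_le N. euler_logderiv \<xi> p z)) (at z)" if "Re z > 1" for N z
    by (rule euler_prod_deriv[OF m \<xi>]) (use that primes_le_gt_1 in auto)
  have Ld: "(Lser \<xi> has_field_derivative deriv (Lser \<xi>) z) (at z)" if "Re z > 1" for z
    by (rule holomorphic_derivI[OF Lser_holomorphic[OF m \<xi>] open_Re_gt]) (use that in auto)
  have Ed: "(?E N has_field_derivative deriv (Lser \<xi>) z * ?P N z + ?P N z * (\<Sum>p\<in>primes_le N. euler_logderiv \<xi> p z) * Lser \<xi> z) (at z)"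
    if "Re z > 1" for N z
    by (intro DERIV_mult Ld Pd that)
  have "(\<lambda>N. deriv (?E N) s) \<longlonglongrightarrow> deriv (\<lambda>_. 1) s"
  proof (rule deriv_complex_uniform_limit[OF sieve_uniform_limit[OF m \<xi> a(1)]])
    show "\<forall>\<^sub>F N in sequentially. ?E N holomorphic_on {s. Re s > a}"
      using Ed a(1) by (intro always_eventually allI, subst holomorphic_on_open[OF open_Re_gt]) force
  qed (use a open_Re_gt in auto)
  then have d0: "(\<lambda>N. deriv (?E N) s) \<longlonglongrightarrow> 0" by simp
  have E1: "(\<lambda>N. ?E N s) \<longlonglongrightarrow> 1"
    by (rule tendsto_uniform_limitI[OF sieve_uniform_limit[OF m \<xi> a(1)]]) (use a in auto)
  have P0: "?P N s \<noteq> 0" for N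
  proof -
    have "dterm \<xi> s p \<noteq> 1" if "p \<in> primes_le N" for p
      using norm_dterm_lt_1[OF m \<xi> _ primes_le_gt_1[OF that], of s] s by auto
    then show ?thesis by simp
  qed
  have L0: "Lser \<xi> s \<noteq> 0" by (rule Lser_nonzero[OF m \<xi> s])
  have "(\<lambda>N. deriv (?E N) s / ?E N s - deriv (Lser \<xi>) s / Lser \<xi> s) \<longlonglongrightarrow> 0 / 1 - deriv (Lser \<xi>) s / Lser \<xi> s"
    by (intro tendsto_intros d0 E1) auto
  also have "(\<lambda>N. deriv (?E N) s / ?E N s - deriv (Lser \<xi>) s / Lser \<xi> s) = ?Q"
  proof
    fix N
    show "deriv (?E N) s / ?E N s - deriv (Lser \<xi>) s / Lser \<xi> s = ?Q N"
      unfolding DERIV_imp_deriv[OF Ed[OF s]] using P0[of N] L0 by (simp add: divide_simps)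
  qed
  finally show ?thesis by simp
qed

section \<open>The line Re s = 1\<close>

text \<open>For Re s > 1 this is \<open>s - 1\<close> times the product of all
  \<open>L\<close>-functions. Hence \<open>Lprod m 1 = 0\<close> would mean that the product itself
  has no pole at 1.\<close>

definition Lprod :: "nat \<Rightarrow> complex \<Rightarrow> complex" where
  "Lprod m s = (\<Prod>\<xi>\<in>dchars m. Lcont m \<xi> s)"

definition prime_wt :: "nat \<Rightarrow> nat \<Rightarrow> real" where
  "prime_wt m n = (if prime n \<and> [n = 1] (mod m) then ln (real n) else 0)"

definition Pser :: "nat \<Rightarrow> complex \<Rightarrow> complex" where
  "Pser m s = (\<Sum>n. of_real (prime_wt m n) * of_nat n powr (- s))"

text \<open>The contribution of the powers \<open>n ^ k\<close> with \<open>k \<ge> 2\<close>: a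
  geometric series without its first term. Being quadratic in n^(-s), it is summable over
  \<open>n\<close> for Re s > 1/2.\<close>

definition pow_term :: "nat \<Rightarrow> nat \<Rightarrow> complex \<Rightarrow> complex" where
  "pow_term m n s = (if prime n then of_real (ln (real n)) * (\<Sum>\<xi>\<in>dchars m. dterm \<xi> s n ^ 2 / (1 - dterm \<xi> s n)) else 0)"

definition Kser :: "nat \<Rightarrow> complex \<Rightarrow> complex" where
  "Kser m s = (\<Sum>n. pow_term m n s)"

lemma prime_wt_nonneg: "prime_wt m n \<ge> 0"
  by (auto simp: prime_wt_def dest: prime_ge_1_nat)

lemma prime_wt_le: "prime_wt m n \<le> ln (real n)"
  by (cases "n = 0") (auto simp: prime_wt_def)

lemma Lprod_holomorphic:
  assumes "m > 0" shows "Lprod m holomorphic_on {s. Re s > 0}"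
  unfolding Lprod_def[abs_def] by (intro holomorphic_on_prod Lcont_holomorphic assms)

lemma summable_ln_powr:
  assumes "b < -1" shows "summable (\<lambda>n. ln (real n) * real n powr b)"
proof -
  \<comment> \<open>Half of the gap between \<open>b\<close> and -1 absorbs the logarithm; the other
    half keeps the exponent below -1.\<close>
  define e where "e = (- 1 - b) / 2"
  have e: "e > 0" using assms by (simp add: e_def)
  have "norm (ln (real n) * real n powr b) \<le> real n powr (e + b) / e" for n
  proof (cases "n = 0")
    case False
    then have "ln (real n) \<le> real n powr e / e" using ln_powr_bound[of "real n" e] e by simp
    then have "ln (real n) * real n powr b \<le> real n powr e / e * real n powr b"
      by (intro mult_right_mono) auto
    then show ?thesis using False by (simp add: powr_add)
  qed auto
  then have bd: "norm (ln (real n) * real n powr b) \<le> real n powr (e + b) / e" if "n \<ge> 0" for n .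
  have "summable (\<lambda>n. real n powr (e + b) / e)"
    by (intro summable_divide) (use assms in \<open>simp add: summable_real_powr_iff e_def field_simps\<close>)
  then show ?thesis by (rule summable_comparison_test') (rule bd)
qed

lemma Pser_norm_summable:
  assumes "Re s > 1" shows "summable (\<lambda>n. norm (of_real (prime_wt m n) * of_nat n powr (- s) :: complex))"
proof (rule summable_comparison_test'[of _ 0])
  show "summable (\<lambda>n. ln (real n) * real n powr (- Re s))" using assms by (intro summable_ln_powr) auto
  fix n show "norm (norm (of_real (prime_wt m n) * of_nat n powr (- s) :: complex)) \<le> ln (real n) * real n powr (- Re s)"
    using prime_wt_nonneg[of m n] prime_wt_le[of m n] norm_of_nat_powr_le[of s n] assms
    by (cases "n = 0") (auto simp: norm_mult intro!: mult_mono)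
qed

lemma norm_pow_term:
  assumes m: "m > 0" and a: "Re s \<ge> a" "a > 1/2"
  shows "norm (pow_term m n s) \<le> real (totient m) / (1 - 2 powr (-1/2)) * (ln (real n) * real n powr (- 2 * a))"
proof (cases "prime n")
  case True
  then have n: "n \<ge> 2" by (rule prime_ge_2_nat)
  \<comment> \<open>Since n \<ge> 2 and Re s > 1/2, every \<open>dterm\<close> has norm at most
    2^(-1/2), so this constant bounds the denominators from below.\<close>
  have c: "1 - 2 powr (-1/2 :: real) > 0" using powr_less_mono[of "-1/2" 0 "2::real"] by simp
  have *: "norm (dterm \<xi> s n ^ 2 / (1 - dterm \<xi> s n)) \<le> real n powr (- 2 * a) / (1 - 2 powr (-1/2))" if \<xi>: "\<xi> \<in> dchars m" for \<xi>
  proof -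
    have d: "norm (dterm \<xi> s n) \<le> real n powr (- a)" by (rule norm_dterm_le[OF m \<xi> a(1)])
    also have "real n powr (- a) \<le> real n powr (-1/2)" using a n by (intro powr_mono) auto
    also have "\<dots> \<le> 2 powr (-1/2)" using n by (intro powr_mono2') auto
    finally have "1 - 2 powr (-1/2) \<le> 1 - norm (dterm \<xi> s n)" by simp
    also have "\<dots> \<le> norm (1 - dterm \<xi> s n)" using norm_triangle_ineq2[of 1 "dterm \<xi> s n"] by simp
    finally have 1: "1 - 2 powr (-1/2) \<le> norm (1 - dterm \<xi> s n)" .
    have "norm (dterm \<xi> s n) ^ 2 \<le> (real n powr (- a)) ^ 2" by (intro power_mono d) auto
    also have "\<dots> = real n powr (- 2 * a)" using n by (simp add: power2_eq_square flip: powr_add)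
    finally show ?thesis unfolding norm_divide norm_power by (intro frac_le c 1) auto
  qed
  have "norm (\<Sum>\<xi>\<in>dchars m. dterm \<xi> s n ^ 2 / (1 - dterm \<xi> s n)) \<le> (\<Sum>\<xi>\<in>dchars m. real n powr (- 2 * a) / (1 - 2 powr (-1/2)))"
    by (rule sum_norm_le) (rule *)
  also have "\<dots> = real (totient m) * (real n powr (- 2 * a) / (1 - 2 powr (-1/2)))"
    by (simp add: card_dchars[OF m])
  finally have "ln (real n) * norm (\<Sum>\<xi>\<in>dchars m. dterm \<xi> s n ^ 2 / (1 - dterm \<xi> s n))
     \<le> ln (real n) * (real (totient m) * (real n powr (- 2 * a) / (1 - 2 powr (-1/2))))"
    using n by (intro mult_left_mono) auto
  then show ?thesis using True n by (simp add: pow_term_def norm_mult mult_ac)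
next
  case False
  have c: "1 - 2 powr (-1/2 :: real) > 0" using powr_less_mono[of "-1/2" 0 "2::real"] by simp
  then show ?thesis using False by (cases "n = 0") (auto simp: pow_term_def intro!: mult_nonneg_nonneg divide_nonneg_nonneg)
qed

lemma dterm_neq_1:
  assumes "m > 0" "\<xi> \<in> dchars m" "Re s > 0" "n > 1" shows "dterm \<xi> s n \<noteq> 1"
  using norm_dterm_lt_1[OF assms] by auto

lemma dterm_holomorphic: "(\<lambda>s. dterm \<xi> s n) holomorphic_on A"
proof (cases "n = 0")
  case False
  then show ?thesis using dterm_deriv[of n \<xi>] 
    by (meson field_differentiable_at_within field_differentiable_def holomorphic_on_def gr0I)
qed auto

lemma Kser_holomorphic:
  assumes m: "m > 0" shows "Kser m holomorphic_on {s. Re s > 1/2}"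
  unfolding Kser_def[abs_def]
proof (intro holomorphic_suminf_local open_Re_gt)
  show "(\<lambda>s. pow_term m n s) holomorphic_on {s. Re s > 1/2}" for n
  proof (cases "prime n")
    case True
    then show ?thesis unfolding pow_term_def
      using dterm_neq_1[OF m _ _ prime_gt_1_nat[OF True]]
      by (auto intro!: holomorphic_intros dterm_holomorphic)
  qed (simp add: pow_term_def)
  fix z assume "z \<in> {s. Re s > 1/2}"
  then have z: "Re z > 1/2" by simp
  define d where "d = (Re z - 1/2) / 2"
  let ?a = "Re z - d"
  let ?M = "\<lambda>n. real (totient m) / (1 - 2 powr (-1/2)) * (ln (real n) * real n powr (- 2 * ?a))"
  have d: "d > 0" "?a > 1/2" using z by (auto simp: d_def field_simps)
  have "norm (pow_term m n w) \<le> ?M n" if "w \<in> cball z d" for n w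
    by (rule norm_pow_term[OF m Re_le_cball(1)[OF that] d(2)])
  moreover have "summable ?M" using d by (intro summable_mult summable_ln_powr) auto
  moreover have "cball z d \<subseteq> {s. Re s > 1/2}" by (rule cball_subset_halfplane) (use d in auto)
  ultimately show "\<exists>d>0. \<exists>M. cball z d \<subseteq> {s. Re s > 1/2} \<and> summable M \<and> (\<forall>n. \<forall>w\<in>cball z d. norm (pow_term m n w) \<le> M n)"
    using d by blast
qed

lemma pow_term_summable:
  assumes m: "m > 0" and s: "Re s > 1/2" shows "summable (\<lambda>n. pow_term m n s)"
proof (rule summable_comparison_test'[of _ 0])
  show "summable (\<lambda>n. real (totient m) / (1 - 2 powr (-1/2)) * (ln (real n) * real n powr (- 2 * Re s)))"
    using s by (intro summable_mult summable_ln_powr) auto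
qed (rule norm_pow_term[OF m order_refl s])

lemma sum_dterm:
  assumes m: "m > 0"
  shows "(\<Sum>\<xi>\<in>dchars m. dterm \<xi> s n) = (if [n = 1] (mod m) then of_nat (totient m) * of_nat n powr (- s) else 0)"
  unfolding dterm_def sum_distrib_right[symmetric] dchars_sum_chars[OF m] by simp

lemma sum_euler_logderiv:
  assumes m: "m > 0" and s: "Re s > 0" and n: "prime n"
  shows "(\<Sum>\<xi>\<in>dchars m. euler_logderiv \<xi> n s) = 
     of_nat (totient m) * (of_real (prime_wt m n) * of_nat n powr (- s)) + pow_term m n s"
proof -
  have "(\<Sum>\<xi>\<in>dchars m. euler_logderiv \<xi> n s) =
      (\<Sum>\<xi>\<in>dchars m. of_real (ln (real n)) * (dterm \<xi> s n + dterm \<xi> s n ^ 2 / (1 - dterm \<xi> s n)))"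
  proof (intro sum.cong refl)
    fix \<xi> assume "\<xi> \<in> dchars m"
    then have "1 - dterm \<xi> s n \<noteq> 0" using dterm_neq_1[OF m _ s prime_gt_1_nat[OF n]] by simp
    then show "euler_logderiv \<xi> n s = of_real (ln (real n)) * (dterm \<xi> s n + dterm \<xi> s n ^ 2 / (1 - dterm \<xi> s n))"
      by (simp add: euler_logderiv_def field_simps power2_eq_square)
  qed
  also have "\<dots> = of_real (ln (real n)) * (\<Sum>\<xi>\<in>dchars m. dterm \<xi> s n) + pow_term m n s"
    using n by (simp add: pow_term_def sum.distrib sum_distrib_left distrib_left)
  finally show ?thesis using n by (simp add: sum_dterm[OF m] prime_wt_def)
qed

lemma DERIV_prod_log:
  fixes f :: "'i \<Rightarrow> complex \<Rightarrow> complex"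
  assumes "finite A" "\<And>i. i \<in> A \<Longrightarrow> (f i has_field_derivative f i s * g i) (at s)"
  shows "((\<lambda>s. \<Prod>i\<in>A. f i s) has_field_derivative (\<Prod>i\<in>A. f i s) * (\<Sum>i\<in>A. g i)) (at s)"
  using assms
proof (induction A rule: finite_induct)
  case (insert q A)
  have "((\<lambda>s. f q s * (\<Prod>i\<in>A. f i s)) has_field_derivative
     f q s * g q * (\<Prod>i\<in>A. f i s) + (\<Prod>i\<in>A. f i s) * (\<Sum>i\<in>A. g i) * f q s) (at s)"
    by (intro DERIV_mult insert) auto
  then show ?case using insert by (simp add: algebra_simps)
qed auto

lemma Lcont_deriv:
  assumes m: "m > 0" and \<xi>: "\<xi> \<in> dchars m" and s: "Re s > 1"
  shows "(Lcont m \<xi> has_field_derivative Lcont m \<xi> s * ((if \<xi> = char0 m then 1 / (s - 1) else 0) + deriv (Lser \<xi>) s / Lser \<xi> s)) (at s)"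
proof -
  have Ld: "(Lser \<xi> has_field_derivative deriv (Lser \<xi>) s) (at s)"
    by (rule holomorphic_derivI[OF Lser_holomorphic[OF m \<xi>] open_Re_gt]) (use s in auto)
  have L0: "Lser \<xi> s \<noteq> 0" by (rule Lser_nonzero[OF m \<xi> s])
  have s1: "s - 1 \<noteq> 0" using s by auto
  let ?g = "\<lambda>s. if \<xi> = char0 m then (s - 1) * Lser \<xi> s else Lser \<xi> s"
  have "(?g has_field_derivative ?g s * ((if \<xi> = char0 m then 1 / (s - 1) else 0) + deriv (Lser \<xi>) s / Lser \<xi> s)) (at s)"
  proof (cases "\<xi> = char0 m")
    case True
    have "((\<lambda>s. (s - 1) * Lser \<xi> s) has_field_derivative (1 - 0) * Lser \<xi> s + deriv (Lser \<xi>) s * (s - 1)) (at s)"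
      by (intro DERIV_mult Ld DERIV_diff DERIV_ident DERIV_const)
    moreover have "(1 - 0) * Lser \<xi> s + deriv (Lser \<xi>) s * (s - 1) = (s - 1) * Lser \<xi> s * (1 / (s - 1) + deriv (Lser \<xi>) s / Lser \<xi> s)"
      using L0 s1 by (simp add: distrib_left)
    ultimately show ?thesis using True by simp
  next
    case False
    then show ?thesis using L0 Ld by simp
  qed
  then have "(Lcont m \<xi> has_field_derivative ?g s * ((if \<xi> = char0 m then 1 / (s - 1) else 0) + deriv (Lser \<xi>) s / Lser \<xi> s)) (at s)"
    by (rule has_field_derivative_transform_within_open[OF _ open_Re_gt[of 1]])
       (use s in \<open>auto simp: Lcont_eq[OF m \<xi>]\<close>)
  then show ?thesis using Lcont_eq[OF m \<xi> s] by simp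
qed

lemma Lprod_nonzero:
  assumes m: "m > 0" and s: "Re s > 1" shows "Lprod m s \<noteq> 0"
proof -
  have "s \<noteq> 1" using s by auto
  then show ?thesis unfolding Lprod_def
    using Lcont_eq[OF m _ s] Lser_nonzero[OF m _ s] finite_dchars[OF m] by simp
qed

lemma Lprod_logderiv_lim:
  assumes m: "m > 0" and s: "Re s > 1"
  shows "(\<lambda>N. \<Sum>p\<in>primes_le N. \<Sum>\<xi>\<in>dchars m. euler_logderiv \<xi> p s) \<longlonglongrightarrow> 1 / (s - 1) - deriv (Lprod m) s / Lprod m s"
proof -
  have "(Lprod m has_field_derivative Lprod m s * (\<Sum>\<xi>\<in>dchars m. (if \<xi> = char0 m then 1 / (s - 1) else 0) + deriv (Lser \<xi>) s / Lser \<xi> s)) (at s)"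
    unfolding Lprod_def[abs_def]
    by (rule DERIV_prod_log[OF finite_dchars[OF m] Lcont_deriv[OF m _ s]])
  then have "deriv (Lprod m) s / Lprod m s = (\<Sum>\<xi>\<in>dchars m. (if \<xi> = char0 m then 1 / (s - 1) else 0) + deriv (Lser \<xi>) s / Lser \<xi> s)"
    using Lprod_nonzero[OF m s] by (simp add: DERIV_imp_deriv)
  also have "\<dots> = 1 / (s - 1) + (\<Sum>\<xi>\<in>dchars m. deriv (Lser \<xi>) s / Lser \<xi> s)"
    using finite_dchars[OF m] char0_in[OF m] by (simp add: sum.distrib)
  finally have eq: "1 / (s - 1) - deriv (Lprod m) s / Lprod m s = (\<Sum>\<xi>\<in>dchars m. - deriv (Lser \<xi>) s / Lser \<xi> s)"
    by (simp add: sum_negf)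
  show ?thesis unfolding eq
    by (subst sum.swap, rule tendsto_sum) (rule Lser_logderiv[OF m _ s])
qed

lemma primes_le_sum: "(\<Sum>p\<in>primes_le N. f p) = (\<Sum>n<Suc N. if prime n then f n else (0::complex))"
  unfolding primes_le_def by (subst sum.inter_filter[symmetric]) (auto intro!: sum.cong)

text \<open>Orthogonality reduces the sum over characters to the primes in the class of 1 plus
  \<open>pow_term\<close>. The term 1 / (s - 1) compensates the extra factor in \<open>Lcont\<close>
  for the principal character.\<close>

lemma Lprod_logderiv:
  assumes m: "m > 0" and s: "Re s > 1"
  shows "of_nat (totient m) * Pser m s + Kser m s = 1 / (s - 1) - deriv (Lprod m) s / Lprod m s"
proof -
  let ?p = "\<lambda>n. of_real (prime_wt m n) * of_nat n powr (- s) :: complex"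
  let ?t = "\<lambda>n. of_nat (totient m) * ?p n + pow_term m n s"
  have "summable ?p" using Pser_norm_summable[OF s] by (rule summable_norm_cancel)
  then have "?t sums (of_nat (totient m) * Pser m s + Kser m s)"
    unfolding Pser_def Kser_def using s
    by (intro sums_add sums_mult summable_sums pow_term_summable m) auto
  then have "(\<lambda>N. \<Sum>n<Suc N. ?t n) \<longlonglongrightarrow> of_nat (totient m) * Pser m s + Kser m s"
    unfolding sums_def by (rule LIMSEQ_Suc)
  also have "(\<lambda>N. \<Sum>n<Suc N. ?t n) = (\<lambda>N. \<Sum>p\<in>primes_le N. \<Sum>\<xi>\<in>dchars m. euler_logderiv \<xi> p s)"
  proof
    fix N show "(\<Sum>n<Suc N. ?t n) = (\<Sum>p\<in>primes_le N. \<Sum>\<xi>\<in>dchars m. euler_logderiv \<xi> p s)"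
      unfolding primes_le_sum
      by (intro sum.cong refl) (use s in \<open>auto simp: sum_euler_logderiv[OF m] prime_wt_def pow_term_def\<close>)
  qed
  finally show ?thesis using Lprod_logderiv_lim[OF m s] LIMSEQ_unique by blast
qed

section \<open>Residues on the line Re s = 1\<close>

text \<open>Here \<open>n\<close> is the order of the zero of \<open>f\<close> at \<open>z\<close>,
  that is, the residue of the logarithmic derivative, read off along the horizontal ray from the
  right.\<close>

lemma logderiv_limit:
  assumes f: "f holomorphic_on S" and S: "open S" "connected S" and z: "z \<in> S" and nz: "\<exists>w\<in>S. f w \<noteq> 0"
  shows "\<exists>n::nat. (n = 0 \<longleftrightarrow> f z \<noteq> 0) \<and> ((\<lambda>x. of_real x * (deriv f (z + of_real x) / f (z + of_real x))) \<longlongrightarrow> of_nat n) (at_right (0::real))"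
proof -
  have lz: "((\<lambda>x. z + of_real x) \<longlongrightarrow> z) (at_right (0::real))"
    by (rule tendsto_eq_intros tendsto_ident_at refl | simp)+
  have lx: "((\<lambda>x. complex_of_real x) \<longlongrightarrow> 0) (at_right (0::real))"
    by (rule tendsto_eq_intros tendsto_ident_at refl | simp)+
  show ?thesis
  proof (cases "f z = 0")
    case False
    have c: "isCont f z" "isCont (deriv f) z"
      using holomorphic_on_imp_differentiable_at[OF f S(1) z]
        holomorphic_on_imp_differentiable_at[OF holomorphic_deriv[OF f S(1)] S(1) z]
      by (simp_all add: field_differentiable_imp_continuous_at)
    have "((\<lambda>x. of_real x * (deriv f (z + of_real x) / f (z + of_real x))) \<longlongrightarrow> 0 * (deriv f z / f z)) (at_right (0::real))"
      by (intro tendsto_intros lx isCont_tendsto_compose[OF c(1) lz] isCont_tendsto_compose[OF c(2) lz] False)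
    then show ?thesis using False by (intro exI[of _ 0]) auto
  next
    case True
    have "\<not> f constant_on S" using nz True z by (metis constant_on_def)
    then obtain g r n where g: "0 < n" "0 < r" "ball z r \<subseteq> S" "g holomorphic_on ball z r"
      "\<And>w. w \<in> ball z r \<Longrightarrow> f w = (w - z) ^ n * g w" "\<And>w. w \<in> ball z r \<Longrightarrow> g w \<noteq> 0"
      using holomorphic_factor_zero_nonconstant[OF f S z True] by metis
    have c: "isCont g z" "isCont (deriv g) z"
      using holomorphic_on_imp_differentiable_at[OF g(4) open_ball, of z]
        holomorphic_on_imp_differentiable_at[OF holomorphic_deriv[OF g(4) open_ball] open_ball, of z] g(2)
      by (simp_all add: field_differentiable_imp_continuous_at)
    have gz: "g z \<noteq> 0" using g by simp
    have "((\<lambda>x. of_nat n + of_real x * (deriv g (z + of_real x) / g (z + of_real x))) \<longlongrightarrow> of_nat n + 0 * (deriv g z / g z)) (at_right (0::real))"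
      by (intro tendsto_intros lx isCont_tendsto_compose[OF c(1) lz] isCont_tendsto_compose[OF c(2) lz] gz)
    moreover have "eventually (\<lambda>x. of_nat n + of_real x * (deriv g (z + of_real x) / g (z + of_real x)) =
       of_real x * (deriv f (z + of_real x) / f (z + of_real x))) (at_right (0::real))"
    proof -
      have "eventually (\<lambda>x. x \<in> {0<..<r}) (at_right (0::real))" by (rule eventually_at_right_real[OF g(2)])
      then show ?thesis
      proof eventually_elim
        case (elim x)
        let ?w = "z + of_real x"
        have w: "?w \<in> ball z r" using elim by (simp add: dist_norm)
        have gd: "(g has_field_derivative deriv g ?w) (at ?w)"
          by (rule holomorphic_derivI[OF g(4) open_ball w])
        have "((\<lambda>w. (w - z) ^ n * g w) has_field_derivative (of_nat n * (?w - z) ^ (n - 1)) * g ?w + deriv g ?w * (?w - z) ^ n) (at ?w)"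
          by (rule derivative_eq_intros gd refl | simp)+
        then have "(f has_field_derivative (of_nat n * (?w - z) ^ (n - 1)) * g ?w + deriv g ?w * (?w - z) ^ n) (at ?w)"
          by (rule has_field_derivative_transform_within_open[OF _ open_ball w]) (use g(5) in auto)
        then have df: "deriv f ?w = of_nat n * of_real x ^ (n - 1) * g ?w + deriv g ?w * of_real x ^ n"
          by (simp add: DERIV_imp_deriv)
        have fw: "f ?w = of_real x ^ n * g ?w" using g(5)[OF w] by simp
        have xn: "of_real x ^ n = of_real x * (of_real x ^ (n - 1) :: complex)" using g(1)
          by (metis power_eq_if neq0_conv)
        have alg: "of_nat n + x * (g' / G) = x * ((of_nat n * X * G + g' * (x * X)) / (x * X * G))"
          if "x \<noteq> 0" "X \<noteq> 0" "G \<noteq> 0" for x X g' G :: complex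
          using that by (simp add: add_divide_distrib distrib_left)
        show ?case unfolding df fw xn by (rule alg) (use g(6)[OF w] elim in auto)
      qed
    qed
    ultimately have "((\<lambda>x. of_real x * (deriv f (z + of_real x) / f (z + of_real x))) \<longlongrightarrow> of_nat n + 0 * (deriv g z / g z)) (at_right (0::real))"
      by (rule Lim_transform_eventually)
    then show ?thesis using True g(1) by (intro exI[of _ n]) auto
  qed
qed

text \<open>The limit is the residue of \<open>totient m\<close> times \<open>Pser\<close> at 1 + i
  t: 1 from the pole if \<open>t = 0\<close>, minus the order of the zero of \<open>Lprod\<close>.
  \<open>Kser\<close> is continuous there and contributes nothing.\<close>

lemma Pser_limit:
  assumes m: "m > 0"
  shows "\<exists>n::nat. (n = 0 \<longleftrightarrow> Lprod m (1 + \<i> * of_real t) \<noteq> 0) \<and>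
    ((\<lambda>x. of_real x * (of_nat (totient m) * Pser m (1 + \<i> * of_real t + of_real x))) \<longlongrightarrow> (if t = 0 then 1 else 0) - of_nat n) (at_right (0::real))"
proof -
  let ?z = "1 + \<i> * of_real t"
  have "2 \<in> {s. Re s > 0}" "Lprod m 2 \<noteq> 0" using Lprod_nonzero[OF m, of 2] by auto
  then have "\<exists>w\<in>{s. Re s > 0}. Lprod m w \<noteq> 0" by blast
  moreover have "connected {s. Re s > 0}" by (intro convex_connected convex_halfspace_Re_gt)
  ultimately obtain n :: nat where n: "n = 0 \<longleftrightarrow> Lprod m ?z \<noteq> 0"
    and lim: "((\<lambda>x. of_real x * (deriv (Lprod m) (?z + of_real x) / Lprod m (?z + of_real x))) \<longlongrightarrow> of_nat n) (at_right (0::real))"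
    using logderiv_limit[OF Lprod_holomorphic[OF m] open_Re_gt, of ?z] by auto
  have lz: "((\<lambda>x. ?z + of_real x) \<longlongrightarrow> ?z) (at_right (0::real))"
    by (rule tendsto_eq_intros tendsto_ident_at refl | simp)+
  have lx: "((\<lambda>x. complex_of_real x) \<longlongrightarrow> 0) (at_right (0::real))"
    by (rule tendsto_eq_intros tendsto_ident_at refl | simp)+
  have "isCont (Kser m) ?z"
    using holomorphic_on_imp_continuous_on[OF Kser_holomorphic[OF m]]
    by (subst (asm) continuous_on_eq_continuous_at[OF open_Re_gt]) auto
  then have K: "((\<lambda>x. of_real x * Kser m (?z + of_real x)) \<longlongrightarrow> 0 * Kser m ?z) (at_right (0::real))"
    by (intro tendsto_intros lx isCont_tendsto_compose[OF _ lz])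
  have pole: "((\<lambda>x. of_real x * (1 / (?z + of_real x - 1))) \<longlongrightarrow> (if t = 0 then 1 else 0)) (at_right (0::real))"
  proof (cases "t = 0")
    case True
    have "eventually (\<lambda>x. 1 = of_real x * (1 / (?z + of_real x - 1))) (at_right (0::real))"
      using eventually_at_right_less[of 0] by eventually_elim (use True in auto)
    then show ?thesis using True by (auto intro: Lim_transform_eventually[OF tendsto_const])
  next
    case False
    have "((\<lambda>x. of_real x * (1 / (?z + of_real x - 1))) \<longlongrightarrow> 0 * (1 / (?z - 1))) (at_right (0::real))"
      by (intro tendsto_intros lx lz) (use False in auto)
    then show ?thesis using False by simp
  qed
  have "((\<lambda>x. of_real x * (1 / (?z + of_real x - 1)) - of_real x * (deriv (Lprod m) (?z + of_real x) / Lprod m (?z + of_real x))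
      - of_real x * Kser m (?z + of_real x)) \<longlongrightarrow> (if t = 0 then 1 else 0) - of_nat n - 0 * Kser m ?z) (at_right (0::real))"
    by (intro tendsto_diff pole lim K)
  moreover have "eventually (\<lambda>x. of_real x * (1 / (?z + of_real x - 1)) - of_real x * (deriv (Lprod m) (?z + of_real x) / Lprod m (?z + of_real x))
      - of_real x * Kser m (?z + of_real x) = of_real x * (of_nat (totient m) * Pser m (?z + of_real x))) (at_right (0::real))"
    using eventually_at_right_less[of 0]
  proof eventually_elim
    case (elim x)
    then have "of_nat (totient m) * Pser m (?z + of_real x) = 1 / (?z + of_real x - 1) - deriv (Lprod m) (?z + of_real x) / Lprod m (?z + of_real x) - Kser m (?z + of_real x)"
      using Lprod_logderiv[OF m, of "?z + of_real x"] by (simp add: algebra_simps)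
    then show ?case by (simp only: right_diff_distrib)
  qed
  ultimately have "((\<lambda>x. of_real x * (of_nat (totient m) * Pser m (?z + of_real x))) \<longlongrightarrow> (if t = 0 then 1 else 0) - of_nat n - 0 * Kser m ?z) (at_right (0::real))"
    by (rule Lim_transform_eventually)
  then have "((\<lambda>x. of_real x * (of_nat (totient m) * Pser m (?z + of_real x))) \<longlongrightarrow> (if t = 0 then 1 else 0) - of_nat n) (at_right (0::real))"
    by simp
  with n show ?thesis by (intro exI[of _ n] conjI)
qed

text \<open>Termwise the identity 3 + 4 cos u + cos 2u = 2 (1 + cos u)^2 is used with u = t ln
  n.\<close>

lemma three_four_one:
  assumes "x > 0"
  shows "3 * Re (Pser m (1 + of_real x)) + 4 * Re (Pser m (1 + \<i> * of_real t + of_real x)) + Re (Pser m (1 + \<i> * of_real (2 * t) + of_real x)) \<ge> 0"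
proof -
  let ?p = "\<lambda>t n. of_real (prime_wt m n) * of_nat n powr (- (1 + \<i> * of_real t + of_real x)) :: complex"
  have sm: "summable (?p t)" for t
    by (rule summable_norm_cancel[OF Pser_norm_summable]) (use assms in auto)
  have re: "Re (?p t n) = prime_wt m n * real n powr (- 1 - x) * cos (t * ln (real n))" for t n
  proof (cases "n = 0")
    case False
    have "of_nat n powr (- (1 + \<i> * of_real t + of_real x)) = exp (of_real ((- 1 - x) * ln (real n)) + \<i> * of_real (- (t * ln (real n))))"
      using False by (simp add: powr_def algebra_simps)
    then have "Re (of_nat n powr (- (1 + \<i> * of_real t + of_real x))) = exp ((- 1 - x) * ln (real n)) * cos (- (t * ln (real n)))"
      by (simp only: Re_exp) simp
    then show ?thesis using False by (simp add: powr_def)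
  qed (simp add: prime_wt_def)
  have S: "(\<lambda>n. prime_wt m n * real n powr (- 1 - x) * cos (t * ln (real n))) sums Re (Pser m (1 + \<i> * of_real t + of_real x))" for t
    using sums_Re[OF summable_sums[OF sm[of t]]] unfolding re by (simp add: Pser_def)
  have "(\<lambda>n. 3 * (prime_wt m n * real n powr (- 1 - x) * cos (0 * ln (real n))) + 4 * (prime_wt m n * real n powr (- 1 - x) * cos (t * ln (real n)))
      + prime_wt m n * real n powr (- 1 - x) * cos (2 * t * ln (real n)))
    sums (3 * Re (Pser m (1 + \<i> * of_real 0 + of_real x)) + 4 * Re (Pser m (1 + \<i> * of_real t + of_real x)) + Re (Pser m (1 + \<i> * of_real (2 * t) + of_real x)))"
    by (intro sums_add sums_mult S)
  moreover have "0 \<le> 3 * (prime_wt m n * real n powr (- 1 - x) * cos (0 * ln (real n))) + 4 * (prime_wt m n * real n powr (- 1 - x) * cos (t * ln (real n)))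
      + prime_wt m n * real n powr (- 1 - x) * cos (2 * t * ln (real n))" for n
  proof -
    let ?c = "cos (t * ln (real n))"
    have dbl: "cos (2 * t * ln (real n)) = 2 * ?c ^ 2 - 1" using cos_double_cos[of "t * ln (real n)"] by (simp add: mult.assoc)
    have "3 * (prime_wt m n * real n powr (- 1 - x) * cos (0 * ln (real n))) + 4 * (prime_wt m n * real n powr (- 1 - x) * ?c)
      + prime_wt m n * real n powr (- 1 - x) * cos (2 * t * ln (real n)) = prime_wt m n * real n powr (- 1 - x) * (2 * (?c + 1) ^ 2)"
      unfolding dbl by (simp add: power2_eq_square algebra_simps)
    then show ?thesis using prime_wt_nonneg[of m n] by simp
  qed
  ultimately have "0 \<le> 3 * Re (Pser m (1 + \<i> * of_real 0 + of_real x)) + 4 * Re (Pser m (1 + \<i> * of_real t + of_real x)) + Re (Pser m (1 + \<i> * of_real (2 * t) + of_real x))"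
    by (metis (no_types, lifting) suminf_nonneg sums_iff)
  then show ?thesis by simp
qed

text \<open>Residues in \<open>three_four_one\<close> give 3 (1 - n0) - 4 n1 - n2 \<ge> 0. An order
  n1 \<ge> 1 would make this at most -1, whatever the order n0 at the point 1.\<close>

lemma Lprod_nonzero_line:
  assumes m: "m > 0" and t: "t \<noteq> 0"
  shows "Lprod m (1 + \<i> * of_real t) \<noteq> 0"
proof
  assume z: "Lprod m (1 + \<i> * of_real t) = 0"
  let ?f = "\<lambda>t x. of_real x * (of_nat (totient m) * Pser m (1 + \<i> * of_real t + of_real x))"
  obtain n0 :: nat where n0: "(?f 0 \<longlongrightarrow> 1 - of_nat n0) (at_right (0::real))"
    using Pser_limit[OF m, of 0] by auto
  obtain n1 :: nat where n1: "n1 \<noteq> 0" "(?f t \<longlongrightarrow> 0 - of_nat n1) (at_right (0::real))"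
    using Pser_limit[OF m, of t] t z by auto
  obtain n2 :: nat where n2: "(?f (2 * t) \<longlongrightarrow> 0 - of_nat n2) (at_right (0::real))"
    using Pser_limit[OF m, of "2 * t"] t by auto
  have "((\<lambda>x. 3 * Re (?f 0 x) + 4 * Re (?f t x) + Re (?f (2 * t) x)) \<longlongrightarrow>
     3 * Re (1 - of_nat n0) + 4 * Re (0 - of_nat n1) + Re (0 - of_nat n2)) (at_right (0::real))"
    by (intro tendsto_intros n0 n1 n2)
  moreover have "eventually (\<lambda>x. 0 \<le> 3 * Re (?f 0 x) + 4 * Re (?f t x) + Re (?f (2 * t) x)) (at_right (0::real))"
    using eventually_at_right_less[of 0]
  proof eventually_elim
    case (elim x)
    have "3 * Re (?f 0 x) + 4 * Re (?f t x) + Re (?f (2 * t) x) = x * real (totient m) *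
       (3 * Re (Pser m (1 + of_real x)) + 4 * Re (Pser m (1 + \<i> * of_real t + of_real x)) + Re (Pser m (1 + \<i> * of_real (2 * t) + of_real x)))"
      by (simp add: algebra_simps)
    also have "\<dots> \<ge> 0" by (intro mult_nonneg_nonneg three_four_one) (use elim in auto)
    finally show ?case .
  qed
  ultimately have "0 \<le> 3 * Re (1 - of_nat n0) + 4 * Re (0 - of_nat n1) + Re (0 - of_nat n2 :: complex)"
    by (rule tendsto_lowerbound) simp
  then show False using n1(1) by simp
qed

section \<open>The point s = 1\<close>

text \<open>Nonnegative Taylor coefficients in the variable \<open>2 - s\<close>, as for a Dirichlet series with
  nonnegative coefficients.\<close>
definition cmono :: "(complex \<Rightarrow> complex) \<Rightarrow> bool" where
  "cmono f \<longleftrightarrow> (\<forall>j. (-1) ^ j * (deriv ^^ j) f 2 \<in> \<real>\<^sub>\<ge>\<^sub>0)"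

lemma nonneg_Reals_sumI: "(\<And>i. i \<in> A \<Longrightarrow> f i \<in> \<real>\<^sub>\<ge>\<^sub>0) \<Longrightarrow> sum f A \<in> (\<real>\<^sub>\<ge>\<^sub>0 :: complex set)"
  by (induction A rule: infinite_finite_induct) (auto intro: nonneg_Reals_add_I)

lemma cmono_uniform_limit:
  assumes "uniform_limit A f g sequentially" "open A" "2 \<in> A"
    and "\<And>n. f n holomorphic_on A" "\<And>n. cmono (f n)"
  shows "cmono g"
  unfolding cmono_def
proof
  fix j
  have "(\<lambda>n. (deriv ^^ j) (f n) 2) \<longlonglongrightarrow> (deriv ^^ j) g 2"
    by (rule higher_deriv_complex_uniform_limit[OF assms(1)]) (use assms in auto)
  then have "(\<lambda>n. (-1) ^ j * (deriv ^^ j) (f n) 2) \<longlonglongrightarrow> (-1) ^ j * (deriv ^^ j) g 2"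
    by (intro tendsto_intros)
  then show "(-1) ^ j * (deriv ^^ j) g 2 \<in> \<real>\<^sub>\<ge>\<^sub>0"
    by (rule closed_sequentially[OF closed_nonneg_Reals_complex, rotated])
       (use assms(5) in \<open>auto simp: cmono_def\<close>)
qed

lemma higher_deriv_dirichlet_poly:
  assumes "finite I" "\<And>i. i \<in> I \<Longrightarrow> n i > 0"
  shows "(deriv ^^ j) (\<lambda>s. \<Sum>i\<in>I. complex_of_real (c i) * of_nat (n i) powr (- s)) =
     (\<lambda>s. \<Sum>i\<in>I. of_real (c i) * (- of_real (ln (real (n i)))) ^ j * of_nat (n i) powr (- s))"
proof (induction j)
  case (Suc j)
  show ?case unfolding funpow.simps o_def Suc
  proof (rule ext, rule DERIV_imp_deriv)
    fix s :: complex
    have d: "((\<lambda>s. of_nat k powr (- s)) has_field_derivative - of_real (ln (real k)) * (of_nat k :: complex) powr (- s)) (at s)" if "k > 0" for k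
      using dterm_deriv[OF that, of "\<lambda>_. 1" s] by (simp add: dterm_def)
    have "((\<lambda>s. \<Sum>i\<in>I. of_real (c i) * (- of_real (ln (real (n i)))) ^ j * of_nat (n i) powr (- s)) has_field_derivative
        (\<Sum>i\<in>I. of_real (c i) * (- of_real (ln (real (n i)))) ^ j * (- of_real (ln (real (n i))) * of_nat (n i) powr (- s)))) (at s)"
      by (intro DERIV_sum DERIV_cmult d assms(2))
    then show "((\<lambda>s. \<Sum>i\<in>I. of_real (c i) * (- of_real (ln (real (n i)))) ^ j * of_nat (n i) powr (- s)) has_field_derivative
        (\<Sum>i\<in>I. of_real (c i) * (- of_real (ln (real (n i)))) ^ Suc j * of_nat (n i) powr (- s))) (at s)"
      by (simp add: mult_ac)
  qed
qed simp

text \<open>Each derivative contributes a factor - ln n, whose sign is absorbed by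
  \<open>(-1) ^ j\<close>.\<close>

lemma cmono_dirichlet_poly:
  assumes "finite I" "\<And>i. i \<in> I \<Longrightarrow> n i > 0" "\<And>i. i \<in> I \<Longrightarrow> c i \<ge> 0"
  shows "cmono (\<lambda>s. \<Sum>i\<in>I. of_real (c i) * of_nat (n i) powr (- s))"
  unfolding cmono_def
proof
  fix j
  have "(- 1) ^ j * (of_real (c i) * (- of_real (ln (real (n i)))) ^ j * of_nat (n i) powr (- 2)) \<in> (\<real>\<^sub>\<ge>\<^sub>0 :: complex set)"
    if i: "i \<in> I" for i
  proof -
  have "of_nat (n i) powr (- 2) = (of_real (real (n i) powr (- 2)) :: complex)"
    using powr_of_real[of "real (n i)" "-2"] by simp
  then have "(- 1) ^ j * (of_real (c i) * (- of_real (ln (real (n i)))) ^ j * of_nat (n i) powr (- 2)) =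
     complex_of_real (c i * ln (real (n i)) ^ j * real (n i) powr (- 2))"
    using power_mult_distrib[of "-1" "- complex_of_real (ln (real (n i)))" j] by simp
  moreover have "c i * ln (real (n i)) ^ j * real (n i) powr (- 2) \<ge> 0"
    using assms(2)[OF i] assms(3)[OF i] by (intro mult_nonneg_nonneg zero_le_power) auto
  ultimately show ?thesis by (simp only: nonneg_Reals_of_real_iff)
  qed
  then have "(\<Sum>i\<in>I. (- 1) ^ j * (of_real (c i) * (- of_real (ln (real (n i)))) ^ j * of_nat (n i) powr (- 2))) \<in> (\<real>\<^sub>\<ge>\<^sub>0 :: complex set)"
    by (rule nonneg_Reals_sumI)
  moreover have "(deriv ^^ j) (\<lambda>s. \<Sum>i\<in>I. of_real (c i) * of_nat (n i) powr (- s)) =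
     (\<lambda>s. \<Sum>i\<in>I. of_real (c i) * (- of_real (ln (real (n i)))) ^ j * (of_nat (n i) :: complex) powr (- s))"
    by (rule higher_deriv_dirichlet_poly) (use assms in auto)
  ultimately show "(- 1) ^ j * (deriv ^^ j) (\<lambda>s. \<Sum>i\<in>I. of_real (c i) * of_nat (n i) powr (- s)) 2 \<in> (\<real>\<^sub>\<ge>\<^sub>0 :: complex set)"
    by (simp add: sum_distrib_left)
qed

text \<open>By Leibniz' rule each derivative of \<open>H\<close> at 2 is minus a sum of products of
  derivatives of \<open>N\<close> and lower derivatives of \<open>H\<close>. The powers of -1 split
  between the factors and strong induction applies. This plays the part of exponentiating a series
  with nonnegative coefficients.\<close>

lemma cmono_ode:
  assumes A: "open A" "2 \<in> A" and holo: "H holomorphic_on A" "N holomorphic_on A"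
    and ode: "\<And>s. s \<in> A \<Longrightarrow> deriv H s = - N s * H s" and N: "cmono N" and H2: "H 2 \<in> \<real>\<^sub>\<ge>\<^sub>0"
  shows "cmono H"
  unfolding cmono_def
proof
  fix j show "(-1) ^ j * (deriv ^^ j) H 2 \<in> \<real>\<^sub>\<ge>\<^sub>0"
  proof (induction j rule: less_induct)
    case (less j)
    show ?case
    proof (cases j)
      case 0
      then show ?thesis using H2 by simp
    next
      case (Suc k)
      have "(deriv ^^ j) H 2 = (deriv ^^ k) (deriv H) 2" unfolding Suc by (simp add: funpow_Suc_right del: funpow.simps)
      also have "\<dots> = (deriv ^^ k) (\<lambda>s. - (N s * H s)) 2"
        by (rule higher_deriv_transform_within_open[of _ A]) (use ode A holo in \<open>auto intro!: holomorphic_intros holomorphic_deriv\<close>)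
      also have "\<dots> = - (deriv ^^ k) (\<lambda>s. N s * H s) 2"
        by (rule higher_deriv_uminus[of _ A]) (use A holo in \<open>auto intro!: holomorphic_intros\<close>)
      also have "(deriv ^^ k) (\<lambda>s. N s * H s) 2 = (\<Sum>i=0..k. of_nat (k choose i) * (deriv ^^ i) N 2 * (deriv ^^ (k - i)) H 2)"
        by (rule higher_deriv_mult[OF holo(2,1) A])
      finally have "(deriv ^^ j) H 2 = - (\<Sum>i=0..k. of_nat (k choose i) * (deriv ^^ i) N 2 * (deriv ^^ (k - i)) H 2)" .
      then have "(-1) ^ j * (deriv ^^ j) H 2 = (-1) ^ k * (\<Sum>i=0..k. of_nat (k choose i) * (deriv ^^ i) N 2 * (deriv ^^ (k - i)) H 2)"
        by (simp only: Suc power_Suc) simp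
      also have "\<dots> = (\<Sum>i=0..k. (-1) ^ k * (of_nat (k choose i) * (deriv ^^ i) N 2 * (deriv ^^ (k - i)) H 2))"
        by (rule sum_distrib_left)
      also have "\<dots> = (\<Sum>i=0..k. of_nat (k choose i) * ((-1) ^ i * (deriv ^^ i) N 2) * ((-1) ^ (k - i) * (deriv ^^ (k - i)) H 2))"
      proof (intro sum.cong refl)
        fix i assume "i \<in> {0..k}"
        then have "(-1 :: complex) ^ k = (-1) ^ i * (-1) ^ (k - i)" by (simp flip: power_add)
        then show "(-1) ^ k * (of_nat (k choose i) * (deriv ^^ i) N 2 * (deriv ^^ (k - i)) H 2) =
          of_nat (k choose i) * ((-1) ^ i * (deriv ^^ i) N 2) * ((-1) ^ (k - i) * (deriv ^^ (k - i)) H 2)"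
          by simp
      qed
      also have "\<dots> \<in> \<real>\<^sub>\<ge>\<^sub>0"
      proof (rule nonneg_Reals_sumI)
        fix i assume "i \<in> {0..k}"
        have "(-1) ^ i * (deriv ^^ i) N 2 \<in> \<real>\<^sub>\<ge>\<^sub>0" using N by (simp add: cmono_def)
        moreover have "(-1) ^ (k - i) * (deriv ^^ (k - i)) H 2 \<in> \<real>\<^sub>\<ge>\<^sub>0" by (rule less) (simp add: Suc)
        ultimately show "of_nat (k choose i) * ((-1) ^ i * (deriv ^^ i) N 2) * ((-1) ^ (k - i) * (deriv ^^ (k - i)) H 2) \<in> \<real>\<^sub>\<ge>\<^sub>0"
          using nonneg_Reals_mult_I[OF nonneg_Reals_mult_I[OF nonneg_Reals_of_nat_I]] by blast
      qed
      finally show ?thesis .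
    qed
  qed
qed

text \<open>Holomorphy on the half-plane makes the Taylor series at 2 converge in the disc of radius
  2, which reaches down to 0. For real \<open>x < 2\<close> every term is nonnegative, so the value
  is at least the constant term. This is Landau's step beyond the region of convergence of the
  Dirichlet series.\<close>

lemma cmono_lower_bound:
  assumes "H holomorphic_on {s. Re s > 0}" "cmono H" "0 < x" "x < 2"
  shows "Re (H 2) \<le> Re (H (of_real x))"
proof -
  have "ball 2 2 \<subseteq> {s. Re s > 0}"
  proof
    fix w :: complex assume "w \<in> ball 2 2"
    then have "norm (2 - w) < 2" by (simp add: dist_norm)
    then have "\<bar>Re (2 - w)\<bar> < 2" using abs_Re_le_cmod le_less_trans by blast
    then show "w \<in> {s. Re s > 0}" by simp
  qed
  then have "H holomorphic_on ball 2 2" using assms(1) holomorphic_on_subset by blast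
  moreover have "complex_of_real x \<in> ball 2 2"
  proof -
    have "2 - complex_of_real x = of_real (2 - x)" by simp
    then show ?thesis using assms(3,4) by (simp only: mem_ball dist_norm norm_of_real)
  qed
  ultimately have "(\<lambda>n. (deriv ^^ n) H 2 / fact n * (of_real x - 2) ^ n) sums H (of_real x)"
    by (rule holomorphic_power_series)
  then have S: "(\<lambda>n. Re ((deriv ^^ n) H 2 / fact n * (of_real x - 2) ^ n)) sums Re (H (of_real x))"
    by (rule sums_Re)
  have nn: "Re ((deriv ^^ n) H 2 / fact n * (of_real x - 2) ^ n) \<ge> 0" for n
  proof -
    have "of_real x - 2 = (-1) * complex_of_real (2 - x)" by simp
    then have "(of_real x - 2 :: complex) ^ n = (-1) ^ n * of_real ((2 - x) ^ n)"
      by (metis power_mult_distrib of_real_power)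
    then have "(deriv ^^ n) H 2 / fact n * (of_real x - 2) ^ n = ((-1) ^ n * (deriv ^^ n) H 2) * of_real ((2 - x) ^ n / fact n)"
      by simp
    also have "\<dots> \<in> \<real>\<^sub>\<ge>\<^sub>0"
    proof (rule nonneg_Reals_mult_I)
      show "(-1) ^ n * (deriv ^^ n) H 2 \<in> \<real>\<^sub>\<ge>\<^sub>0" using assms(2) by (simp add: cmono_def)
      show "complex_of_real ((2 - x) ^ n / fact n) \<in> \<real>\<^sub>\<ge>\<^sub>0"
        using assms(4) by (subst nonneg_Reals_of_real_iff) simp
    qed
    finally show ?thesis by (simp add: complex_nonneg_Reals_iff)
  qed
  have "(\<Sum>n\<in>{0}. Re ((deriv ^^ n) H 2 / fact n * (of_real x - 2) ^ n)) \<le> Re (H (of_real x))"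
    unfolding sums_unique[OF S] by (rule sum_le_suminf) (use S nn in \<open>auto simp: sums_iff\<close>)
  then show ?thesis by simp
qed

section \<open>Landau's argument with a finite correction\<close>

text \<open>If \<open>F\<close> had no pole at \<open>1\<close>, then \<open>F(s) exp (- \<Sum> p\<^sup>-\<^sup>\<phi>\<^sup>s)\<close> with \<open>\<phi> = totient m\<close>, over finitely
  many primes \<open>p\<close> not dividing \<open>m\<close>, would have nonnegative Taylor coefficients at \<open>2\<close> after
  normalisation. So \<open>F\<close> would dominate \<open>exp (\<Sum> p\<^sup>-\<^sup>\<phi>\<^sup>s)\<close> on \<open>(0, 2)\<close>, which is
  absurd at \<open>s = 1 / (2 \<phi>)\<close>.\<close>
definition landau_corr :: "nat \<Rightarrow> nat \<Rightarrow> nat set" where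
  "landau_corr m M = {p \<in> primes_le M. coprime p m}"

text \<open>The contribution of \<open>n\<close> to minus the logarithmic derivative of F times the
  correcting exponential. The subtracted term comes from differentiating the exponent.\<close>

definition landau_term :: "nat \<Rightarrow> nat \<Rightarrow> nat \<Rightarrow> complex \<Rightarrow> complex" where
  "landau_term m M n s = (if prime n then (\<Sum>\<xi>\<in>dchars m. euler_logderiv \<xi> n s) -
     (if n \<in> landau_corr m M then of_real (real (totient m) * ln (real n)) * of_nat (n ^ totient m) powr (- s) else 0) else 0)"

lemma dterm_power: "\<xi> \<in> dchars m \<Longrightarrow> dterm \<xi> s (n ^ k) = dterm \<xi> s n ^ k"
  by (induction k) (simp_all add: dterm_mult, simp add: dterm_def dchars_1)

lemma norm_dterm_le_half:
  assumes m: "m > 0" and \<xi>: "\<xi> \<in> dchars m" and s: "Re s > 3/2" and n: "n \<ge> 2"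
  shows "norm (dterm \<xi> s n) \<le> 1/2"
proof -
  have "norm (dterm \<xi> s n) \<le> real n powr (- 1)" by (rule norm_dterm_le[OF m \<xi>]) (use s in auto)
  also have "\<dots> \<le> 2 powr (- 1)" using n by (intro powr_mono2') auto
  finally show ?thesis by (simp add: powr_minus)
qed

lemma euler_logderiv_holomorphic:
  assumes m: "m > 0" and \<xi>: "\<xi> \<in> dchars m" and n: "n > 1"
  shows "euler_logderiv \<xi> n holomorphic_on {s. Re s > 0}"
  unfolding euler_logderiv_def[abs_def]
  by (intro holomorphic_intros dterm_holomorphic) (use dterm_neq_1[OF m \<xi> _ n] in auto)

lemma landau_term_holomorphic:
  assumes m: "m > 0" shows "landau_term m M n holomorphic_on {s. Re s > 3/2}"
proof (cases "prime n")
  case True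
  have *: "euler_logderiv \<xi> n holomorphic_on {s. Re s > 3/2}" if "\<xi> \<in> dchars m" for \<xi>
    by (rule holomorphic_on_subset[OF euler_logderiv_holomorphic[OF m that prime_gt_1_nat[OF True]]]) auto
  have "(\<lambda>s. (\<Sum>\<xi>\<in>dchars m. euler_logderiv \<xi> n s) -
     (if n \<in> landau_corr m M then of_real (real (totient m) * ln (real n)) * of_nat (n ^ totient m) powr (- s) else 0)) holomorphic_on {s. Re s > 3/2}"
    by (cases "n \<in> landau_corr m M") (simp_all only: if_True if_False diff_zero, (intro holomorphic_intros *; assumption?)+)
  then show ?thesis using True by (simp add: landau_term_def[abs_def])
qed (simp add: landau_term_def[abs_def])

text \<open>In the geometric series the coefficient at \<open>n ^ k\<close> is ln n times
  \<open>totient m\<close> if \<open>n ^ k\<close> is 1 modulo \<open>m\<close>, and 0 otherwise.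
  The correction subtracts ln n times \<open>totient m\<close> at \<open>k = totient m\<close> only,
  where Euler's theorem provides exactly that much, so no coefficient becomes negative.\<close>

lemma landau_term_cmono:
  assumes m: "m > 0" shows "cmono (landau_term m M n)"
proof -
  have z: "cmono (\<lambda>_. 0)" using cmono_dirichlet_poly[of "{}" "\<lambda>_. 0" "\<lambda>_. 0"] by simp
  consider "\<not> prime n" | "prime n" "\<not> coprime n m" | "prime n" "coprime n m" by blast
  then show ?thesis
  proof cases
    case 1
    then show ?thesis using z by (simp add: landau_term_def[abs_def])
  next
    case 2
    then have "euler_logderiv \<xi> n s = 0" if "\<xi> \<in> dchars m" for \<xi> s
      using that by (simp add: euler_logderiv_def dterm_def dchars_eq_0)
    then have "landau_term m M n = (\<lambda>_. 0)" using 2 by (auto simp: landau_term_def landau_corr_def)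
    then show ?thesis using z by simp
  next
    case 3
    let ?\<phi> = "totient m" and ?A = "{s. Re s > 3/2}"
    have n: "n \<ge> 2" using 3 by (simp add: prime_ge_2_nat)
    define b where "b = (if n \<in> landau_corr m M then real ?\<phi> else 0)"
    define c where "c k = ln (real n) * ((if [n ^ k = 1] (mod m) then real ?\<phi> else 0) - (if k = ?\<phi> then b else 0))" for k
    \<comment> \<open>The cut-off \<open>J + ?\<phi>\<close> keeps the exponent
      \<open>?\<phi>\<close> of the correction in range for every \<open>J\<close>.\<close>
    define G where "G J s = (\<Sum>k\<in>{1..J + ?\<phi>}. complex_of_real (c k) * of_nat (n ^ k) powr (- s))" for J s
    have "c k \<ge> 0" for k
      using euler_theorem[OF 3(2)] n unfolding c_def b_def by (intro mult_nonneg_nonneg) auto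
    then have cm: "cmono (G J)" for J
      unfolding G_def[abs_def] using n by (intro cmono_dirichlet_poly) auto
    have hol: "G J holomorphic_on ?A" for J
      unfolding G_def[abs_def] by (intro holomorphic_intros)
    have eq: "landau_term m M n s - G J s = (\<Sum>\<xi>\<in>dchars m. of_real (ln (real n)) * (dterm \<xi> s n ^ (J + ?\<phi> + 1) / (1 - dterm \<xi> s n)))"
      if s: "Re s > 3/2" for s J
    proof -
      have phi: "?\<phi> \<in> {1..J + ?\<phi>}" using m by (simp add: Suc_le_eq)
      have "G J s = (\<Sum>k\<in>{1..J + ?\<phi>}. of_real (ln (real n)) * (\<Sum>\<xi>\<in>dchars m. dterm \<xi> s n ^ k) -
          (if k = ?\<phi> then of_real (b * ln (real n)) * of_nat (n ^ ?\<phi>) powr (- s) else 0))"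
        unfolding G_def
      proof (intro sum.cong refl)
        fix k
        have "(\<Sum>\<xi>\<in>dchars m. dterm \<xi> s n ^ k) = (\<Sum>\<xi>\<in>dchars m. dterm \<xi> s (n ^ k))"
          by (intro sum.cong refl) (simp add: dterm_power)
        also have "\<dots> = (if [n ^ k = 1] (mod m) then of_nat ?\<phi> * of_nat (n ^ k) powr (- s) else 0)"
          by (rule sum_dterm[OF m])
        finally show "complex_of_real (c k) * of_nat (n ^ k) powr (- s) = of_real (ln (real n)) * (\<Sum>\<xi>\<in>dchars m. dterm \<xi> s n ^ k) -
          (if k = ?\<phi> then of_real (b * ln (real n)) * of_nat (n ^ ?\<phi>) powr (- s) else 0)"
          unfolding c_def by (simp add: algebra_simps)
      qed
      also have "\<dots> = of_real (ln (real n)) * (\<Sum>k\<in>{1..J + ?\<phi>}. \<Sum>\<xi>\<in>dchars m. dterm \<xi> s n ^ k) - of_real (b * ln (real n)) * of_nat (n ^ ?\<phi>) powr (- s)"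
        unfolding sum_subtractf sum.delta[OF finite_atLeastAtMost] using phi by (simp add: sum_distrib_left)
      finally have "landau_term m M n s - G J s = (\<Sum>\<xi>\<in>dchars m. euler_logderiv \<xi> n s) - of_real (ln (real n)) * (\<Sum>k\<in>{1..J + ?\<phi>}. \<Sum>\<xi>\<in>dchars m. dterm \<xi> s n ^ k)"
        using 3 by (simp add: landau_term_def b_def)
      also have "\<dots> = (\<Sum>\<xi>\<in>dchars m. euler_logderiv \<xi> n s - of_real (ln (real n)) * (\<Sum>k\<in>{1..J + ?\<phi>}. dterm \<xi> s n ^ k))"
        by (subst sum.swap) (simp add: sum_subtractf sum_distrib_left)
      also have "\<dots> = (\<Sum>\<xi>\<in>dchars m. of_real (ln (real n)) * (dterm \<xi> s n ^ (J + ?\<phi> + 1) / (1 - dterm \<xi> s n)))"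
      proof (intro sum.cong refl)
        fix \<xi> assume \<xi>: "\<xi> \<in> dchars m"
        let ?w = "dterm \<xi> s n"
        have w: "1 - ?w \<noteq> 0" using dterm_neq_1[OF m \<xi>, of s n] s n by simp
        have "(1 - ?w) * (\<Sum>k\<in>{1..N}. ?w ^ k) = ?w - ?w ^ (N + 1)" for N
          by (induction N) (simp_all add: distrib_left, simp add: algebra_simps)
        from this[of "J + ?\<phi>"] have "(\<Sum>k\<in>{1..J + ?\<phi>}. ?w ^ k) = (?w - ?w ^ (J + ?\<phi> + 1)) / (1 - ?w)"
          using w by (metis nonzero_mult_div_cancel_left)
        then show "euler_logderiv \<xi> n s - of_real (ln (real n)) * (\<Sum>k\<in>{1..J + ?\<phi>}. ?w ^ k) = of_real (ln (real n)) * (?w ^ (J + ?\<phi> + 1) / (1 - ?w))"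
          unfolding euler_logderiv_def by (simp add: diff_divide_distrib right_diff_distrib)
      qed
      finally show ?thesis .
    qed
    have bd: "norm (landau_term m M n s - G J s) \<le> real ?\<phi> * ln (real n) * 2 * (1/2) ^ J" if s: "Re s > 3/2" for s J
    proof -
      have "norm (landau_term m M n s - G J s) \<le> (\<Sum>\<xi>\<in>dchars m. ln (real n) * ((1/2) ^ J / (1/2)))"
        unfolding eq[OF s]
      proof (rule sum_norm_le)
        fix \<xi> assume \<xi>: "\<xi> \<in> dchars m"
        let ?w = "dterm \<xi> s n"
        have w: "norm ?w \<le> 1/2" by (rule norm_dterm_le_half[OF m \<xi> s n])
        have "norm (1 - ?w) \<ge> 1/2" using norm_triangle_ineq2[of 1 ?w] w by simp
        moreover have "norm ?w ^ (J + ?\<phi> + 1) \<le> (1/2) ^ J"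
        proof -
          have "norm ?w ^ (J + ?\<phi> + 1) \<le> (1/2) ^ (J + ?\<phi> + 1)" by (intro power_mono w) auto
          also have "\<dots> \<le> (1/2 :: real) ^ J" by (intro power_decreasing) auto
          finally show ?thesis .
        qed
        ultimately have "norm (?w ^ (J + ?\<phi> + 1) / (1 - ?w)) \<le> (1/2) ^ J / (1/2)"
          unfolding norm_divide norm_power by (intro frac_le) auto
        then show "norm (of_real (ln (real n)) * (?w ^ (J + ?\<phi> + 1) / (1 - ?w))) \<le> ln (real n) * ((1/2) ^ J / (1/2))"
          using n unfolding norm_mult by (intro mult_mono) auto
      qed
      then show ?thesis by (simp add: card_dchars[OF m] mult_ac)
    qed
    have "uniform_limit ?A G (landau_term m M n) sequentially"
    proof (rule uniform_limitI)
      fix e :: real assume "e > 0"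
      have "(\<lambda>J. real ?\<phi> * ln (real n) * 2 * (1/2) ^ J) \<longlonglongrightarrow> real ?\<phi> * ln (real n) * 2 * 0"
        by (intro tendsto_intros LIMSEQ_power_zero) auto
      then have "eventually (\<lambda>J. real ?\<phi> * ln (real n) * 2 * (1/2) ^ J < e) sequentially"
        using \<open>e > 0\<close> by (simp add: order_tendsto_iff)
      then show "\<forall>\<^sub>F J in sequentially. \<forall>s\<in>?A. dist (G J s) (landau_term m M n s) < e"
      proof eventually_elim
        case (elim J)
        show ?case
        proof
          fix s assume "s \<in> ?A"
          then show "dist (G J s) (landau_term m M n s) < e" using bd[of s J] elim by (simp add: dist_norm norm_minus_commute)
        qed
      qed
    qed
    then show ?thesis by (rule cmono_uniform_limit[OF _ open_Re_gt _ hol cm]) simp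
  qed
qed

lemma landau_term_bound:
  assumes m: "m > 0" and s: "Re s > 3/2"
  shows "norm (landau_term m M n s) \<le> 3 * real (totient m) * (ln (real n) * real n powr (- 3/2))"
proof (cases "prime n")
  case True
  then have n: "n \<ge> 2" by (simp add: prime_ge_2_nat)
  have phi: "totient m \<ge> 1" using m by (simp add: Suc_le_eq)
  have "norm (\<Sum>\<xi>\<in>dchars m. euler_logderiv \<xi> n s) \<le> (\<Sum>\<xi>\<in>dchars m. ln (real n) * (real n powr (- 3/2) / (1/2)))"
  proof (rule sum_norm_le)
    fix \<xi> assume \<xi>: "\<xi> \<in> dchars m"
    let ?w = "dterm \<xi> s n"
    have w: "norm ?w \<le> 1/2" by (rule norm_dterm_le_half[OF m \<xi> s n])
    have "norm (1 - ?w) \<ge> 1/2" using norm_triangle_ineq2[of 1 ?w] w by simp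
    moreover have "norm ?w \<le> real n powr (- 3/2)" using norm_dterm_le[OF m \<xi>, of "3/2" s n] s by simp
    ultimately have "norm (?w / (1 - ?w)) \<le> real n powr (- 3/2) / (1/2)"
      unfolding norm_divide by (intro frac_le) auto
    then show "norm (euler_logderiv \<xi> n s) \<le> ln (real n) * (real n powr (- 3/2) / (1/2))"
      using n unfolding euler_logderiv_def norm_mult by (intro mult_mono) auto
  qed
  then have 1: "norm (\<Sum>\<xi>\<in>dchars m. euler_logderiv \<xi> n s) \<le> 2 * real (totient m) * (ln (real n) * real n powr (- 3/2))"
    by (simp add: card_dchars[OF m] mult_ac)
  have "norm (of_nat (n ^ totient m) powr (- s) :: complex) \<le> real n powr (- 3/2)"
  proof -
    have "norm (of_nat (n ^ totient m) powr (- s) :: complex) = real (n ^ totient m) powr (- Re s)"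
      by (subst norm_of_nat_powr) (use n in auto)
    also have "\<dots> \<le> real n powr (- Re s)"
    proof (rule powr_mono2')
      have "n ^ 1 \<le> n ^ totient m" using n phi by (intro power_increasing) auto
      then show "real n \<le> real (n ^ totient m)" by (simp only: power_one_right of_nat_le_iff)
    qed (use s n in auto)
    also have "\<dots> \<le> real n powr (- 3/2)" using s n by (intro powr_mono) auto
    finally show ?thesis .
  qed
  then have 2: "norm (of_real (real (totient m) * ln (real n)) * of_nat (n ^ totient m) powr (- s) :: complex) \<le> real (totient m) * ln (real n) * real n powr (- 3/2)"
    unfolding norm_mult norm_of_real using n by (intro mult_mono) auto
  have 3: "0 \<le> real (totient m) * ln (real n) * real n powr (- 3/2)" using n by simp
  show ?thesis
    using 1 2 3 True norm_triangle_ineq4[of "\<Sum>\<xi>\<in>dchars m. euler_logderiv \<xi> n s" "of_real (real (totient m) * ln (real n)) * of_nat (n ^ totient m) powr (- s)"]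
    by (auto simp: landau_term_def simp del: of_nat_power)
next
  case False
  then show ?thesis by (cases "n = 0") (auto simp: landau_term_def)
qed


lemma dchars_one: "dchars (Suc 0) = {char0 (Suc 0)}"
proof -
  have "card (dchars (Suc 0)) = 1" using card_dchars[of "Suc 0"] by simp
  then obtain x where "dchars (Suc 0) = {x}" by (rule card_1_singletonE)
  then show ?thesis using char0_in[of "Suc 0"] by auto
qed

lemma Lprod_one_1: "Lprod (Suc 0) 1 \<noteq> 0"
  by (simp add: Lprod_def dchars_one Lcont_char0_1)

text \<open>The case \<open>m = 1\<close>, where the pole is known, shows that the primes are too dense for this sum to stay bounded.\<close>
lemma primes_sqrt_unbounded: "\<exists>M. (\<Sum>p\<in>primes_le M. real p powr (- 1/2)) > C"
proof (rule ccontr)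
  assume "\<not> ?thesis"
  then have C: "(\<Sum>p\<in>primes_le M. real p powr (- 1/2)) \<le> C" for M by (simp add: not_less)
  have bound: "norm (Pser (Suc 0) (1 + of_real x)) \<le> 2 * C" if x: "x > 0" for x
  proof -
    let ?t = "\<lambda>n. complex_of_real (prime_wt (Suc 0) n) * of_nat n powr (- (1 + of_real x))"
    have sm: "summable (\<lambda>n. norm (?t n))" by (rule Pser_norm_summable) (use x in auto)
    have le: "norm (?t n) \<le> (if prime n then 2 * real n powr (- 1/2) else 0)" for n
    proof (cases "prime n")
      case True
      then have n: "n \<ge> 2" by (simp add: prime_ge_2_nat)
      \<comment> \<open>ln n is at most 2 sqrt n, so the size (ln n) / n of a term of
        \<open>Pser\<close> near s = 1 is at most 2 n^(-1/2).\<close>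
      have "ln (real n) \<le> real n powr (1/2) / (1/2)" by (rule ln_powr_bound) (use n in auto)
      moreover have "norm (of_nat n powr (- (1 + of_real x)) :: complex) \<le> real n powr (- 1)"
      proof -
        have "norm (of_nat n powr (- (1 + of_real x)) :: complex) = real n powr (- 1 - x)"
          by (subst norm_of_nat_powr) (use n in auto)
        also have "\<dots> \<le> real n powr (- 1)" by (rule powr_mono) (use n x in auto)
        finally show ?thesis .
      qed
      ultimately have "norm (?t n) \<le> (real n powr (1/2) / (1/2)) * real n powr (- 1)"
        unfolding norm_mult using True n by (intro mult_mono) (auto simp: prime_wt_def)
      also have "\<dots> = 2 * (real n powr (1/2) * real n powr (- 1))" by simp
      also have "real n powr (1/2) * real n powr (- 1) = real n powr (- 1/2)"
        by (subst powr_add[symmetric]) simp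
      finally show ?thesis using True by simp
    qed (simp add: prime_wt_def)
    have part: "(\<Sum>n<N. norm (?t n)) \<le> 2 * C" for N
    proof -
      have "(\<Sum>n<N. norm (?t n)) \<le> (\<Sum>n<N. if prime n then 2 * real n powr (- 1/2) else 0)"
        by (rule sum_mono) (rule le)
      also have "\<dots> = (\<Sum>n\<in>{n\<in>{..<N}. prime n}. 2 * real n powr (- 1/2))"
        by (rule sum.inter_filter[symmetric]) simp
      also have "\<dots> \<le> (\<Sum>n\<in>primes_le N. 2 * real n powr (- 1/2))"
        by (rule sum_mono2) (auto simp: primes_le_def)
      also have "\<dots> = 2 * (\<Sum>n\<in>primes_le N. real n powr (- 1/2))" by (simp add: sum_distrib_left)
      also have "\<dots> \<le> 2 * C" using C[of N] by simp
      finally show ?thesis .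
    qed
    have "norm (Pser (Suc 0) (1 + of_real x)) \<le> (\<Sum>n. norm (?t n))"
      unfolding Pser_def by (rule summable_norm[OF sm])
    also have "\<dots> \<le> 2 * C" by (rule suminf_le_const[OF sm part])
    finally show ?thesis .
  qed
  \<comment> \<open>For modulus 1 \<open>Lprod\<close> does not vanish at 1, so \<open>Pser\<close>
    has residue 1 there, against the boundedness just derived.\<close>
  obtain n :: nat where "n = 0" and lim: "((\<lambda>x. of_real x * (of_nat (totient (Suc 0)) * Pser (Suc 0) (1 + \<i> * of_real 0 + of_real x))) \<longlongrightarrow> 1 - of_nat n) (at_right (0::real))"
    using Pser_limit[of "Suc 0" 0] Lprod_one_1 by auto
  have "((\<lambda>x. of_real x * (of_nat (totient (Suc 0)) * Pser (Suc 0) (1 + \<i> * of_real 0 + of_real x))) \<longlongrightarrow> 0) (at_right (0::real))"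
  proof (rule Lim_null_comparison)
    show "\<forall>\<^sub>F x in at_right (0::real). norm (of_real x * (of_nat (totient (Suc 0)) * Pser (Suc 0) (1 + \<i> * of_real 0 + of_real x))) \<le> x * (2 * C)"
      using eventually_at_right_less[of 0]
    proof eventually_elim
      case (elim x)
      then show ?case using bound[of x] by (simp add: norm_mult mult_left_mono)
    qed
    show "((\<lambda>x. x * (2 * C)) \<longlongrightarrow> 0) (at_right 0)" by (rule tendsto_eq_intros tendsto_ident_at refl | simp)+
  qed
  then have "(1 - of_nat n :: complex) = 0" using lim tendsto_unique[OF trivial_limit_at_right_real] by blast
  then show False using \<open>n = 0\<close> by simp
qed

definition landau_sum :: "nat \<Rightarrow> nat \<Rightarrow> complex \<Rightarrow> complex" where
  "landau_sum m M s = (\<Sum>p\<in>landau_corr m M. of_nat (p ^ totient m) powr (- s))"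

lemma landau_corrD: "p \<in> landau_corr m M \<Longrightarrow> prime p \<and> p \<le> M \<and> coprime p m"
  by (auto simp: landau_corr_def primes_le_def)

lemma finite_landau_corr [simp]: "finite (landau_corr m M)"
  by (simp add: landau_corr_def)

lemma landau_series:
  assumes m: "m > 0"
  shows "cmono (\<lambda>s. \<Sum>n. landau_term m M n s)" "(\<lambda>s. \<Sum>n. landau_term m M n s) holomorphic_on {s. Re s > 3/2}"
proof -
  let ?A = "{s. Re s > 3/2}" and ?M = "\<lambda>n. 3 * real (totient m) * (ln (real n) * real n powr (- 3/2))"
  have sm: "summable ?M" by (intro summable_mult summable_ln_powr) auto
  have ul: "uniform_limit ?A (\<lambda>N s. \<Sum>n<N. landau_term m M n s) (\<lambda>s. \<Sum>n. landau_term m M n s) sequentially"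
    by (rule uniform_limit_suminf_local[OF sm]) (use landau_term_bound[OF m] in auto)
  have hol: "(\<lambda>s. \<Sum>n<N. landau_term m M n s) holomorphic_on ?A" for N
    by (intro holomorphic_intros landau_term_holomorphic[OF m])
  have "cmono (\<lambda>s. \<Sum>n<N. landau_term m M n s)" for N
    unfolding cmono_def
  proof
    fix j
    have "(deriv ^^ j) (\<lambda>s. \<Sum>n<N. landau_term m M n s) 2 = (\<Sum>n<N. (deriv ^^ j) (landau_term m M n) 2)"
    proof (induction N)
      case (Suc N)
      have "(deriv ^^ j) (\<lambda>s. (\<Sum>n<N. landau_term m M n s) + landau_term m M N s) 2 =
         (deriv ^^ j) (\<lambda>s. \<Sum>n<N. landau_term m M n s) 2 + (deriv ^^ j) (landau_term m M N) 2"
        by (rule higher_deriv_add[OF hol landau_term_holomorphic[OF m] open_Re_gt]) simp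
      then show ?case using Suc by simp
    next
      case 0
      have "(deriv ^^ j) (\<lambda>_. 0) = (\<lambda>_. 0 :: complex)" by (induction j) auto
      then show ?case by simp
    qed
    then show "(-1) ^ j * (deriv ^^ j) (\<lambda>s. \<Sum>n<N. landau_term m M n s) 2 \<in> \<real>\<^sub>\<ge>\<^sub>0"
      using landau_term_cmono[OF m] by (simp add: sum_distrib_left cmono_def nonneg_Reals_sumI)
  qed
  then show "cmono (\<lambda>s. \<Sum>n. landau_term m M n s)"
    by (intro cmono_uniform_limit[OF ul open_Re_gt _ hol]) auto
  show "(\<lambda>s. \<Sum>n. landau_term m M n s) holomorphic_on ?A"
  proof (rule holomorphic_uniform_sequence[OF open_Re_gt hol])
    fix z assume "z \<in> ?A"
    then obtain d where "d > 0" "cball z d \<subseteq> ?A" using open_Re_gt[of "3/2"] open_contains_cball by blast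
    then show "\<exists>d>0. cball z d \<subseteq> ?A \<and> uniform_limit (cball z d) (\<lambda>N s. \<Sum>n<N. landau_term m M n s) (\<lambda>s. \<Sum>n. landau_term m M n s) sequentially"
      using uniform_limit_on_subset[OF ul] by blast
  qed
qed

lemma landau_sum_deriv:
  "(landau_sum m M has_field_derivative - (\<Sum>p\<in>landau_corr m M. of_real (real (totient m) * ln (real p)) * of_nat (p ^ totient m) powr (- s))) (at s)"
proof -
  have "((\<lambda>s. of_nat (p ^ totient m) powr (- s)) has_field_derivative - (of_real (real (totient m) * ln (real p)) * of_nat (p ^ totient m) powr (- s))) (at s)"
    if "p \<in> landau_corr m M" for p
  proof -
    have p: "p > 0" using landau_corrD[OF that] by (simp add: prime_gt_0_nat)
    then have "ln (real (p ^ totient m)) = real (totient m) * ln (real p)" by (simp add: ln_realpow)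
    then show ?thesis using dterm_deriv[of "p ^ totient m" "\<lambda>_. 1" s] p by (simp add: dterm_def del: of_nat_power)
  qed
  then show ?thesis unfolding landau_sum_def[abs_def] sum_negf[symmetric] by (intro DERIV_sum)
qed

lemma landau_series_eq:
  assumes m: "m > 0" and s: "Re s > 3/2"
  shows "(\<Sum>n. landau_term m M n s) = 1 / (s - 1) - deriv (Lprod m) s / Lprod m s
      - (\<Sum>p\<in>landau_corr m M. of_real (real (totient m) * ln (real p)) * of_nat (p ^ totient m) powr (- s))"
proof -
  let ?c = "\<lambda>p. complex_of_real (real (totient m) * ln (real p)) * of_nat (p ^ totient m) powr (- s)"
  have "summable (\<lambda>n. 3 * real (totient m) * (ln (real n) * real n powr (- 3/2)))"
    by (intro summable_mult summable_ln_powr) auto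
  then have "summable (\<lambda>n. landau_term m M n s)"
    by (rule summable_comparison_test'[of _ 0]) (rule landau_term_bound[OF m s])
  then have "(\<lambda>N. \<Sum>n<Suc N. landau_term m M n s) \<longlonglongrightarrow> (\<Sum>n. landau_term m M n s)"
    using summable_LIMSEQ LIMSEQ_Suc by blast
  moreover have "(\<lambda>N. (\<Sum>p\<in>primes_le N. \<Sum>\<xi>\<in>dchars m. euler_logderiv \<xi> p s) - (\<Sum>p\<in>landau_corr m M. ?c p)) \<longlonglongrightarrow>
     1 / (s - 1) - deriv (Lprod m) s / Lprod m s - (\<Sum>p\<in>landau_corr m M. ?c p)"
    by (intro tendsto_diff tendsto_const Lprod_logderiv_lim[OF m]) (use s in auto)
  moreover have "eventually (\<lambda>N. (\<Sum>p\<in>primes_le N. \<Sum>\<xi>\<in>dchars m. euler_logderiv \<xi> p s) - (\<Sum>p\<in>landau_corr m M. ?c p)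
      = (\<Sum>n<Suc N. landau_term m M n s)) sequentially"
    \<comment> \<open>From \<open>N = M\<close> on, all corrected primes lie in
      \<open>primes_le N\<close>, so the finite correction is complete.\<close>
    using eventually_ge_at_top[of M]
  proof eventually_elim
    case (elim N)
    have "(\<Sum>n<Suc N. landau_term m M n s) = (\<Sum>p\<in>primes_le N. landau_term m M p s)"
      unfolding primes_le_sum by (intro sum.cong refl) (simp add: landau_term_def)
    also have "\<dots> = (\<Sum>p\<in>primes_le N. (\<Sum>\<xi>\<in>dchars m. euler_logderiv \<xi> p s) - (if p \<in> landau_corr m M then ?c p else 0))"
      by (intro sum.cong refl) (simp add: landau_term_def primes_le_def)
    also have "\<dots> = (\<Sum>p\<in>primes_le N. \<Sum>\<xi>\<in>dchars m. euler_logderiv \<xi> p s) - (\<Sum>p\<in>{p\<in>primes_le N. p \<in> landau_corr m M}. ?c p)"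
      unfolding sum_subtractf by (subst sum.inter_filter) auto
    also have "{p\<in>primes_le N. p \<in> landau_corr m M} = landau_corr m M"
      using elim by (auto simp: landau_corr_def primes_le_def)
    finally show ?case by simp
  qed
  ultimately show ?thesis using LIMSEQ_unique[OF _ Lim_transform_eventually] by blast
qed

lemma Lprod_nonzero_1:
  assumes m: "m > 0" shows "Lprod m 1 \<noteq> 0"
proof
  assume L1: "Lprod m 1 = 0"
  let ?\<phi> = "totient m"
  \<comment> \<open>\<open>Lprod m s / (s - 1)\<close> with the singularity at 1 removed: under the
    assumption \<open>L1\<close> this is the product of the \<open>L\<close>-functions, holomorphic
    for Re s > 0.\<close>
  define F where "F s = (if s = 1 then deriv (Lprod m) 1 else (Lprod m s - Lprod m 1) / (s - 1))" for s
  have Fhol: "F holomorphic_on {s. Re s > 0}"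
    unfolding F_def[abs_def] by (rule pole_lemma_open[OF Lprod_holomorphic[OF m] open_Re_gt])
  have F_eq: "F s = Lprod m s / (s - 1)" if "Re s > 1" for s using that L1 by (auto simp: F_def)
  have F2: "F 2 \<noteq> 0" using F_eq[of 2] Lprod_nonzero[OF m, of 2] by simp
  have Fd: "(F has_field_derivative F s * (deriv (Lprod m) s / Lprod m s - 1 / (s - 1))) (at s)" if s: "Re s > 1" for s
  proof -
    have s1: "s - 1 \<noteq> 0" using s by auto
    have Ld: "(Lprod m has_field_derivative deriv (Lprod m) s) (at s)"
      by (rule holomorphic_derivI[OF Lprod_holomorphic[OF m] open_Re_gt]) (use s in auto)
    have "((\<lambda>s. Lprod m s / (s - 1)) has_field_derivative (deriv (Lprod m) s * (s - 1) - Lprod m s * (1 - 0)) / ((s - 1) * (s - 1))) (at s)"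
      by (intro DERIV_divide Ld DERIV_diff DERIV_ident DERIV_const s1)
    then have "(F has_field_derivative (deriv (Lprod m) s * (s - 1) - Lprod m s * (1 - 0)) / ((s - 1) * (s - 1))) (at s)"
      by (rule has_field_derivative_transform_within_open[OF _ open_Re_gt[of 1]]) (use s in \<open>auto simp: F_eq\<close>)
    moreover have "(l' * x - l * (1 - 0)) / (x * x) = l / x * (l' / l - 1 / x)" if "l \<noteq> 0" "x \<noteq> 0" for l l' x :: complex
      using that by (simp add: field_simps)
    ultimately show ?thesis using Lprod_nonzero[OF m s] s1 F_eq[OF s] by metis
  qed
  define c where "c M s = exp (- landau_sum m M s)" for M s
  have ls_hol: "landau_sum m M holomorphic_on S" for M S
    unfolding landau_sum_def[abs_def] by (intro holomorphic_intros)
  have lower: "norm (F 2 * c M 2) \<le> norm (F (of_real x) * c M (of_real x))" if x: "0 < x" "x < 2" for x M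
  proof -
    \<comment> \<open>Dividing by the value at 2 makes \<open>H 2 = 1\<close>, which supplies the
      nonnegative real initial value for \<open>cmono_ode\<close>.\<close>
    define H where "H s = F s * c M s / (F 2 * c M 2)" for s
    have nz: "F 2 * c M 2 \<noteq> 0" using F2 by (simp add: c_def)
    have Hhol: "H holomorphic_on {s. Re s > 0}"
      unfolding H_def[abs_def] c_def using nz by (intro holomorphic_intros Fhol ls_hol) (simp add: c_def)
    have "cmono H"
    proof (rule cmono_ode[where N = "\<lambda>s. \<Sum>n. landau_term m M n s", OF open_Re_gt[of "3/2"]])
      show "H holomorphic_on {s. Re s > 3/2}" by (rule holomorphic_on_subset[OF Hhol]) auto
      show "H 2 \<in> \<real>\<^sub>\<ge>\<^sub>0" using nz by (simp add: H_def)
      fix s assume "s \<in> {s. Re s > 3/2}"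
      then have s: "Re s > 3/2" by simp
      let ?l = "deriv (Lprod m) s / Lprod m s - 1 / (s - 1)"
      let ?c = "\<Sum>p\<in>landau_corr m M. of_real (real ?\<phi> * ln (real p)) * of_nat (p ^ ?\<phi>) powr (- s)"
      have cd: "(c M has_field_derivative c M s * ?c) (at s)"
        unfolding c_def using DERIV_chain2[OF DERIV_exp DERIV_minus[OF landau_sum_deriv[of m M s]]] by simp
      have "(H has_field_derivative (F s * ?l * c M s + c M s * ?c * F s) / (F 2 * c M 2)) (at s)"
        unfolding H_def[abs_def] by (intro DERIV_cdivide DERIV_mult Fd cd) (use s in auto)
      moreover have "(F s * ?l * c M s + c M s * ?c * F s) / (F 2 * c M 2) = - (- ?l - ?c) * H s"
      proof -
        have "(f * l * k + k * d * f) / q = - (- l - d) * (f * k / q)" for f l k d q :: complex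
          by (simp add: algebra_simps add_divide_distrib)
        then show ?thesis unfolding H_def .
      qed
      moreover have "(\<Sum>n. landau_term m M n s) = - ?l - ?c"
        unfolding landau_series_eq[OF m s] by simp
      ultimately show "deriv H s = - (\<Sum>n. landau_term m M n s) * H s" by (metis DERIV_imp_deriv)
    qed (use landau_series[OF m] in auto)
    from cmono_lower_bound[OF Hhol this x] have "1 \<le> Re (H (of_real x))" using nz by (simp add: H_def)
    also have "\<dots> \<le> norm (H (of_real x))" by (rule complex_Re_le_cmod)
    finally show ?thesis using nz unfolding H_def norm_divide by (simp add: le_divide_eq)
  qed
  have ls_real: "landau_sum m M (of_real x) = of_real (\<Sum>p\<in>landau_corr m M. real p powr (- (real ?\<phi> * x)))" for M x
    unfolding landau_sum_def of_real_sum
  proof (intro sum.cong refl)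
    fix p assume "p \<in> landau_corr m M"
    then have p: "p > 0" using landau_corrD prime_gt_0_nat by blast
    have "of_nat (p ^ ?\<phi>) powr (- complex_of_real x) = of_real (real (p ^ ?\<phi>) powr (- x))"
      using powr_of_real[of "real (p ^ ?\<phi>)" "- x"] by simp
    also have "real (p ^ ?\<phi>) powr (- x) = real p powr (- (real ?\<phi> * x))"
      using p by (simp add: powr_realpow[symmetric] powr_powr)
    finally show "of_nat (p ^ ?\<phi>) powr (- complex_of_real x) = of_real (real p powr (- (real ?\<phi> * x)))" .
  qed
  have phi: "?\<phi> \<ge> 1" using m by (simp add: Suc_le_eq)
  \<comment> \<open>With \<phi> x = 1/2 the correction at \<open>x\<close> is the sum of p^(-1/2),
    which is unbounded in \<open>M\<close>.\<close>
  define x where "x = 1 / (2 * real ?\<phi>)"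
  have "x \<le> 1 / 2" unfolding x_def using phi m by (intro divide_left_mono) auto
  moreover have "0 < x" "real ?\<phi> * x = 1/2" using phi m by (auto simp: x_def)
  ultimately have x: "0 < x" "x < 2" "real ?\<phi> * x = 1/2" by auto
  let ?S = "\<lambda>M a. \<Sum>p\<in>landau_corr m M. real p powr a"
  have norm_c: "norm (c M (of_real y)) = exp (- ?S M (- (real ?\<phi> * y)))" for M y
    unfolding c_def ls_real by (simp flip: of_real_minus)
  \<comment> \<open>At the point 2 the exponent is -2 \<phi> \<le> -2, so the correction there is
    bounded independently of \<open>M\<close>.\<close>
  define Z where "Z = (\<Sum>n. real n powr (- 2))"
  have "?S M (- (real ?\<phi> * 2)) \<le> Z" for M
  proof -
    have "?S M (- (real ?\<phi> * 2)) \<le> ?S M (- 2)"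
    proof (intro sum_mono powr_mono)
      fix p assume "p \<in> landau_corr m M"
      then have "p > 0" using landau_corrD prime_gt_0_nat by blast
      then show "1 \<le> real p" by simp
    qed (use phi in auto)
    also have "\<dots> \<le> Z" unfolding Z_def by (intro sum_le_suminf) (auto simp: summable_real_powr_iff)
    finally show ?thesis .
  qed
  then have lo: "norm (F 2) * exp (- Z) \<le> norm (F (of_real x)) * exp (- ?S M (- 1/2))" for M
    using lower[OF x(1,2), of M] norm_c[of M 2] norm_c[of M x] x(3)
    by (simp add: norm_mult) (meson exp_le_cancel_iff mult_left_mono neg_le_iff_le norm_ge_zero order_trans)
  have F2p: "norm (F 2) * exp (- Z) > 0" using F2 by simp
  have Fx: "norm (F (of_real x)) > 0" using lo[of 0] F2p by (metis less_le_trans norm_ge_zero not_less mult_zero_left order_le_less)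
  define C where "C = ln (norm (F (of_real x)) / (norm (F 2) * exp (- Z)))"
  have SC: "?S M (- 1/2) \<le> C" for M
  proof -
    have "exp (?S M (- 1/2)) \<le> norm (F (of_real x)) / (norm (F 2) * exp (- Z))"
      using lo[of M] F2p by (simp add: exp_minus field_simps)
    then show ?thesis unfolding C_def using F2p Fx by (subst ln_ge_iff) auto
  qed
  \<comment> \<open>\<open>landau_corr\<close> leaves out the primes dividing \<open>m\<close>;
    their finite contribution is added to the threshold.\<close>
  obtain M where M: "(\<Sum>p\<in>primes_le M. real p powr (- 1/2)) > C + (\<Sum>p\<in>prime_factors m. real p powr (- 1/2))"
    using primes_sqrt_unbounded by blast
  have "primes_le M \<subseteq> landau_corr m M \<union> prime_factors m"
    using m by (auto simp: landau_corr_def primes_le_def prime_factors_dvd prime_imp_coprime)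
  then have "(\<Sum>p\<in>primes_le M. real p powr (- 1/2)) \<le> (\<Sum>p\<in>landau_corr m M \<union> prime_factors m. real p powr (- 1/2))"
    by (intro sum_mono2) auto
  also have "\<dots> \<le> ?S M (- 1/2) + (\<Sum>p\<in>prime_factors m. real p powr (- 1/2))"
  proof -
    have "0 \<le> (\<Sum>p\<in>landau_corr m M \<inter> prime_factors m. real p powr (- 1/2))" by (intro sum_nonneg) auto
    then show ?thesis by (subst sum_Un) auto
  qed
  finally show False using M SC[of M] by simp
qed

section \<open>The Fejer kernel\<close>

text \<open>The square of sin (u/2) / (u/2), continued by 1 at 0. It is the cosine transform of the
  triangle 1 - |t| on [-1, 1].\<close>

definition fejer :: "real \<Rightarrow> real" where
  "fejer u = (if u = 0 then 1 else 2 * (1 - cos u) / u\<^sup>2)"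

lemma one_minus_cos: "1 - cos u = 2 * (sin (u / 2))\<^sup>2" for u :: real
  using cos_double_sin[of "u / 2"] by simp

lemma one_minus_cos_le: "1 - cos u \<le> u\<^sup>2 / 2" for u :: real
proof -
  have "(sin (u / 2))\<^sup>2 \<le> (u / 2)\<^sup>2" using abs_sin_x_le_abs_x[of "u / 2"] by (metis abs_le_square_iff)
  then show ?thesis unfolding one_minus_cos by (simp add: power_divide)
qed

lemma fejer_nonneg: "fejer u \<ge> 0"
  by (simp add: fejer_def)

lemma fejer_le_1: "fejer u \<le> 1"
  using one_minus_cos_le[of u] by (auto simp: fejer_def field_simps)

lemma fejer_le: "fejer u \<le> 8 * inverse (1 + u\<^sup>2)"
proof -
  have pos: "1 + u\<^sup>2 > 0" by (smt (verit) zero_le_power2)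
  \<comment> \<open>The bounds 1 for the kernel and 4 for its product with u^2 add up to 5; 8 leaves
    room.\<close>
  have "fejer u * (1 + u\<^sup>2) \<le> 8"
  proof (cases "u = 0")
    case False
    have "fejer u * u\<^sup>2 = 2 * (1 - cos u)" using False by (simp add: fejer_def)
    also have "2 * (1 - cos u) \<le> 2 * (1 - (- 1))" by (intro mult_left_mono diff_left_mono cos_ge_minus_one) simp
    finally show ?thesis using fejer_le_1[of u] by (simp add: algebra_simps)
  qed (simp add: fejer_def)
  then show ?thesis using pos by (simp add: field_simps)
qed

lemma fejer_measurable [measurable]: "fejer \<in> borel_measurable borel"
  unfolding fejer_def[abs_def] by measurable

lemma fejer_integrable: "integrable lborel fejer"
proof (rule Bochner_Integration.integrable_bound)
  show "integrable lborel (\<lambda>u. 8 * inverse (1 + u\<^sup>2) :: real)"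
    using integrable_inverse_1_plus_square by (simp add: set_integrable_def)
  show "AE u in lborel. norm (fejer u) \<le> norm (8 * inverse (1 + u\<^sup>2) :: real)"
    using fejer_le fejer_nonneg by (intro AE_I2) (smt (verit) real_norm_def)
qed measurable

lemma fejer_has_integral: "((\<lambda>t. 2 * (1 - t) * cos (t * x)) has_integral fejer x) {0..1}"
proof (cases "x = 0")
  case True
  have "((\<lambda>t. 2 * (1 - t)) has_integral ((2 * 1 - 1\<^sup>2) - (2 * 0 - 0\<^sup>2))) {0..1::real}"
    by (rule fundamental_theorem_of_calculus) 
       (auto intro!: derivative_eq_intros simp flip: has_real_derivative_iff_has_vector_derivative)
  then show ?thesis using True by (simp add: fejer_def)
next
  case False
  let ?A = "\<lambda>t. 2 * ((1 - t) * sin (t * x) / x - cos (t * x) / x\<^sup>2)"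
  have "((\<lambda>t. 2 * (1 - t) * cos (t * x)) has_integral (?A 1 - ?A 0)) {0..1}"
  proof (rule fundamental_theorem_of_calculus)
    fix t :: real
    have "(?A has_real_derivative 2 * (1 - t) * cos (t * x)) (at t within {0..1})"
      by (rule derivative_eq_intros refl | use False in \<open>simp add: field_simps power2_eq_square\<close>)+
    then show "(?A has_vector_derivative 2 * (1 - t) * cos (t * x)) (at t within {0..1})"
      by (simp add: has_real_derivative_iff_has_vector_derivative)
  qed simp
  also have "?A 1 - ?A 0 = fejer x" using False by (simp add: fejer_def diff_divide_distrib)
  finally show ?thesis .
qed

text \<open>In the integral representation cos (t u) \<ge> 1/2. The bound allows
  \<open>window\<close> to divide by the kernel on an interval of length one.\<close>

lemma fejer_ge: assumes "\<bar>u\<bar> \<le> 1" shows "fejer u \<ge> 1/2"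
proof -
  have "((\<lambda>t. 2 * (1 - t) * (1/2)) has_integral ((1 - 1\<^sup>2/2) - (0 - 0\<^sup>2/2))) {0..1::real}"
    by (rule fundamental_theorem_of_calculus) 
       (auto intro!: derivative_eq_intros simp flip: has_real_derivative_iff_has_vector_derivative)
  then have 1: "((\<lambda>t. 2 * (1 - t) * (1/2)) has_integral (1/2)) {0..1::real}" by simp
  show ?thesis
  proof (rule has_integral_le[OF 1 fejer_has_integral])
    fix t :: real assume t: "t \<in> {0..1}"
    have "\<bar>t * u\<bar> \<le> 1 * 1" unfolding abs_mult using t assms by (intro mult_mono) auto
    then have "(t * u)\<^sup>2 \<le> 1" by (simp add: abs_square_le_1)
    then have "1/2 \<le> cos (t * u)" using one_minus_cos_le[of "t * u"] by simp
    then show "2 * (1 - t) * (1/2) \<le> 2 * (1 - t) * cos (t * u)" using t by (intro mult_left_mono) auto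
  qed
qed

text \<open>The Fourier transform of the Fejer kernel is supported in \<open>[-1, 1]\<close>; the integral over this
  interval is folded to \<open>[0, 1]\<close>.\<close>
definition fold_int :: "real \<Rightarrow> (real \<Rightarrow> complex) \<Rightarrow> complex" where
  "fold_int \<xi> W = integral {0..1} (\<lambda>t. of_real (1 - t) * (W (\<xi> + t) + W (\<xi> - t)))"

lemma fejer_cis_has_integral:
  "((\<lambda>t. of_real (1 - t) * (cis ((\<xi> + t) * x) + cis ((\<xi> - t) * x))) has_integral (of_real (fejer x) * cis (\<xi> * x))) {0..1}"
proof -
  have "((\<lambda>t. complex_of_real (2 * (1 - t) * cos (t * x))) has_integral complex_of_real (fejer x)) {0..1}"
    by (rule has_integral_of_real[OF fejer_has_integral])
  then have "((\<lambda>t. complex_of_real (2 * (1 - t) * cos (t * x)) * cis (\<xi> * x)) has_integral (of_real (fejer x) * cis (\<xi> * x))) {0..1}"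
    by (rule has_integral_mult_left)
  moreover have "complex_of_real (2 * (1 - t) * cos (t * x)) * cis (\<xi> * x) = of_real (1 - t) * (cis ((\<xi> + t) * x) + cis ((\<xi> - t) * x))" for t
    by (simp add: complex_eq_iff distrib_right left_diff_distrib cos_add sin_add cos_diff sin_diff algebra_simps)
  ultimately show ?thesis by simp
qed

lemma fold_int_cis: "fold_int \<xi> (\<lambda>\<tau>. cis (\<tau> * x)) = of_real (fejer x) * cis (\<xi> * x)"
  unfolding fold_int_def by (rule integral_unique[OF fejer_cis_has_integral])

lemma cis_continuous [continuous_intros]: "continuous_on A f \<Longrightarrow> continuous_on A (\<lambda>x. cis (f x))"
  unfolding cis_conv_exp by (intro continuous_intros)

text \<open>One integration by parts gains a factor 1/v, while the boundary terms and the integral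
  of \<open>f'\<close> stay bounded.\<close>

lemma riemann_lebesgue_C1:
  fixes f f' :: "real \<Rightarrow> complex"
  assumes f: "\<And>t. t \<in> {0..1} \<Longrightarrow> (f has_vector_derivative f' t) (at t within {0..1})"
    and f': "continuous_on {0..1} f'" and c: "c \<noteq> 0"
  shows "((\<lambda>v. integral {0..1} (\<lambda>t. f t * cis (c * t * v))) \<longlongrightarrow> 0) at_top"
proof -
  have fc: "continuous_on {0..1} f"
    using f by (meson continuous_on_eq_continuous_within has_vector_derivative_continuous)
  obtain B where B: "\<And>t. t \<in> {0..1} \<Longrightarrow> norm (f' t) \<le> B"
    using compact_imp_bounded[OF compact_continuous_image[OF f' compact_Icc]] unfolding bounded_iff by blast
  have bound: "norm (integral {0..1} (\<lambda>t. f t * cis (c * t * v))) \<le> (norm (f 1) + norm (f 0) + B) / (\<bar>c\<bar> * v)" if v: "v > 0" for v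
  proof -
    let ?I = "integral {0..1} (\<lambda>t. f t * cis (c * t * v))" and ?J = "integral {0..1} (\<lambda>t. f' t * cis (c * t * v))"
    have d: "((\<lambda>t. cis (c * t * v)) has_vector_derivative \<i> * of_real (c * v) * cis (c * t * v)) (at t within {0..1})" for t
    proof -
      have "((\<lambda>z. exp (\<i> * of_real (c * v) * z)) has_field_derivative \<i> * of_real (c * v) * exp (\<i> * of_real (c * v) * of_real t)) (at (of_real t))"
        by (auto intro!: derivative_eq_intros)
      from has_vector_derivative_real_field[OF this] show ?thesis by (simp add: cis_conv_exp mult_ac)
    qed
    have "((\<lambda>t. f t * (\<i> * of_real (c * v) * cis (c * t * v)) + f' t * cis (c * t * v)) has_integral
       (f 1 * cis (c * 1 * v) - f 0 * cis (c * 0 * v))) {0..1}"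
      by (rule fundamental_theorem_of_calculus[OF zero_le_one has_vector_derivative_mult[OF f d]])
    then have A: "((\<lambda>t. \<i> * of_real (c * v) * (f t * cis (c * t * v)) + f' t * cis (c * t * v)) has_integral
       (f 1 * cis (c * 1 * v) - f 0 * cis (c * 0 * v))) {0..1}"
      by (simp add: mult.left_commute mult.assoc)
    have "((\<lambda>t. f t * cis (c * t * v)) has_integral ?I) {0..1}"
      by (intro integrable_integral integrable_continuous_interval continuous_intros fc)
    then have B1: "((\<lambda>t. \<i> * of_real (c * v) * (f t * cis (c * t * v))) has_integral (\<i> * of_real (c * v) * ?I)) {0..1}"
      by (rule has_integral_mult_right)
    have B2: "((\<lambda>t. f' t * cis (c * t * v)) has_integral ?J) {0..1}"
      by (intro integrable_integral integrable_continuous_interval continuous_intros f')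
    have "f 1 * cis (c * 1 * v) - f 0 * cis (c * 0 * v) = \<i> * of_real (c * v) * ?I + ?J"
      by (rule has_integral_unique[OF A has_integral_add[OF B1 B2]])
    then have I_eq: "\<i> * of_real (c * v) * ?I = f 1 * cis (c * v) - f 0 - ?J" by simp
    have "\<bar>c\<bar> * v * norm ?I = norm (\<i> * of_real (c * v) * ?I)"
      using v by (simp add: norm_mult abs_mult)
    also have "\<dots> = norm (f 1 * cis (c * v) - f 0 - ?J)" by (simp only: I_eq)
    also have "\<dots> \<le> norm (f 1 * cis (c * v)) + norm (f 0) + norm ?J"
      using norm_triangle_ineq4[of "f 1 * cis (c * v) - f 0" ?J] norm_triangle_ineq4[of "f 1 * cis (c * v)" "f 0"] by simp
    also have "norm ?J \<le> B * (1 - 0)"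
      by (rule integral_bound) (auto intro!: continuous_intros f' simp: norm_mult B)
    finally show ?thesis using v c by (simp add: norm_mult field_simps)
  qed
  show ?thesis
  proof (rule Lim_null_comparison)
    show "\<forall>\<^sub>F v in at_top. norm (integral {0..1} (\<lambda>t. f t * cis (c * t * v))) \<le> (norm (f 1) + norm (f 0) + B) / (\<bar>c\<bar> * v)"
      using eventually_gt_at_top[of 0] by eventually_elim (rule bound)
    show "((\<lambda>v. (norm (f 1) + norm (f 0) + B) / (\<bar>c\<bar> * v)) \<longlongrightarrow> 0) at_top"
    proof (rule real_tendsto_divide_at_top[OF tendsto_const])
      show "filterlim (\<lambda>v. \<bar>c\<bar> * v) at_top at_top"
        using c by (intro filterlim_tendsto_pos_mult_at_top[OF tendsto_const _ filterlim_ident]) auto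
    qed
  qed
qed

section \<open>Exchanging the folded integral with sums and limits\<close>

lemma fold_int_continuous_integrable:
  fixes W :: "real \<Rightarrow> complex"
  assumes "continuous_on {\<xi> - 1..\<xi> + 1} W"
  shows "(\<lambda>t. of_real (1 - t) * (W (\<xi> + t) + W (\<xi> - t))) integrable_on {0..1}"
  by (intro integrable_continuous_interval continuous_intros continuous_on_compose2[OF assms]) auto

lemma fold_int_uniform_limit:
  assumes c: "\<And>n. continuous_on UNIV (f n)" and u: "uniform_limit UNIV f g sequentially"
  shows "(\<lambda>n. fold_int \<xi> (f n)) \<longlonglongrightarrow> fold_int \<xi> g"
proof -
  let ?F = "\<lambda>W t. complex_of_real (1 - t) * (W (\<xi> + t) + W (\<xi> - t))"
  have "uniform_limit {0..1} (\<lambda>n. ?F (f n)) (?F g) sequentially"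
  proof (rule uniform_limitI)
    fix e :: real assume e: "e > 0"
    have "eventually (\<lambda>n. \<forall>\<tau>\<in>UNIV. dist (f n \<tau>) (g \<tau>) < e / 2) sequentially"
      using u e by (intro uniform_limitD) auto
    then show "\<forall>\<^sub>F n in sequentially. \<forall>t\<in>{0..1}. dist (?F (f n) t) (?F g t) < e"
    proof eventually_elim
      case (elim n)
      show ?case
      proof
        fix t :: real assume t: "t \<in> {0..1}"
        have "?F (f n) t - ?F g t = of_real (1 - t) * ((f n (\<xi> + t) - g (\<xi> + t)) + (f n (\<xi> - t) - g (\<xi> - t)))"
          by (simp add: algebra_simps)
        also have "norm \<dots> \<le> 1 * (norm (f n (\<xi> + t) - g (\<xi> + t)) + norm (f n (\<xi> - t) - g (\<xi> - t)))"
          unfolding norm_mult norm_of_real using t by (intro mult_mono norm_triangle_ineq) auto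
        also have "\<dots> < 1 * (e / 2 + e / 2)" using elim by (intro mult_strict_left_mono add_strict_mono) (auto simp: dist_norm)
        finally show "dist (?F (f n) t) (?F g t) < e" by (simp add: dist_norm)
      qed
    qed
  qed
  moreover have "continuous_on {0..1} (?F (f n))" for n
    by (intro continuous_intros continuous_on_compose2[OF c]) auto
  ultimately obtain I J where I: "\<And>n. (?F (f n) has_integral I n) {0..1}" and J: "(?F g has_integral J) {0..1}"
    and lim: "(I \<longlongrightarrow> J) sequentially"
    by (rule uniform_limit_integral) auto
  have "fold_int \<xi> (f n) = I n" "fold_int \<xi> g = J" for n
    using I J by (auto simp: fold_int_def intro: integral_unique)
  then show ?thesis using lim by simp
qed

lemma fold_int_sum: "finite A \<Longrightarrow> (\<And>i. i \<in> A \<Longrightarrow> continuous_on UNIV (f i)) \<Longrightarrow>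
   fold_int \<xi> (\<lambda>\<tau>. \<Sum>i\<in>A. f i \<tau>) = (\<Sum>i\<in>A. fold_int \<xi> (f i))"
proof (induction A rule: finite_induct)
  case (insert x A)
  let ?F = "\<lambda>W t. complex_of_real (1 - t) * (W (\<xi> + t) + W (\<xi> - t))"
  have 1: "?F (f x) integrable_on {0..1}"
    by (rule fold_int_continuous_integrable) (use insert in \<open>auto intro: continuous_on_subset\<close>)
  have 2: "?F (\<lambda>\<tau>. \<Sum>i\<in>A. f i \<tau>) integrable_on {0..1}"
    by (rule fold_int_continuous_integrable) (use insert in \<open>auto intro!: continuous_on_sum intro: continuous_on_subset\<close>)
  have "fold_int \<xi> (\<lambda>\<tau>. \<Sum>i\<in>insert x A. f i \<tau>) = integral {0..1} (\<lambda>t. ?F (f x) t + ?F (\<lambda>\<tau>. \<Sum>i\<in>A. f i \<tau>) t)"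
    unfolding fold_int_def using insert by (simp add: algebra_simps)
  also have "\<dots> = fold_int \<xi> (f x) + fold_int \<xi> (\<lambda>\<tau>. \<Sum>i\<in>A. f i \<tau>)"
    unfolding fold_int_def by (rule integral_add[OF 1 2])
  finally show ?case using insert by simp
qed (simp add: fold_int_def)

lemma fold_int_cmult: "fold_int \<xi> (\<lambda>\<tau>. c * W \<tau>) = c * fold_int \<xi> W"
proof -
  have "fold_int \<xi> (\<lambda>\<tau>. c * W \<tau>) = integral {0..1} (\<lambda>t. c * (of_real (1 - t) * (W (\<xi> + t) + W (\<xi> - t))))"
    unfolding fold_int_def by (simp add: algebra_simps)
  then show ?thesis unfolding fold_int_def by simp
qed

lemma fold_int_diff:
  assumes "continuous_on UNIV V" "continuous_on UNIV W"
  shows "fold_int \<xi> (\<lambda>\<tau>. V \<tau> - W \<tau>) = fold_int \<xi> V - fold_int \<xi> W"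
proof -
  let ?F = "\<lambda>W t. complex_of_real (1 - t) * (W (\<xi> + t) + W (\<xi> - t))"
  have i: "?F V integrable_on {0..1}" "?F W integrable_on {0..1}"
    by (rule fold_int_continuous_integrable; use assms continuous_on_subset in blast)+
  have "fold_int \<xi> (\<lambda>\<tau>. V \<tau> - W \<tau>) = integral {0..1} (\<lambda>t. ?F V t - ?F W t)"
    unfolding fold_int_def by (simp add: algebra_simps)
  then show ?thesis unfolding fold_int_def by (simp only: integral_diff[OF i])
qed

text \<open>Weighting the points \<open>x n\<close> by the kernel amounts to averaging the transform
  over the interval of radius one around \<open>\<xi>\<close>. Summability of \<open>b\<close> makes
  the transform converge uniformly, so the average can be taken termwise.\<close>

lemma fejer_sum_eq:
  fixes b x :: "nat \<Rightarrow> real"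
  assumes sm: "summable b" and b: "\<And>n. b n \<ge> 0"
  shows "(\<lambda>n. of_real (b n * fejer (x n)) * cis (\<xi> * x n)) sums fold_int \<xi> (\<lambda>\<tau>. \<Sum>n. of_real (b n) * cis (\<tau> * x n))"
proof -
  have "(\<lambda>N. fold_int \<xi> (\<lambda>\<tau>. \<Sum>n<N. of_real (b n) * cis (\<tau> * x n))) \<longlonglongrightarrow> fold_int \<xi> (\<lambda>\<tau>. \<Sum>n. of_real (b n) * cis (\<tau> * x n))"
  proof (rule fold_int_uniform_limit)
    show "uniform_limit UNIV (\<lambda>N \<tau>. \<Sum>n<N. of_real (b n) * cis (\<tau> * x n)) (\<lambda>\<tau>. \<Sum>n. of_real (b n) * cis (\<tau> * x n)) sequentially"
      by (rule Weierstrass_m_test[OF _ sm]) (use b in \<open>simp add: norm_mult\<close>)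
  qed (intro continuous_intros)
  moreover have "fold_int \<xi> (\<lambda>\<tau>. \<Sum>n<N. of_real (b n) * cis (\<tau> * x n)) = (\<Sum>n<N. of_real (b n * fejer (x n)) * cis (\<xi> * x n))" for N
  proof -
    have "fold_int \<xi> (\<lambda>\<tau>. \<Sum>n<N. of_real (b n) * cis (\<tau> * x n)) = (\<Sum>n<N. fold_int \<xi> (\<lambda>\<tau>. of_real (b n) * cis (\<tau> * x n)))"
      by (rule fold_int_sum) (auto intro!: continuous_intros)
    then show ?thesis by (simp add: fold_int_cmult fold_int_cis mult_ac)
  qed
  ultimately show ?thesis by (simp add: sums_def)
qed

lemma exp_cis_integral:
  assumes d: "\<delta> > 0" and T: "T \<ge> 0"
  shows "((\<lambda>u. of_real (exp (- \<delta> * u)) * cis (\<tau> * (u - v))) has_integral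
     (cis (- \<tau> * v) * (1 - exp (- (of_real \<delta> - \<i> * of_real \<tau>) * of_real T)) / (of_real \<delta> - \<i> * of_real \<tau>))) {0..T}"
proof -
  define c where "c = of_real \<delta> - \<i> * of_real \<tau>"
  have c: "c \<noteq> 0" using d by (simp add: c_def complex_eq_iff)
  have "((\<lambda>u. cis (- \<tau> * v) * exp (- c * of_real u)) has_integral
      (- cis (- \<tau> * v) * exp (- c * of_real T) / c - - cis (- \<tau> * v) * exp (- c * of_real 0) / c)) {0..T}"
  proof (rule fundamental_theorem_of_calculus[OF T])
    fix u assume "u \<in> {0..T}"
    have "((\<lambda>z. - cis (- \<tau> * v) * exp (- c * z) / c) has_field_derivative cis (- \<tau> * v) * exp (- c * of_real u)) (at (of_real u))"
      using c by (auto intro!: derivative_eq_intros)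
    then show "((\<lambda>u. - cis (- \<tau> * v) * exp (- c * of_real u) / c) has_vector_derivative cis (- \<tau> * v) * exp (- c * of_real u)) (at u within {0..T})"
      by (rule has_vector_derivative_real_field)
  qed
  moreover have "cis (- \<tau> * v) * exp (- c * of_real u) = of_real (exp (- \<delta> * u)) * cis (\<tau> * (u - v))" for u
    by (simp add: c_def cis_conv_exp exp_of_real[symmetric] algebra_simps flip: exp_add)
  moreover have "(- cis (- \<tau> * v) * exp (- c * of_real T) / c - - cis (- \<tau> * v) * exp (- c * of_real 0) / c) =
     cis (- \<tau> * v) * (1 - exp (- c * of_real T)) / c"
    by (simp add: algebra_simps diff_divide_distrib)
  ultimately show ?thesis unfolding c_def[symmetric] by simp
qed


text \<open>The integral representation yields continuity at the removable singularity of the kernel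
  together with all other points.\<close>

lemma continuous_cis_fejer: "continuous_on A (\<lambda>u. of_real (fejer (u - v)) * cis (\<xi> * (u - v)))"
proof -
  have "continuous_on UNIV (\<lambda>x. integral (cbox 0 1) (\<lambda>t::real. 2 * (1 - t) * cos (t * (x - v))))"
    by (intro integral_continuous_on_param) (auto simp: split_beta intro!: continuous_intros)
  then have "continuous_on UNIV (\<lambda>x. fejer (x - v))"
    using integral_unique[OF fejer_has_integral] by (simp add: cbox_interval)
  then show ?thesis by (intro continuous_intros) (rule continuous_on_subset, auto)
qed

section \<open>The smoothed contribution of the pole\<close>

text \<open>The transform of the density e^(-\<delta> u) on u \<ge> 0 after weighting by the kernel
  centred at \<open>v\<close>. With u = ln n, this is what a pole 1 / (s - 1) contributes to the
  smoothed sums.\<close>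

definition half_mass :: "real \<Rightarrow> real \<Rightarrow> real \<Rightarrow> complex" where
  "half_mass \<delta> \<xi> v = (LINT u|lborel. indicator {0..} u *\<^sub>R (of_real (exp (- \<delta> * u) * fejer (u - v)) * cis (\<xi> * (u - v))))"

lemma cis_measurable [measurable]: "cis \<in> borel_measurable borel"
  by (rule borel_measurable_continuous_onI) (intro continuous_intros)

lemma fejer_shift_integrable: "integrable lborel (\<lambda>u. fejer (u - v))"
  using lborel_integrable_real_affine[OF fejer_integrable, of 1 "- v"] by simp

lemma half_mass_bound:
  assumes "\<delta> \<ge> 0"
  shows "norm (indicator {0..} u *\<^sub>R (complex_of_real (exp (- \<delta> * u) * fejer (u - v)) * cis (\<xi> * (u - v)))) \<le> fejer (u - v)"
  using assms fejer_nonneg[of "u - v"] by (auto simp: indicator_def norm_mult intro!: mult_left_le_one_le)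

lemma borel_measurable_indicator_scaleR:
  fixes g :: "real \<Rightarrow> complex"
  assumes "continuous_on UNIV g" "S \<in> sets borel"
  shows "(\<lambda>u. indicator S u *\<^sub>R g u) \<in> borel_measurable lborel"
  using borel_measurable_scaleR[OF borel_measurable_indicator[OF assms(2)] borel_measurable_continuous_onI[OF assms(1)]]
  by simp

lemma half_mass_continuous:
  "continuous_on A (\<lambda>u. complex_of_real (exp (- \<delta> * u) * fejer (u - v)) * cis (\<xi> * (u - v)))"
  unfolding of_real_mult mult.assoc by (intro continuous_intros continuous_cis_fejer)

lemma half_mass_measurable:
  "(\<lambda>u. indicator {0..} u *\<^sub>R (complex_of_real (exp (- \<delta> * u) * fejer (u - v)) * cis (\<xi> * (u - v)))) \<in> borel_measurable lborel"
  by (intro borel_measurable_indicator_scaleR half_mass_continuous) simp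

text \<open>Truncation at \<open>T\<close> makes both integration ranges compact, so the integrals
  can be swapped. As \<open>T\<close> grows, the folded integrand converges uniformly with error at
  most e^(-\<delta> T) / \<delta>, which is where \<open>\<delta> > 0\<close> enters; the other side
  converges by domination through the kernel.\<close>

lemma half_mass_eq:
  assumes d: "\<delta> > 0"
  shows "half_mass \<delta> \<xi> v = fold_int \<xi> (\<lambda>\<tau>. cis (- \<tau> * v) / (of_real \<delta> - \<i> * of_real \<tau>))"
proof -
  let ?g = "\<lambda>u. complex_of_real (exp (- \<delta> * u) * fejer (u - v)) * cis (\<xi> * (u - v))"
  let ?E = "\<lambda>T \<tau>. cis (- \<tau> * v) * (1 - exp (- (of_real \<delta> - \<i> * of_real \<tau>) * of_real T)) / (of_real \<delta> - \<i> * of_real \<tau>)"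
  have gc: "continuous_on A ?g" for A by (rule half_mass_continuous)
  have nz: "of_real \<delta> - \<i> * of_real \<tau> \<noteq> 0" for \<tau> using d by (simp add: complex_eq_iff)
  have nb: "norm (of_real \<delta> - \<i> * of_real \<tau>) \<ge> \<delta>" for \<tau>
    using complex_Re_le_cmod[of "of_real \<delta> - \<i> * of_real \<tau>"] by simp
  have trunc: "integral {0..T} ?g = fold_int \<xi> (?E T)" if T: "T \<ge> 0" for T
  proof -
    let ?h = "\<lambda>u t. complex_of_real (1 - t) * (of_real (exp (- \<delta> * u)) * cis ((\<xi> + t) * (u - v)) + of_real (exp (- \<delta> * u)) * cis ((\<xi> - t) * (u - v)))"
    have "integral {0..T} ?g = integral (cbox 0 T) (\<lambda>u. integral (cbox 0 1) (?h u))"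
      unfolding cbox_interval
    proof (rule integral_cong)
      fix u
      have "((\<lambda>t. of_real (exp (- \<delta> * u)) * (of_real (1 - t) * (cis ((\<xi> + t) * (u - v)) + cis ((\<xi> - t) * (u - v))))) has_integral
         of_real (exp (- \<delta> * u)) * (of_real (fejer (u - v)) * cis (\<xi> * (u - v)))) {0..1}"
        by (rule has_integral_mult_right[OF fejer_cis_has_integral])
      then show "?g u = integral {0..1} (?h u)"
        by (intro integral_unique[symmetric]) (simp add: algebra_simps)
    qed
    also have "\<dots> = integral (cbox 0 1) (\<lambda>t. integral (cbox 0 T) (\<lambda>u. ?h u t))"
      by (rule integral_swap_continuous) (auto simp: split_beta intro!: continuous_intros)
    also have "\<dots> = fold_int \<xi> (?E T)"
      unfolding fold_int_def cbox_interval
      by (intro integral_cong integral_unique has_integral_mult_right has_integral_add exp_cis_integral d T)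
    finally show ?thesis .
  qed
  have "(\<lambda>n. fold_int \<xi> (?E (real n))) \<longlonglongrightarrow> fold_int \<xi> (\<lambda>\<tau>. cis (- \<tau> * v) / (of_real \<delta> - \<i> * of_real \<tau>))"
  proof (rule fold_int_uniform_limit)
    show "continuous_on UNIV (?E (real n))" for n
      by (intro continuous_intros) (use nz in auto)
    show "uniform_limit UNIV (\<lambda>n. ?E (real n)) (\<lambda>\<tau>. cis (- \<tau> * v) / (of_real \<delta> - \<i> * of_real \<tau>)) sequentially"
    proof (rule uniform_limitI)
      fix e :: real assume e: "e > 0"
      have "(\<lambda>n. exp (- \<delta> * real n) / \<delta>) \<longlonglongrightarrow> 0" using d by real_asymp
      then have "eventually (\<lambda>n. exp (- \<delta> * real n) / \<delta> < e) sequentially" using e by (simp add: order_tendsto_iff)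
      then show "\<forall>\<^sub>F n in sequentially. \<forall>\<tau>\<in>UNIV. dist (?E (real n) \<tau>) (cis (- \<tau> * v) / (of_real \<delta> - \<i> * of_real \<tau>)) < e"
      proof eventually_elim
        case (elim n)
        show ?case
        proof
          fix \<tau>
          have "?E (real n) \<tau> - cis (- \<tau> * v) / (of_real \<delta> - \<i> * of_real \<tau>) =
             - (cis (- \<tau> * v) * exp (- (of_real \<delta> - \<i> * of_real \<tau>) * of_real (real n)) / (of_real \<delta> - \<i> * of_real \<tau>))"
            by (simp add: diff_divide_distrib right_diff_distrib)
          also have "norm \<dots> = exp (- \<delta> * real n) / norm (of_real \<delta> - \<i> * of_real \<tau>)"
            by (simp add: norm_mult norm_divide)
          also have "\<dots> \<le> exp (- \<delta> * real n) / \<delta>" using d nb[of \<tau>] by (intro divide_left_mono mult_pos_pos) auto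
          finally show "dist (?E (real n) \<tau>) (cis (- \<tau> * v) / (of_real \<delta> - \<i> * of_real \<tau>)) < e"
            using elim by (simp add: dist_norm)
        qed
      qed
    qed
  qed
  moreover have "(\<lambda>n. LINT u|lborel. indicator {0..real n} u *\<^sub>R ?g u) \<longlonglongrightarrow> half_mass \<delta> \<xi> v"
    unfolding half_mass_def
  proof (rule integral_dominated_convergence[where w = "\<lambda>u. fejer (u - v)"])
    show "integrable lborel (\<lambda>u. fejer (u - v))" by (rule fejer_shift_integrable)
    show "AE u in lborel. (\<lambda>n. indicator {0..real n} u *\<^sub>R ?g u) \<longlonglongrightarrow> indicator {0..} u *\<^sub>R ?g u"
    proof (rule AE_I2)
      fix u :: real
      have "eventually (\<lambda>n. real n \<ge> u) sequentially" by real_asymp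
      then have "eventually (\<lambda>n. indicator {0..} u *\<^sub>R ?g u = indicator {0..real n} u *\<^sub>R ?g u) sequentially"
        by eventually_elim (auto simp: indicator_def)
      then show "(\<lambda>n. indicator {0..real n} u *\<^sub>R ?g u) \<longlonglongrightarrow> indicator {0..} u *\<^sub>R ?g u"
        by (rule Lim_transform_eventually[OF tendsto_const])
    qed
    show "AE u in lborel. norm (indicator {0..real n} u *\<^sub>R ?g u) \<le> fejer (u - v)" for n
    proof (rule AE_I2)
      fix u :: real
      show "norm (indicator {0..real n} u *\<^sub>R ?g u) \<le> fejer (u - v)"
      proof (cases "u \<in> {0..real n}")
        case True
        then show ?thesis using half_mass_bound[of \<delta> u v \<xi>] d by (simp add: indicator_def)
      next
        case False
        then have "indicator {0..real n} u = (0 :: real)" by (rule indicator_simps(2))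
        then show ?thesis using fejer_nonneg by simp
      qed
    qed
  qed (intro borel_measurable_indicator_scaleR half_mass_continuous half_mass_measurable; simp)+
  moreover have "(LINT u|lborel. indicator {0..real n} u *\<^sub>R ?g u) = integral {0..real n} ?g" for n
  proof -
    have "set_integrable lborel {0..real n} ?g" by (rule borel_integrable_atLeastAtMost'[OF gc])
    from set_borel_integral_eq_integral(2)[OF this] show ?thesis by (simp add: set_lebesgue_integral_def)
  qed
  ultimately show ?thesis unfolding trunc[OF of_nat_0_le_iff, symmetric] by (simp add: LIMSEQ_unique)
qed

lemma half_mass_lim_0: "(\<lambda>j. half_mass (1 / real (Suc j)) \<xi> v) \<longlonglongrightarrow> half_mass 0 \<xi> v"
  unfolding half_mass_def
proof (rule integral_dominated_convergence[where w = "\<lambda>u. fejer (u - v)"])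
  show "integrable lborel (\<lambda>u. fejer (u - v))" by (rule fejer_shift_integrable)
  show "AE u in lborel. norm (indicator {0..} u *\<^sub>R (complex_of_real (exp (- (1 / real (Suc j)) * u) * fejer (u - v)) * cis (\<xi> * (u - v)))) \<le> fejer (u - v)" for j
    by (intro AE_I2 half_mass_bound) simp
  show "AE u in lborel. (\<lambda>j. indicator {0..} u *\<^sub>R (complex_of_real (exp (- (1 / real (Suc j)) * u) * fejer (u - v)) * cis (\<xi> * (u - v))))
     \<longlonglongrightarrow> indicator {0..} u *\<^sub>R (complex_of_real (exp (- 0 * u) * fejer (u - v)) * cis (\<xi> * (u - v)))"
  proof (rule AE_I2)
    fix u :: real
    have "(\<lambda>j. 1 / real (Suc j)) \<longlonglongrightarrow> 0" using LIMSEQ_inverse_real_of_nat by (simp add: inverse_eq_divide)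
    then show "(\<lambda>j. indicator {0..} u *\<^sub>R (complex_of_real (exp (- (1 / real (Suc j)) * u) * fejer (u - v)) * cis (\<xi> * (u - v))))
     \<longlonglongrightarrow> indicator {0..} u *\<^sub>R (complex_of_real (exp (- 0 * u) * fejer (u - v)) * cis (\<xi> * (u - v)))"
      by (intro tendsto_intros)
  qed
qed (rule half_mass_measurable)+

definition fejer_hat :: "real \<Rightarrow> complex" where
  "fejer_hat \<xi> = (LINT u|lborel. of_real (fejer u) * cis (\<xi> * u))"

text \<open>Substituting u + v turns the half-line into the one from -v upwards, which exhausts the
  real line.\<close>

lemma half_mass_lim_top: "((\<lambda>v. half_mass 0 \<xi> v) \<longlongrightarrow> fejer_hat \<xi>) at_top"
proof -
  have eq: "half_mass 0 \<xi> v = (LINT u|lborel. indicator {- v..} u *\<^sub>R (of_real (fejer u) * cis (\<xi> * u)))" for v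
  proof -
    have "half_mass 0 \<xi> v = (LINT u|lborel. indicator {0..} (v + 1 * u) *\<^sub>R (of_real (exp (- 0 * (v + 1 * u)) * fejer (v + 1 * u - v)) * cis (\<xi> * (v + 1 * u - v))))"
      unfolding half_mass_def by (subst lborel_integral_real_affine[where c = 1 and t = v]) simp_all
    also have "\<dots> = (LINT u|lborel. indicator {- v..} u *\<^sub>R (of_real (fejer u) * cis (\<xi> * u)))"
      by (intro Bochner_Integration.integral_cong) (auto simp: indicator_def)
    finally show ?thesis .
  qed
  show ?thesis
    unfolding eq fejer_hat_def
  proof (rule integral_dominated_convergence_at_top[where w = fejer])
    show "integrable lborel fejer" by (rule fejer_integrable)
    show "\<forall>\<^sub>F v in at_top. AE u in lborel. norm (indicator {- v..} u *\<^sub>R (complex_of_real (fejer u) * cis (\<xi> * u))) \<le> fejer u"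
      using fejer_nonneg by (intro always_eventually allI AE_I2) (auto simp: indicator_def norm_mult)
    show "AE u in lborel. ((\<lambda>v. indicator {- v..} u *\<^sub>R (complex_of_real (fejer u) * cis (\<xi> * u))) \<longlongrightarrow> of_real (fejer u) * cis (\<xi> * u)) at_top"
    proof (rule AE_I2)
      fix u :: real
      have "eventually (\<lambda>v. of_real (fejer u) * cis (\<xi> * u) = indicator {- v..} u *\<^sub>R (complex_of_real (fejer u) * cis (\<xi> * u))) at_top"
        using eventually_ge_at_top[of "- u"] by eventually_elim (auto simp: indicator_def)
      then show "((\<lambda>v. indicator {- v..} u *\<^sub>R (complex_of_real (fejer u) * cis (\<xi> * u))) \<longlongrightarrow> of_real (fejer u) * cis (\<xi> * u)) at_top"
        by (rule Lim_transform_eventually[OF tendsto_const])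
    qed
    have c: "continuous_on UNIV (\<lambda>u. complex_of_real (fejer u) * cis (\<xi> * u))"
      using continuous_cis_fejer[of UNIV 0 \<xi>] by simp
    show "(\<lambda>u. indicator {- v..} u *\<^sub>R (complex_of_real (fejer u) * cis (\<xi> * u))) \<in> borel_measurable lborel" for v
      by (intro borel_measurable_indicator_scaleR c) simp
    show "(\<lambda>u. complex_of_real (fejer u) * cis (\<xi> * u)) \<in> borel_measurable lborel"
      using borel_measurable_continuous_onI[OF c] by simp
  qed
qed

section \<open>A Wiener-Ikehara theorem\<close>

text \<open>\<open>R\<close> is holomorphic on a neighbourhood of the closed half-plane; its
  derivative on the line Re s = 1 is what the integration by parts in the error term works
  with.\<close>

locale tauber =
  fixes a :: "nat \<Rightarrow> real" and \<alpha> :: real and R :: "complex \<Rightarrow> complex" and S :: "complex set"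
  assumes a_nonneg: "a n \<ge> 0" and a_0: "a 0 = 0"
    and a_summable: "\<And>\<sigma>. \<sigma> > 1 \<Longrightarrow> summable (\<lambda>n. a n * real n powr (- \<sigma>))"
    and S_open: "open S" and S_sub: "{s. Re s \<ge> 1} \<subseteq> S" and R_holo: "R holomorphic_on S"
    and alpha_pos: "\<alpha> > 0"
    and a_eq: "\<And>s. Re s > 1 \<Longrightarrow> (\<Sum>n. of_real (a n) * of_nat n powr (- s)) = of_real \<alpha> / (s - 1) + R s"
begin

lemma R_continuous: 
  assumes "continuous_on A f" "\<And>x. x \<in> A \<Longrightarrow> Re (f x) \<ge> 1"
  shows "continuous_on A (\<lambda>x. R (f x))"
  by (rule continuous_on_compose2[OF holomorphic_on_imp_continuous_on[OF R_holo] assms(1)]) (use assms(2) S_sub in auto)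

text \<open>Take s = 1 + \<delta> - i \<tau>, so that n^(-s) carries the oscillation
  \<open>cis (\<tau> * ln n)\<close>; recentring at \<open>v\<close> is a constant phase.\<close>

lemma cis_sum_eq:
  assumes d: "\<delta> > 0"
  shows "(\<Sum>n. of_real (a n * real n powr (- 1 - \<delta>)) * cis (\<tau> * (ln (real n) - v))) =
    of_real \<alpha> * (cis (- \<tau> * v) / (of_real \<delta> - \<i> * of_real \<tau>)) + cis (- \<tau> * v) * R (1 + of_real \<delta> - \<i> * of_real \<tau>)"
proof -
  let ?s = "1 + of_real \<delta> - \<i> * of_real \<tau>"
  have t: "of_real (a n * real n powr (- 1 - \<delta>)) * cis (\<tau> * (ln (real n) - v)) = cis (- \<tau> * v) * (of_real (a n) * of_nat n powr (- ?s))" for n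
  proof (cases "n = 0")
    case False
    have "of_nat n powr (- ?s) = exp (of_real ((- 1 - \<delta>) * ln (real n)) + \<i> * of_real (\<tau> * ln (real n)))"
      using False by (simp add: powr_def algebra_simps)
    also have "\<dots> = of_real (real n powr (- 1 - \<delta>)) * cis (\<tau> * ln (real n))"
      using False by (simp only: exp_add exp_of_real cis_conv_exp powr_def) simp
    finally have "of_nat n powr (- ?s) = of_real (real n powr (- 1 - \<delta>)) * cis (\<tau> * ln (real n))" .
    moreover have "cis (\<tau> * (ln (real n) - v)) = cis (- \<tau> * v) * cis (\<tau> * ln (real n))"
      by (simp add: cis_mult algebra_simps)
    ultimately show ?thesis by simp
  qed (simp add: a_0)
  have s: "Re ?s > 1" using d by simp
  have "summable (\<lambda>n. norm (of_real (a n) * of_nat n powr (- ?s) :: complex))"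
  proof (rule summable_comparison_test'[OF a_summable[OF s], of 0])
    fix n show "norm (norm (of_real (a n) * of_nat n powr (- ?s) :: complex)) \<le> a n * real n powr (- Re ?s)"
      using a_nonneg[of n] by (cases "n = 0") (simp_all add: norm_mult norm_powr_real_powr)
  qed
  then have "summable (\<lambda>n. of_real (a n) * of_nat n powr (- ?s) :: complex)" by (rule summable_norm_cancel)
  then have "(\<Sum>n. of_real (a n * real n powr (- 1 - \<delta>)) * cis (\<tau> * (ln (real n) - v))) =
     cis (- \<tau> * v) * (\<Sum>n. of_real (a n) * of_nat n powr (- ?s))"
    unfolding t by (rule suminf_mult)
  also have "\<dots> = cis (- \<tau> * v) * (of_real \<alpha> / (?s - 1) + R ?s)"
    by (simp only: a_eq[OF s])
  finally show ?thesis by (simp add: distrib_left)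
qed

definition err :: "real \<Rightarrow> real \<Rightarrow> real \<Rightarrow> complex" where
  "err \<delta> \<xi> v = fold_int \<xi> (\<lambda>\<tau>. cis (- \<tau> * v) * R (1 + of_real \<delta> - \<i> * of_real \<tau>))"

text \<open>Folding the identity \<open>cis_sum_eq\<close> over \<open>\<tau>\<close> splits it: the
  pole gives \<open>half_mass\<close>, the regular part gives \<open>err\<close>. In this form both
  sides survive the limit \<open>\<delta>\<close> to 0.\<close>

lemma smoothed_sum:
  assumes d: "\<delta> > 0"
  shows "(\<lambda>n. of_real (a n * real n powr (- 1 - \<delta>) * fejer (ln (real n) - v)) * cis (\<xi> * (ln (real n) - v))) sums
     (of_real \<alpha> * half_mass \<delta> \<xi> v + err \<delta> \<xi> v)"
proof -
  let ?W = "\<lambda>\<tau>. of_real \<alpha> * (cis (- \<tau> * v) / (of_real \<delta> - \<i> * of_real \<tau>))"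
  let ?E = "\<lambda>\<tau>. cis (- \<tau> * v) * R (1 + of_real \<delta> - \<i> * of_real \<tau>)"
  have nz: "of_real \<delta> - \<i> * of_real \<tau> \<noteq> 0" for \<tau> using d by (simp add: complex_eq_iff)
  have W: "continuous_on UNIV ?W" by (intro continuous_intros) (use nz in auto)
  have E: "continuous_on UNIV ?E" by (intro continuous_intros R_continuous) (use d in auto)
  have "summable (\<lambda>n. a n * real n powr (- 1 - \<delta>))" using a_summable[of "1 + \<delta>"] d by simp
  from fejer_sum_eq[OF this, of "\<lambda>n. ln (real n) - v" \<xi>] a_nonneg
  have "(\<lambda>n. of_real (a n * real n powr (- 1 - \<delta>) * fejer (ln (real n) - v)) * cis (\<xi> * (ln (real n) - v))) sums
     fold_int \<xi> (\<lambda>\<tau>. ?W \<tau> + ?E \<tau>)"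
    unfolding cis_sum_eq[OF d] by simp
  moreover have "fold_int \<xi> (\<lambda>\<tau>. (?W \<tau> + ?E \<tau>) - ?W \<tau>) = fold_int \<xi> (\<lambda>\<tau>. ?W \<tau> + ?E \<tau>) - fold_int \<xi> ?W"
    by (rule fold_int_diff) (intro continuous_on_add W E)+
  then have "fold_int \<xi> (\<lambda>\<tau>. ?W \<tau> + ?E \<tau>) = of_real \<alpha> * half_mass \<delta> \<xi> v + err \<delta> \<xi> v"
    unfolding half_mass_eq[OF d] fold_int_cmult err_def by simp
  ultimately show ?thesis by simp
qed

lemma err_lim_0: "(\<lambda>j. err (1 / real (Suc j)) \<xi> v) \<longlonglongrightarrow> err 0 \<xi> v"
proof -
  have "continuous_on {0..1} (\<lambda>\<delta>. integral (cbox 0 1) (\<lambda>t. of_real (1 - t) * 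
      (cis (- (\<xi> + t) * v) * R (1 + of_real \<delta> - \<i> * of_real (\<xi> + t)) + cis (- (\<xi> - t) * v) * R (1 + of_real \<delta> - \<i> * of_real (\<xi> - t)))))"
    by (intro integral_continuous_on_param) (auto simp: split_beta intro!: continuous_intros R_continuous)
  then have "continuous_on {0..1} (\<lambda>\<delta>. err \<delta> \<xi> v)" by (simp only: err_def[abs_def] fold_int_def cbox_interval)
  moreover have "(\<lambda>j. 1 / real (Suc j)) \<longlonglongrightarrow> 0" using LIMSEQ_inverse_real_of_nat by (simp add: inverse_eq_divide)
  ultimately show ?thesis by (rule continuous_on_tendsto_compose) auto
qed

text \<open>Used with \<open>c\<close> equal to 1 and -1, the two arms of the folded
  integral.\<close>

lemma err_piece_lim:
  assumes c: "c \<noteq> 0"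
  shows "((\<lambda>v. integral {0..1} (\<lambda>t. of_real (1 - t) * R (1 - \<i> * of_real (\<xi> + c * t)) * cis (- c * t * v))) \<longlongrightarrow> 0) at_top"
proof (rule riemann_lebesgue_C1)
  let ?z = "\<lambda>t. 1 - \<i> * complex_of_real (\<xi> + c * t)"
  let ?f' = "\<lambda>t. - R (?z t) + of_real (1 - t) * (deriv R (?z t) * (- \<i> * of_real c))"
  have dR: "deriv R holomorphic_on S" by (rule holomorphic_deriv[OF R_holo S_open])
  show "continuous_on {0..1} ?f'"
    by (intro continuous_intros R_continuous continuous_on_compose2[OF holomorphic_on_imp_continuous_on[OF dR]])
       (use S_sub in auto)
  fix t :: real
  have z: "?z t \<in> S" using S_sub by auto
  have "((\<lambda>w. (1 - w) * R (1 - \<i> * (of_real \<xi> + of_real c * w))) has_field_derivative 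
     (0 - 1) * R (1 - \<i> * (of_real \<xi> + of_real c * of_real t)) + deriv R (?z t) * (- \<i> * of_real c) * (1 - of_real t)) (at (of_real t))"
  proof (intro DERIV_mult DERIV_diff DERIV_const DERIV_ident)
    have "(R has_field_derivative deriv R (?z t)) (at (1 - \<i> * (of_real \<xi> + of_real c * of_real t)))"
      using holomorphic_derivI[OF R_holo S_open z] by simp
    then show "((\<lambda>w. R (1 - \<i> * (of_real \<xi> + of_real c * w))) has_field_derivative deriv R (?z t) * (- \<i> * of_real c)) (at (of_real t))"
      by (rule DERIV_chain2) (auto intro!: derivative_eq_intros)
  qed
  from has_vector_derivative_real_field[OF this]
  show "((\<lambda>t. of_real (1 - t) * R (?z t)) has_vector_derivative ?f' t) (at t within {0..1})"
    by (simp add: mult_ac)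
qed (use c in auto)

lemma err_lim_top: "((\<lambda>v. err 0 \<xi> v) \<longlongrightarrow> 0) at_top"
proof -
  let ?I = "\<lambda>c v. integral {0..1} (\<lambda>t. of_real (1 - t) * R (1 - \<i> * of_real (\<xi> + c * t)) * cis (- c * t * v))"
  have eq: "err 0 \<xi> v = cis (- \<xi> * v) * (?I 1 v + ?I (-1) v)" for v
  proof -
    have int: "(\<lambda>t. of_real (1 - t) * R (1 - \<i> * of_real (\<xi> + c * t)) * cis (- c * t * v)) integrable_on {0..1}" for c
      by (intro integrable_continuous_interval continuous_intros R_continuous) auto
    have "cis (- (\<xi> + t) * v) = cis (- \<xi> * v) * cis (- 1 * t * v)" "cis (- (\<xi> - t) * v) = cis (- \<xi> * v) * cis (- (-1) * t * v)" for t
      by (simp_all add: cis_mult algebra_simps)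
    then have "err 0 \<xi> v = integral {0..1} (\<lambda>t. cis (- \<xi> * v) * (of_real (1 - t) * R (1 - \<i> * of_real (\<xi> + 1 * t)) * cis (- 1 * t * v)
        + of_real (1 - t) * R (1 - \<i> * of_real (\<xi> + (-1) * t)) * cis (- (-1) * t * v)))"
      unfolding err_def fold_int_def by (intro integral_cong) (simp only:, simp add: distrib_left mult_ac)
    also have "\<dots> = cis (- \<xi> * v) * (?I 1 v + ?I (-1) v)"
      unfolding integral_mult_right integral_add[OF int int] ..
    finally show ?thesis .
  qed
  have "((\<lambda>v. ?I 1 v + ?I (-1) v) \<longlongrightarrow> 0 + 0) at_top"
    by (intro tendsto_add err_piece_lim) auto
  then have "((\<lambda>v. norm (?I 1 v + ?I (-1) v)) \<longlongrightarrow> 0) at_top" by (simp add: tendsto_norm_zero)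
  then show ?thesis
    by (intro tendsto_norm_zero_cancel[of "\<lambda>v. err 0 \<xi> v"]) (simp add: eq norm_mult)
qed

section \<open>The smoothed weights at the boundary\<close>

definition wt :: "real \<Rightarrow> nat \<Rightarrow> real" where
  "wt v n = a n * real n powr (- 1) * fejer (ln (real n) - v)"

lemma wt_nonneg: "wt v n \<ge> 0"
  unfolding wt_def by (intro mult_nonneg_nonneg a_nonneg fejer_nonneg) auto

lemma powr_delta_lim: "(\<lambda>j. real n powr (- 1 - 1 / real (Suc j))) \<longlonglongrightarrow> real n powr (- 1)"
proof (cases "n = 0")
  case False
  have "(\<lambda>j. 1 / real (Suc j)) \<longlonglongrightarrow> 0" using LIMSEQ_inverse_real_of_nat by (simp add: inverse_eq_divide)
  then have "(\<lambda>j. real n powr (- 1 - 1 / real (Suc j))) \<longlonglongrightarrow> real n powr (- 1 - 0)"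
    using False by (intro tendsto_intros) auto
  then show ?thesis by simp
qed auto

text \<open>Nonnegativity bounds each partial sum at \<open>\<delta> > 0\<close> by the full sum,
  and the full sums converge as \<open>\<delta>\<close> tends to 0. So the partial sums at
  \<open>\<delta> = 0\<close> are bounded by the limit.\<close>

lemma wt_summable: "summable (wt v)"
proof -
  let ?d = "\<lambda>j. 1 / real (Suc j)"
  let ?w = "\<lambda>j n. a n * real n powr (- 1 - ?d j) * fejer (ln (real n) - v)"
  have s: "?w j sums Re (of_real \<alpha> * half_mass (?d j) 0 v + err (?d j) 0 v)" for j
    using sums_Re[OF smoothed_sum[of "?d j" v 0]] by simp
  have lim: "(\<lambda>j. Re (of_real \<alpha> * half_mass (?d j) 0 v + err (?d j) 0 v)) \<longlonglongrightarrow> Re (of_real \<alpha> * half_mass 0 0 v + err 0 0 v)"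
    by (intro tendsto_intros half_mass_lim_0 err_lim_0)
  have "(\<Sum>n<N. wt v n) \<le> Re (of_real \<alpha> * half_mass 0 0 v + err 0 0 v)" for N
  proof (rule LIMSEQ_le[OF _ lim])
    show "(\<lambda>j. \<Sum>n<N. ?w j n) \<longlonglongrightarrow> (\<Sum>n<N. wt v n)"
      unfolding wt_def by (intro tendsto_intros powr_delta_lim)
    have "(\<Sum>n<N. ?w j n) \<le> Re (of_real \<alpha> * half_mass (?d j) 0 v + err (?d j) 0 v)" for j
      unfolding sums_unique[OF s] using s sums_summable
      by (intro sum_le_suminf) (auto intro!: mult_nonneg_nonneg a_nonneg fejer_nonneg)
    then show "\<exists>N'. \<forall>j\<ge>N'. (\<Sum>n<N. ?w j n) \<le> Re (of_real \<alpha> * half_mass (?d j) 0 v + err (?d j) 0 v)" by blast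
  qed
  then show ?thesis by (intro summableI_nonneg_bounded[of _ "Re (of_real \<alpha> * half_mass 0 0 v + err 0 0 v)"] wt_nonneg)
qed

definition smooth_transform :: "real \<Rightarrow> real \<Rightarrow> complex" where
  "smooth_transform v \<xi> = (\<Sum>n. of_real (wt v n) * cis (\<xi> * (ln (real n) - v)))"

text \<open>Tannery's theorem: the weights at \<open>\<delta> = 0\<close> dominate those at
  \<open>\<delta> > 0\<close>, and they are summable by \<open>wt_summable\<close>.\<close>

lemma smooth_transform_eq: "smooth_transform v \<xi> = of_real \<alpha> * half_mass 0 \<xi> v + err 0 \<xi> v"
proof -
  let ?d = "\<lambda>j. 1 / real (Suc j)"
  let ?w = "\<lambda>n j. of_real (a n * real n powr (- 1 - ?d j) * fejer (ln (real n) - v)) * cis (\<xi> * (ln (real n) - v))"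
  have "(\<lambda>j. \<Sum>n. ?w n j) \<longlonglongrightarrow> smooth_transform v \<xi>"
    unfolding smooth_transform_def
  proof (rule tannerys_theorem[THEN conjunct2, THEN conjunct2, OF _ _ wt_summable])
    show "(\<lambda>j. ?w n j) \<longlonglongrightarrow> of_real (wt v n) * cis (\<xi> * (ln (real n) - v))" for n
      unfolding wt_def by (intro tendsto_intros powr_delta_lim)
    have "norm (?w n j) \<le> wt v n" for n j
    proof (cases "n = 0")
      case False
      then have "real n powr (- 1 - ?d j) \<le> real n powr (- 1)" by (intro powr_mono) auto
      then have "a n * real n powr (- 1 - ?d j) * fejer (ln (real n) - v) \<le> wt v n"
        unfolding wt_def by (intro mult_right_mono mult_left_mono a_nonneg fejer_nonneg)
      moreover have "0 \<le> a n * real n powr (- 1 - ?d j) * fejer (ln (real n) - v)"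
        by (intro mult_nonneg_nonneg a_nonneg fejer_nonneg) auto
      ultimately show ?thesis by (simp only: norm_mult norm_of_real norm_cis abs_of_nonneg mult_1_right)
    qed (simp add: a_0 wt_nonneg)
    then show "\<forall>\<^sub>F (n, j) in at_top \<times>\<^sub>F sequentially. norm (?w n j) \<le> wt v n"
      by (intro always_eventually) auto
  qed auto
  moreover have "(\<Sum>n. ?w n j) = of_real \<alpha> * half_mass (?d j) \<xi> v + err (?d j) \<xi> v" for j
    using smoothed_sum[of "?d j" v \<xi>] by (simp add: sums_iff)
  moreover have "(\<lambda>j. of_real \<alpha> * half_mass (?d j) \<xi> v + err (?d j) \<xi> v) \<longlonglongrightarrow> of_real \<alpha> * half_mass 0 \<xi> v + err 0 \<xi> v"
    by (intro tendsto_intros half_mass_lim_0 err_lim_0)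
  ultimately show ?thesis by (simp add: LIMSEQ_unique)
qed

lemma smooth_transform_lim: "((\<lambda>v. smooth_transform v \<xi>) \<longlongrightarrow> of_real \<alpha> * fejer_hat \<xi>) at_top"
proof -
  have "((\<lambda>v. smooth_transform v \<xi>) \<longlongrightarrow> of_real \<alpha> * fejer_hat \<xi> + 0) at_top"
    unfolding smooth_transform_eq by (intro tendsto_intros half_mass_lim_top err_lim_top)
  then show ?thesis by simp
qed

section \<open>Normalisation to probability measures\<close>

definition mass :: "real \<Rightarrow> real" where "mass v = (\<Sum>n. wt v n)"

definition smooth_measure :: "real \<Rightarrow> real measure" where
  "smooth_measure v = distr (density (count_space UNIV) (\<lambda>n. ennreal (wt v n / mass v))) borel (\<lambda>n. ln (real n) - v)"

lemma smooth_measure_integral: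
  fixes f :: "real \<Rightarrow> 'b :: {banach, second_countable_topology}"
  assumes f: "f \<in> borel_measurable borel" and B: "\<And>x. norm (f x) \<le> B" and pos: "mass v > 0"
  shows "(LINT x|smooth_measure v. f x) = (\<Sum>n. (wt v n / mass v) *\<^sub>R f (ln (real n) - v))"
proof -
  have "(LINT x|smooth_measure v. f x) = (LINT n|density (count_space UNIV) (\<lambda>n. ennreal (wt v n / mass v)). f (ln (real n) - v))"
    unfolding smooth_measure_def by (rule integral_distr) (use f in auto)
  also have "\<dots> = (LINT n|count_space UNIV. (wt v n / mass v) *\<^sub>R f (ln (real n) - v))"
    by (rule integral_density) (use wt_nonneg pos in \<open>auto intro!: AE_I2 divide_nonneg_pos\<close>)
  also have "\<dots> = (\<Sum>n. (wt v n / mass v) *\<^sub>R f (ln (real n) - v))"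
  proof (rule integral_count_space_nat, subst integrable_count_space_nat_iff)
    have "summable (\<lambda>n. wt v n / mass v * B)" by (intro summable_mult2 summable_divide wt_summable)
    then show "summable (\<lambda>n. norm ((wt v n / mass v) *\<^sub>R f (ln (real n) - v)))"
    proof (rule summable_comparison_test'[of _ 0])
      fix n show "norm (norm ((wt v n / mass v) *\<^sub>R f (ln (real n) - v))) \<le> wt v n / mass v * B"
        using B wt_nonneg[of v n] pos by (simp add: mult_left_mono divide_right_mono)
    qed
  qed
  finally show ?thesis .
qed

lemma smooth_measure_distribution:
  assumes pos: "mass v > 0" shows "real_distribution (smooth_measure v)"
proof -
  have "(\<Sum>n. ennreal (wt v n / mass v)) = ennreal (\<Sum>n. wt v n / mass v)"
    using wt_nonneg pos by (intro suminf_ennreal2 summable_divide wt_summable) (auto intro!: divide_nonneg_pos)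
  also have "(\<Sum>n. wt v n / mass v) = 1"
    using suminf_divide[OF wt_summable, of v "mass v"] pos by (simp add: mass_def)
  finally have "emeasure (density (count_space UNIV) (\<lambda>n. ennreal (wt v n / mass v))) UNIV = 1"
    by (simp add: emeasure_density nn_integral_count_space_nat)
  then have "prob_space (density (count_space UNIV) (\<lambda>n. ennreal (wt v n / mass v)))"
    by (intro prob_spaceI) simp
  then have "prob_space (smooth_measure v)"
    unfolding smooth_measure_def by (rule prob_space.prob_space_distr) simp
  then show ?thesis unfolding real_distribution_def real_distribution_axioms_def
    by (simp add: smooth_measure_def)
qed

lemma mass_eq_transform: "of_real (mass v) = smooth_transform v 0"
  unfolding mass_def smooth_transform_def using suminf_of_real[OF wt_summable, of v] by simp

lemma smooth_measure_char:
  assumes pos: "mass v > 0"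
  shows "char (smooth_measure v) \<xi> = smooth_transform v \<xi> / of_real (mass v)"
proof -
  have sm: "summable (\<lambda>n. of_real (wt v n) * cis (\<xi> * (ln (real n) - v)))"
    by (rule summable_norm_cancel) (use wt_summable[of v] wt_nonneg in \<open>simp add: norm_mult\<close>)
  have "char (smooth_measure v) \<xi> = (\<Sum>n. (wt v n / mass v) *\<^sub>R iexp (\<xi> * (ln (real n) - v)))"
    unfolding char_def by (rule smooth_measure_integral[where B = 1]) (use pos in auto)
  also have "\<dots> = (\<Sum>n. of_real (wt v n) * cis (\<xi> * (ln (real n) - v)) / of_real (mass v))"
    by (simp add: cis_conv_exp scaleR_conv_of_real)
  also have "\<dots> = smooth_transform v \<xi> / of_real (mass v)"
    unfolding smooth_transform_def by (rule suminf_divide[OF sm])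
  finally show ?thesis .
qed

end

definition fejer_total :: real where "fejer_total = (LINT u|lborel. fejer u)"

definition fejer_measure :: "real measure" where
  "fejer_measure = density lborel (\<lambda>u. ennreal (fejer u / fejer_total))"

lemma fejer_total_pos: "fejer_total > 0"
proof -
  have "(LINT u|lborel. indicator {-1..1::real} u * (1/2)) \<le> fejer_total"
    unfolding fejer_total_def
  proof (rule Bochner_Integration.integral_mono[OF _ fejer_integrable])
    show "integrable lborel (\<lambda>u::real. indicator {-1..1} u * (1/2) :: real)"
      by (intro integrable_mult_left integrable_real_indicator) (simp_all add: emeasure_lborel_Icc_eq)
    fix u :: real show "indicator {-1..1} u * (1/2) \<le> fejer u"
      using fejer_ge[of u] fejer_nonneg[of u] by (auto simp: indicator_def)
  qed
  moreover have "(LINT u|lborel. indicator {-1..1::real} u * (1/2) :: real) = 1" by simp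
  ultimately show ?thesis by simp
qed

lemma fejer_hat_0: "fejer_hat 0 = of_real fejer_total"
  unfolding fejer_hat_def fejer_total_def by simp

lemma fejer_measure_integral:
  fixes f :: "real \<Rightarrow> 'b :: {banach, second_countable_topology}"
  assumes "f \<in> borel_measurable borel"
  shows "(LINT x|fejer_measure. f x) = (LINT u|lborel. (fejer u / fejer_total) *\<^sub>R f u)"
  unfolding fejer_measure_def
  by (rule integral_density) (use assms fejer_nonneg fejer_total_pos in \<open>auto intro!: AE_I2 divide_nonneg_pos\<close>)

lemma fejer_measure_distribution: "real_distribution fejer_measure"
proof -
  have "emeasure fejer_measure UNIV = (\<integral>\<^sup>+u. ennreal (fejer u / fejer_total) \<partial>lborel)"
    unfolding fejer_measure_def by (subst emeasure_density) auto
  also have "\<dots> = ennreal (LINT u|lborel. fejer u / fejer_total)"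
    by (rule nn_integral_eq_integral) (use fejer_integrable fejer_nonneg fejer_total_pos in \<open>auto intro!: AE_I2 divide_nonneg_pos\<close>)
  also have "(LINT u|lborel. fejer u / fejer_total) = 1"
    using fejer_total_pos by (simp flip: fejer_total_def)
  finally have "prob_space fejer_measure" by (intro prob_spaceI) (simp add: fejer_measure_def)
  then show ?thesis unfolding real_distribution_def real_distribution_axioms_def
    by (simp add: fejer_measure_def)
qed

lemma fejer_measure_char: "char fejer_measure \<xi> = fejer_hat \<xi> / of_real fejer_total"
proof -
  have "char fejer_measure \<xi> = (LINT u|lborel. (fejer u / fejer_total) *\<^sub>R iexp (\<xi> * u))"
    unfolding char_def by (rule fejer_measure_integral) simp
  also have "\<dots> = (LINT u|lborel. of_real (fejer u) * cis (\<xi> * u) / of_real fejer_total)"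
    by (simp add: cis_conv_exp scaleR_conv_of_real)
  finally show ?thesis unfolding fejer_hat_def by simp
qed

text \<open>Dividing the weight \<open>e\<^sup>u\<close> by the kernel undoes the smoothing on a window of length one.\<close>
definition window :: "real \<Rightarrow> real" where
  "window u = (if -1 < u \<and> u \<le> 0 then exp u / fejer u else 0)"

lemma window_measurable: "window \<in> borel_measurable borel"
  unfolding window_def[abs_def] by measurable

lemma window_bound: "norm (window u) \<le> 2"
proof (cases "-1 < u \<and> u \<le> 0")
  case True
  then have "fejer u \<ge> 1/2" by (intro fejer_ge) auto
  moreover have "exp u \<le> 1" using True by simp
  ultimately have "exp u / fejer u \<le> 1 / (1/2)" by (intro frac_le) auto
  then show ?thesis using True fejer_nonneg[of u] by (simp add: window_def)
qed (auto simp: window_def)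

text \<open>The end points form a null set for \<open>fejer_measure\<close>, so weak convergence may
  be tested against the discontinuous \<open>window\<close>.\<close>

lemma window_isCont: assumes "u \<noteq> -1" "u \<noteq> 0" shows "isCont window u"
proof -
  consider "u < -1 \<or> u > 0" | "-1 < u" "u < 0" using assms by linarith
  then show ?thesis
  proof cases
    case 1
    have "open ({..<-1} \<union> {0<..} :: real set)" by (intro open_Un open_lessThan open_greaterThan)
    then have "\<forall>\<^sub>F x in nhds u. x \<in> {..<-1} \<union> {0<..}" by (rule eventually_nhds_in_open) (use 1 in auto)
    then have "\<forall>\<^sub>F x in nhds u. window x = 0" by eventually_elim (auto simp: window_def)
    then have "isCont window u = isCont (\<lambda>_. 0 :: real) u" by (rule isCont_cong)
    then show ?thesis by simp
  next
    case 2
    have "\<forall>\<^sub>F x in nhds u. x \<in> {-1<..<0}" by (rule eventually_nhds_in_open) (use 2 in auto)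
    then have "\<forall>\<^sub>F x in nhds u. window x = exp x / (2 * (1 - cos x) / x\<^sup>2)"
      by eventually_elim (auto simp: window_def fejer_def)
    then have "isCont window u = isCont (\<lambda>x. exp x / (2 * (1 - cos x) / x\<^sup>2)) u" by (rule isCont_cong)
    moreover have "2 * (1 - cos u) / u\<^sup>2 \<noteq> 0" using fejer_ge[of u] 2 by (auto simp: fejer_def)
    then have "isCont (\<lambda>x. exp x / (2 * (1 - cos x) / x\<^sup>2)) u"
      by (intro continuous_intros) (use 2 in auto)
    ultimately show ?thesis by simp
  qed
qed

lemma window_integral: "(LINT u|fejer_measure. window u) = (1 - exp (-1)) / fejer_total"
proof -
  have "(LINT u|fejer_measure. window u) = (LINT u|lborel. (fejer u / fejer_total) *\<^sub>R window u)"
    by (rule fejer_measure_integral[OF window_measurable])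
  also have "\<dots> = (LINT u|lborel. (exp u * indicator {-1..0} u) / fejer_total)"
  proof (rule integral_cong_AE)
    \<comment> \<open>The two sides differ at the excluded point -1, where \<open>window\<close> is
      0 but the indicator of the closed interval is 1.\<close>
    show "AE u in lborel. (fejer u / fejer_total) *\<^sub>R window u = (exp u * indicator {-1..0} u) / fejer_total"
      using AE_lborel_singleton[of "-1"]
    proof eventually_elim
      case (elim u)
      show ?case
      proof (cases "-1 < u \<and> u \<le> 0")
        case True
        then have "fejer u \<noteq> 0" using fejer_ge[of u] by auto
        then show ?thesis using True by (simp add: window_def)
      qed (use elim in \<open>auto simp: window_def indicator_def\<close>)
    qed
  qed (use window_measurable in measurable)
  also have "\<dots> = (LINT u|lborel. exp u * indicator {-1..0} u) / fejer_total" by simp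
  also have "(LINT u|lborel. exp u * indicator {-1..0::real} u) = exp 0 - exp (-1)"
    by (rule integral_FTC_Icc_real) (auto intro!: derivative_eq_intros)
  finally show ?thesis by simp
qed

section \<open>From multiplicative windows to the summatory function\<close>

context tauber begin

definition block :: "real \<Rightarrow> real" where
  "block v = (\<Sum>n | n > 0 \<and> v - 1 < ln (real n) \<and> ln (real n) \<le> v. a n)"

lemma finite_ln_le: "finite {n::nat. n > 0 \<and> ln (real n) \<le> v}"
proof (rule finite_subset)
  show "{n::nat. n > 0 \<and> ln (real n) \<le> v} \<subseteq> {..nat \<lceil>exp v\<rceil>}"
  proof
    fix n assume "n \<in> {n::nat. n > 0 \<and> ln (real n) \<le> v}"
    then have "real n \<le> exp v" by (metis (mono_tags) mem_Collect_eq exp_le_cancel_iff exp_ln of_nat_0_less_iff)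
    then show "n \<in> {..nat \<lceil>exp v\<rceil>}" by (simp add: nat_le_iff le_nat_iff) linarith
  qed
qed simp

text \<open>At u = ln n - v the kernel in \<open>wt\<close> cancels against the one in
  \<open>window\<close>, and e^u / n = e^(-v). What remains is the unsmoothed sum over e^(v - 1) < n
  \<le> e^v.\<close>

lemma window_sum:
  assumes pos: "mass v > 0"
  shows "(LINT u|smooth_measure v. window u) = exp (- v) * block v / mass v"
proof -
  let ?A = "{n. n > 0 \<and> v - 1 < ln (real n) \<and> ln (real n) \<le> v}"
  have "(LINT u|smooth_measure v. window u) = (\<Sum>n. (wt v n / mass v) *\<^sub>R window (ln (real n) - v))"
    by (rule smooth_measure_integral[OF window_measurable window_bound pos])
  also have "\<dots> = (\<Sum>n\<in>?A. (wt v n / mass v) *\<^sub>R window (ln (real n) - v))"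
  proof (rule suminf_finite)
    show "finite ?A" by (rule finite_subset[OF _ finite_ln_le[of v]]) auto
    fix n assume "n \<notin> ?A"
    then show "(wt v n / mass v) *\<^sub>R window (ln (real n) - v) = 0"
      by (cases "n = 0") (auto simp: window_def wt_def a_0)
  qed
  also have "\<dots> = (\<Sum>n\<in>?A. a n * (exp (- v) / mass v))"
  proof (intro sum.cong refl)
    fix n assume n: "n \<in> ?A"
    then have "fejer (ln (real n) - v) \<ge> 1/2" by (intro fejer_ge) auto
    moreover have "exp (ln (real n) - v) = real n * exp (- v)" using n by (simp add: exp_diff exp_minus divide_inverse)
    ultimately show "(wt v n / mass v) *\<^sub>R window (ln (real n) - v) = a n * (exp (- v) / mass v)"
      using n by (simp add: window_def wt_def powr_minus field_simps)
  qed
  also have "\<dots> = block v * (exp (- v) / mass v)" by (simp only: block_def sum_distrib_right)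
  finally show ?thesis by simp
qed

lemma block_lim: "((\<lambda>v. exp (- v) * block v) \<longlongrightarrow> \<alpha> * (1 - exp (-1))) at_top"
proof (rule tendsto_at_topI_sequentially)
  fix X :: "nat \<Rightarrow> real" assume X: "filterlim X at_top sequentially"
  have T: "(\<lambda>i. smooth_transform (X i) \<xi>) \<longlonglongrightarrow> of_real \<alpha> * fejer_hat \<xi>" for \<xi>
    by (rule filterlim_compose[OF smooth_transform_lim X])
  have M: "(\<lambda>i. mass (X i)) \<longlonglongrightarrow> \<alpha> * fejer_total"
    using T[of 0] unfolding fejer_hat_0 mass_eq_transform[symmetric] of_real_mult[symmetric] tendsto_of_real_iff .
  have K: "\<alpha> * fejer_total > 0" using alpha_pos fejer_total_pos by simp
  then have "eventually (\<lambda>i. mass (X i) > 0) sequentially" using M by (rule order_tendstoD(1)[rotated])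
  then obtain i0 where i0: "\<And>i. i \<ge> i0 \<Longrightarrow> mass (X i) > 0" by (auto simp: eventually_sequentially)
  \<comment> \<open>Shifting the sequence makes every mass positive, since Levy's theorem takes a
    probability measure at each index.\<close>
  define V where "V i = X (i + i0)" for i
  have pos: "mass (V i) > 0" for i using i0 by (simp add: V_def)
  have M': "(\<lambda>i. mass (V i)) \<longlonglongrightarrow> \<alpha> * fejer_total" unfolding V_def by (rule LIMSEQ_ignore_initial_segment[OF M])
  have T': "(\<lambda>i. smooth_transform (V i) \<xi>) \<longlonglongrightarrow> of_real \<alpha> * fejer_hat \<xi>" for \<xi> unfolding V_def by (rule LIMSEQ_ignore_initial_segment[OF T])
  have rd: "real_distribution (smooth_measure (V i))" for i by (rule smooth_measure_distribution[OF pos])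
  have "weak_conv_m (\<lambda>i. smooth_measure (V i)) fejer_measure"
  proof (rule levy_continuity[OF rd fejer_measure_distribution])
    fix \<xi>
    have "(\<lambda>i. smooth_transform (V i) \<xi> / of_real (mass (V i))) \<longlonglongrightarrow> of_real \<alpha> * fejer_hat \<xi> / of_real (\<alpha> * fejer_total)"
      by (intro tendsto_intros T' M') (use K in auto)
    also have "of_real \<alpha> * fejer_hat \<xi> / of_real (\<alpha> * fejer_total) = char fejer_measure \<xi>"
      using alpha_pos by (simp add: fejer_measure_char)
    finally show "(\<lambda>i. char (smooth_measure (V i)) \<xi>) \<longlonglongrightarrow> char fejer_measure \<xi>"
      by (simp add: smooth_measure_char[OF pos])
  qed
  then have "(\<lambda>i. LINT u|smooth_measure (V i). window u) \<longlonglongrightarrow> (LINT u|fejer_measure. window u)"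
  proof (rule weak_conv_imp_bdd_ae_continuous_conv[OF rd fejer_measure_distribution])
    show "norm (window u) \<le> 2" for u by (rule window_bound)
    show "window \<in> borel_measurable borel" by (rule window_measurable)
    have "measure fejer_measure {x. \<not> isCont window x} = 0"
    proof -
      have "{x. \<not> isCont window x} \<subseteq> {-1, 0}" using window_isCont by blast
      moreover have "emeasure fejer_measure {-1, 0} = 0"
      proof -
        have "{-1, 0 :: real} \<in> null_sets lborel" by (rule finite_imp_null_set_lborel) simp
        then have "AE x in lborel. x \<notin> {-1, 0 :: real}" by (rule AE_not_in)
        then have "AE x in lborel. x \<in> {-1, 0 :: real} \<longrightarrow> ennreal (fejer x / fejer_total) = 0" by eventually_elim auto
        then have "{-1, 0 :: real} \<in> null_sets fejer_measure"
          unfolding fejer_measure_def by (subst null_sets_density_iff) auto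
        then show ?thesis by auto
      qed
      moreover have "{-1, 0 :: real} \<in> sets fejer_measure" by (simp add: fejer_measure_def)
      ultimately have "emeasure fejer_measure {x. \<not> isCont window x} = 0" by (metis emeasure_mono le_zero_eq)
      then show ?thesis by (simp add: measure_def)
    qed
    then show "emeasure fejer_measure {x. \<not> isCont window x} = 0"
      using prob_space.finite_measure[of fejer_measure] fejer_measure_distribution 
      by (simp add: finite_measure.emeasure_eq_measure real_distribution_def)
  qed
  then have "(\<lambda>i. exp (- V i) * block (V i) / mass (V i)) \<longlonglongrightarrow> (1 - exp (-1)) / fejer_total"
    by (simp add: window_sum[OF pos] window_integral)
  then have "(\<lambda>i. exp (- V i) * block (V i) / mass (V i) * mass (V i)) \<longlonglongrightarrow> (1 - exp (-1)) / fejer_total * (\<alpha> * fejer_total)"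
    by (intro tendsto_mult M')
  moreover have "exp (- V i) * block (V i) / mass (V i) * mass (V i) = exp (- V i) * block (V i)" for i
    using pos[of i] by simp
  moreover have "(1 - exp (-1)) / fejer_total * (\<alpha> * fejer_total) = \<alpha> * (1 - exp (-1))"
    using fejer_total_pos by simp
  ultimately have "(\<lambda>i. exp (- V i) * block (V i)) \<longlonglongrightarrow> \<alpha> * (1 - exp (-1))" by simp
  then show "(\<lambda>i. exp (- X i) * block (X i)) \<longlonglongrightarrow> \<alpha> * (1 - exp (-1))"
    unfolding V_def by (rule LIMSEQ_offset)
qed


definition esum :: "real \<Rightarrow> real" where
  "esum v = exp (- v) * (\<Sum>n | n > 0 \<and> ln (real n) \<le> v. a n)"

text \<open>Lowering \<open>v\<close> by 1 divides the summation range by e, so a limit for the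
  windows becomes a linear recursion for the normalised sums.\<close>

lemma esum_block: "esum v - exp (-1) * esum (v - 1) = exp (- v) * block v"
proof -
  let ?A = "\<lambda>v. {n. n > 0 \<and> ln (real n) \<le> v}"
  have "?A v = ?A (v - 1) \<union> {n. n > 0 \<and> v - 1 < ln (real n) \<and> ln (real n) \<le> v}" by auto
  moreover have "sum a (?A (v - 1) \<union> {n. n > 0 \<and> v - 1 < ln (real n) \<and> ln (real n) \<le> v}) = sum a (?A (v - 1)) + block v"
    unfolding block_def
    by (rule sum.union_disjoint) (auto intro: finite_subset[OF _ finite_ln_le[of v]] finite_ln_le)
  ultimately have "sum a (?A v) = sum a (?A (v - 1)) + block v" by simp
  moreover have "exp (-1) * exp (- (v - 1)) = exp (- v)" by (simp flip: exp_add)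
  ultimately show ?thesis unfolding esum_def by (simp add: algebra_simps)
qed

end

text \<open>A contraction: each unit step multiplies the old value by \<open>c\<close> and adds a
  small defect. A bound on one interval of unit length starts the iteration, and every large
  \<open>v\<close> is reached from it in a whole number of steps.\<close>

lemma shift_recursion_limit:
  fixes D :: "real \<Rightarrow> real"
  assumes c: "0 < c" "c < 1" and lim: "((\<lambda>v. D v - c * D (v - 1)) \<longlongrightarrow> 0) at_top"
    and bdd: "\<And>v0. \<exists>B. \<forall>v\<in>{v0 - 1..v0}. \<bar>D v\<bar> \<le> B"
  shows "(D \<longlongrightarrow> 0) at_top"
proof (rule tendstoI)
  fix e :: real assume e: "e > 0"
  \<comment> \<open>Chosen so that e/2 is a fixed point of the error bound:
    \<open>e' + c * (e / 2) = e / 2\<close>.\<close>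
  define e' where "e' = e / 2 * (1 - c)"
  have "e' > 0" using e c by (simp add: e'_def)
  then have "eventually (\<lambda>v. dist (D v - c * D (v - 1)) 0 < e') at_top" by (rule tendstoD[OF lim])
  then obtain v0 where v0: "\<And>v. v \<ge> v0 \<Longrightarrow> \<bar>D v - c * D (v - 1)\<bar> \<le> e'"
    unfolding eventually_at_top_linorder by (metis dist_real_def diff_zero less_imp_le)
  obtain B where B: "\<And>v. v \<in> {v0 - 1..v0} \<Longrightarrow> \<bar>D v\<bar> \<le> B" using bdd[of v0] by blast
  have B0: "B \<ge> 0" using B[of v0] by force
  have claim: "\<bar>D v\<bar> \<le> c ^ k * B + e / 2" if "v0 - 1 + real k \<le> v" "v \<le> v0 + real k" for k v
    using that
  proof (induction k arbitrary: v)
    case 0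
    then have "\<bar>D v\<bar> \<le> B" by (intro B) auto
    then show ?case using e by simp
  next
    case (Suc k)
    have "\<bar>D (v - 1)\<bar> \<le> c ^ k * B + e / 2" by (rule Suc.IH) (use Suc.prems in auto)
    then have "c * \<bar>D (v - 1)\<bar> \<le> c * (c ^ k * B + e / 2)" using c by (intro mult_left_mono) auto
    moreover have "\<bar>D v - c * D (v - 1)\<bar> \<le> e'" by (rule v0) (use Suc.prems in auto)
    moreover have "\<bar>c * D (v - 1)\<bar> = c * \<bar>D (v - 1)\<bar>" using c by (simp add: abs_mult)
    ultimately have "\<bar>D v\<bar> \<le> e' + c * (c ^ k * B + e / 2)" by linarith
    also have "\<dots> = c ^ Suc k * B + e / 2" by (simp add: e'_def field_simps)
    finally show ?case .
  qed
  have "(\<lambda>k. c ^ k * B) \<longlonglongrightarrow> 0 * B" by (intro tendsto_intros LIMSEQ_power_zero) (use c in auto)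
  then have "eventually (\<lambda>k. c ^ k * B < e / 2) sequentially" by (rule order_tendstoD(2)) (use e in simp)
  then obtain k0 where k0: "\<And>k. k \<ge> k0 \<Longrightarrow> c ^ k * B < e / 2" by (auto simp: eventually_sequentially)
  show "eventually (\<lambda>v. dist (D v) 0 < e) at_top"
    using eventually_ge_at_top[of "v0 + real k0"]
  proof eventually_elim
    case (elim v)
    define k where "k = nat \<lceil>v - v0\<rceil>"
    have "real k = of_int \<lceil>v - v0\<rceil>" using elim by (simp add: k_def)
    then have k: "v0 - 1 + real k \<le> v" "v \<le> v0 + real k" by linarith+
    have "real k0 \<le> real k" using elim k(2) by linarith
    then have "c ^ k * B < e / 2" by (intro k0) simp
    then show ?case using claim[OF k] by simp
  qed
qed

context tauber begin

text \<open>The constant \<alpha> solves the limiting recursion, because \<alpha> - \<alpha> / e =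
  \<alpha> (1 - 1 / e); the deviation from \<alpha> therefore satisfies the homogeneous one.\<close>

lemma esum_lim: "(esum \<longlongrightarrow> \<alpha>) at_top"
proof -
  have "((\<lambda>v. esum v - \<alpha>) \<longlongrightarrow> 0) at_top"
  proof (rule shift_recursion_limit[of "exp (-1)"])
    have "((\<lambda>v. exp (- v) * block v - \<alpha> * (1 - exp (-1))) \<longlongrightarrow> \<alpha> * (1 - exp (-1)) - \<alpha> * (1 - exp (-1))) at_top"
      by (intro tendsto_diff block_lim tendsto_const)
    moreover have "esum v - \<alpha> - exp (-1) * (esum (v - 1) - \<alpha>) = exp (- v) * block v - \<alpha> * (1 - exp (-1))" for v
      unfolding esum_block[symmetric] by (simp add: algebra_simps)
    ultimately show "((\<lambda>v. esum v - \<alpha> - exp (-1) * (esum (v - 1) - \<alpha>)) \<longlongrightarrow> 0) at_top"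
      by simp
    fix v0 :: real
    let ?A = "\<lambda>v. {n. n > 0 \<and> ln (real n) \<le> v}"
    have "\<bar>esum v - \<alpha>\<bar> \<le> exp (1 - v0) * sum a (?A v0) + \<alpha>" if v: "v \<in> {v0 - 1..v0}" for v
    proof -
      have "sum a (?A v) \<le> sum a (?A v0)"
        by (rule sum_mono2) (use v finite_ln_le a_nonneg in auto)
      moreover have "exp (- v) \<le> exp (1 - v0)" using v by simp
      ultimately have "esum v \<le> exp (1 - v0) * sum a (?A v0)"
        unfolding esum_def by (intro mult_mono) (auto intro!: sum_nonneg a_nonneg)
      moreover have "esum v \<ge> 0" unfolding esum_def by (intro mult_nonneg_nonneg sum_nonneg a_nonneg) auto
      ultimately show ?thesis using alpha_pos by linarith
    qed
    then show "\<exists>B. \<forall>v\<in>{v0 - 1..v0}. \<bar>esum v - \<alpha>\<bar> \<le> B" by blast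
  qed auto
  then show ?thesis by (simp add: LIM_zero_iff)
qed

theorem wiener_ikehara: "((\<lambda>x. (\<Sum>n | n > 0 \<and> real n \<le> x. a n) / x) \<longlongrightarrow> \<alpha>) at_top"
proof -
  have "((\<lambda>x. esum (ln x)) \<longlongrightarrow> \<alpha>) at_top" by (rule filterlim_compose[OF esum_lim ln_at_top])
  moreover have "eventually (\<lambda>x. esum (ln x) = (\<Sum>n | n > 0 \<and> real n \<le> x. a n) / x) at_top"
    using eventually_gt_at_top[of 0]
  proof eventually_elim
    case (elim x)
    have "{n. n > 0 \<and> ln (real n) \<le> ln x} = {n. n > 0 \<and> real n \<le> x}" using elim by auto
    then show ?case using elim by (simp add: esum_def exp_minus divide_inverse mult.commute)
  qed
  ultimately show ?thesis by (rule Lim_transform_eventually)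
qed

end

section \<open>Densities\<close>

lemma Lprod_nonzero_closed:
  assumes m: "m > 0" and s: "Re s \<ge> 1" shows "Lprod m s \<noteq> 0"
proof (cases "Re s > 1")
  case True
  then show ?thesis by (rule Lprod_nonzero[OF m])
next
  case False
  then have "s = 1 + \<i> * of_real (Im s)" using s by (simp add: complex_eq_iff)
  then show ?thesis
    using Lprod_nonzero_1[OF m] Lprod_nonzero_line[OF m, of "Im s"] by (cases "Im s = 0") auto
qed

text \<open>\<open>Lprod\<close> has no zero with Re s \<ge> 1, so discarding its zeros leaves an
  open set that still contains the closed half-plane. On it everything but the pole at 1 is
  holomorphic.\<close>

lemma prime_wt_tauber:
  assumes m: "m > 0"
  shows "tauber (prime_wt m) (1 / real (totient m)) 
     (\<lambda>s. - (deriv (Lprod m) s / Lprod m s + Kser m s) / of_nat (totient m)) {s. Re s > 1/2 \<and> Lprod m s \<noteq> 0}"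
proof
  let ?H = "{s. Re s > 1/2}" and ?S = "{s. Re s > 1/2 \<and> Lprod m s \<noteq> 0}"
  have phi: "totient m > 0" using m by simp
  have Lh: "Lprod m holomorphic_on ?H" by (rule holomorphic_on_subset[OF Lprod_holomorphic[OF m]]) auto
  have "?S = ?H \<inter> Lprod m -` (- {0})" by auto
  moreover have "open (?H \<inter> Lprod m -` (- {0}))"
    by (rule continuous_open_preimage[OF holomorphic_on_imp_continuous_on[OF Lh] open_Re_gt]) auto
  ultimately show S_open: "open ?S" by simp
  show "{s. Re s \<ge> 1} \<subseteq> ?S" using Lprod_nonzero_closed[OF m] by auto
  have sub: "?S \<subseteq> ?H" by auto
  note holomorphic_on_subset[OF Lh sub] holomorphic_on_subset[OF Kser_holomorphic[OF m] sub]
    holomorphic_on_subset[OF holomorphic_deriv[OF Lh open_Re_gt] sub]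
  then show "(\<lambda>s. - (deriv (Lprod m) s / Lprod m s + Kser m s) / of_nat (totient m)) holomorphic_on ?S"
    using phi S_open by (intro holomorphic_on_divide holomorphic_on_minus holomorphic_on_add holomorphic_on_const) auto
  show "prime_wt m n \<ge> 0" for n by (rule prime_wt_nonneg)
  show "prime_wt m 0 = 0" by (simp add: prime_wt_def)
  show "1 / real (totient m) > 0" using phi by simp
  show "summable (\<lambda>n. prime_wt m n * real n powr (- \<sigma>))" if "\<sigma> > 1" for \<sigma>
  proof (rule summable_comparison_test'[OF summable_ln_powr[of "- \<sigma>"], of 0])
    show "- \<sigma> < - 1" using that by simp
    fix n show "norm (prime_wt m n * real n powr (- \<sigma>)) \<le> ln (real n) * real n powr (- \<sigma>)"
      using prime_wt_nonneg[of m n] prime_wt_le[of m n] by (simp add: mult_right_mono)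
  qed
  fix s :: complex assume s: "Re s > 1"
  have "of_nat (totient m) * Pser m s = 1 / (s - 1) - deriv (Lprod m) s / Lprod m s - Kser m s"
    using Lprod_logderiv[OF m s] by (simp add: algebra_simps)
  then have "Pser m s = (1 / (s - 1) - deriv (Lprod m) s / Lprod m s - Kser m s) / of_nat (totient m)"
    using phi by (simp add: field_simps)
  also have "\<dots> = of_real (1 / real (totient m)) / (s - 1) + - (deriv (Lprod m) s / Lprod m s + Kser m s) / of_nat (totient m)"
    by (simp add: diff_divide_distrib add_divide_distrib)
  finally show "(\<Sum>n. of_real (prime_wt m n) * of_nat n powr (- s)) =
     of_real (1 / real (totient m)) / (s - 1) + - (deriv (Lprod m) s / Lprod m s + Kser m s) / of_nat (totient m)"
    by (simp add: Pser_def)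
qed

section \<open>From logarithmic weights to counting primes\<close>

definition class_one :: "nat \<Rightarrow> nat set" where
  "class_one m = {p. prime p \<and> [p = 1] (mod m)}"

definition theta_one :: "nat \<Rightarrow> real \<Rightarrow> real" where
  "theta_one m x = (\<Sum>n | n > 0 \<and> real n \<le> x. prime_wt m n)"

lemma theta_one_lim: "m > 0 \<Longrightarrow> ((\<lambda>x. theta_one m x / x) \<longlongrightarrow> 1 / real (totient m)) at_top"
  unfolding theta_one_def by (rule tauber.wiener_ikehara[OF prime_wt_tauber])

lemma finite_le_real: "finite {n::nat. P n \<and> real n \<le> x}"
proof (rule finite_subset)
  show "{n::nat. P n \<and> real n \<le> x} \<subseteq> {..nat \<lfloor>x\<rfloor>}" by (auto simp: le_nat_floor)
qed simp

lemma theta_one_eq: "theta_one m x = (\<Sum>p | p \<in> class_one m \<and> real p \<le> x. ln (real p))"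
proof -
  have "theta_one m x = (\<Sum>n | n > 0 \<and> real n \<le> x. if n \<in> class_one m then ln (real n) else 0)"
    unfolding theta_one_def by (intro sum.cong refl) (simp add: prime_wt_def class_one_def)
  also have "\<dots> = (\<Sum>n\<in>{n\<in>{n. n > 0 \<and> real n \<le> x}. n \<in> class_one m}. ln (real n))"
    by (rule sum.inter_filter[symmetric]) (rule finite_le_real)
  also have "{n\<in>{n. n > 0 \<and> real n \<le> x}. n \<in> class_one m} = {p. p \<in> class_one m \<and> real p \<le> x}"
    by (auto simp: class_one_def prime_gt_0_nat)
  finally show ?thesis .
qed

lemma count_in_class_one: "count_in (class_one m) x = real (card {p. p \<in> class_one m \<and> real p \<le> x})"
  unfolding count_in_def class_one_def by (rule arg_cong[where f = "\<lambda>A. real (card A)"]) auto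

lemma theta_le_count:
  assumes "x \<ge> 1" shows "theta_one m x \<le> count_in (class_one m) x * ln x"
proof -
  have "theta_one m x \<le> (\<Sum>p | p \<in> class_one m \<and> real p \<le> x. ln x)"
    unfolding theta_one_eq
  proof (rule sum_mono)
    fix p assume p: "p \<in> {p. p \<in> class_one m \<and> real p \<le> x}"
    then have "p > 0" by (auto simp: class_one_def prime_gt_0_nat)
    then show "ln (real p) \<le> ln x" using p by simp
  qed
  then show ?thesis by (simp add: count_in_class_one)
qed

text \<open>Primes above \<open>y\<close> contribute at least ln y each, and at most
  \<open>y\<close> primes are discarded.\<close>

lemma count_le_theta:
  assumes y: "1 \<le> y" "y \<le> x"
  shows "(count_in (class_one m) x - y) * ln y \<le> theta_one m x"
proof -
  let ?A = "{p. p \<in> class_one m \<and> real p \<le> x}" and ?B = "{p. p \<in> class_one m \<and> real p \<le> y}"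
  have fin: "finite ?A" "finite ?B" by (rule finite_le_real)+
  have sub: "?B \<subseteq> ?A" using y by auto
  have "?B \<subseteq> {1..nat \<lfloor>y\<rfloor>}" by (auto simp: class_one_def le_nat_floor prime_ge_Suc_0_nat)
  then have "card ?B \<le> card {1..nat \<lfloor>y\<rfloor>}" by (intro card_mono) auto
  then have cB: "real (card ?B) \<le> y" using y by simp linarith
  have "(count_in (class_one m) x - y) * ln y \<le> real (card (?A - ?B)) * ln y"
    using card_Diff_subset[OF fin(2) sub] card_mono[OF fin(1) sub] cB y
    by (intro mult_right_mono) (simp_all add: count_in_class_one of_nat_diff)
  also have "\<dots> = (\<Sum>p\<in>?A - ?B. ln y)" by simp
  also have "\<dots> \<le> (\<Sum>p\<in>?A - ?B. ln (real p))" using y by (intro sum_mono) auto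
  also have "\<dots> \<le> (\<Sum>p\<in>?A. ln (real p))"
  proof (rule sum_mono2[OF fin(1)])
    fix p assume "p \<in> ?A - (?A - ?B)"
    then have "p > 0" by (auto simp: class_one_def prime_gt_0_nat)
    then show "0 \<le> ln (real p)" by simp
  qed auto
  finally show ?thesis by (simp add: theta_one_eq)
qed

lemma count_class_one_lim:
  assumes m: "m > 0"
  shows "((\<lambda>x. count_in (class_one m) x * ln x / x) \<longlongrightarrow> 1 / real (totient m)) at_top"
proof (rule tendsto_sandwich)
  \<comment> \<open>The exponent tends to 1, so ln y is asymptotic to ln x, yet y ln x / x = ln x
    exp (- sqrt (ln x)) tends to 0.\<close>
  let ?y = "\<lambda>x::real. x powr (1 - 1 / sqrt (ln x))"
  let ?u = "\<lambda>x. theta_one m x / x * (1 / (1 - 1 / sqrt (ln x))) + ?y x * ln x / x"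
  show "((\<lambda>x. theta_one m x / x) \<longlongrightarrow> 1 / real (totient m)) at_top" by (rule theta_one_lim[OF m])
  show "eventually (\<lambda>x. theta_one m x / x \<le> count_in (class_one m) x * ln x / x) at_top"
    using eventually_ge_at_top[of 1] by eventually_elim (simp add: theta_le_count divide_right_mono)
  have "((\<lambda>x::real. 1 / (1 - 1 / sqrt (ln x))) \<longlongrightarrow> 1) at_top" by real_asymp
  moreover have "((\<lambda>x::real. ?y x * ln x / x) \<longlongrightarrow> 0) at_top" by real_asymp
  ultimately have "(?u \<longlongrightarrow> 1 / real (totient m) * 1 + 0) at_top"
    by (intro tendsto_intros theta_one_lim[OF m])
  then show "(?u \<longlongrightarrow> 1 / real (totient m)) at_top" by simp
  have "eventually (\<lambda>x::real. ln x > 1) at_top" by real_asymp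
  then show "eventually (\<lambda>x. count_in (class_one m) x * ln x / x \<le> ?u x) at_top"
    using eventually_gt_at_top[of 1]
  proof eventually_elim
    case (elim x)
    define q where "q = 1 - 1 / sqrt (ln x)"
    have "sqrt (ln x) > 1" using elim by simp
    then have q: "0 < q" "q \<le> 1" by (auto simp: q_def)
    have y: "1 \<le> x powr q" "x powr q \<le> x"
      using powr_mono[of 0 q x] powr_mono[of q 1 x] q elim by auto
    have "ln (x powr q) = q * ln x" using elim by (simp add: ln_powr)
    then have "(count_in (class_one m) x - x powr q) * (q * ln x) \<le> theta_one m x"
      using count_le_theta[OF y, of m] by simp
    then have "count_in (class_one m) x * ln x \<le> theta_one m x / q + x powr q * ln x"
      using q by (simp add: field_simps)
    then have "count_in (class_one m) x * ln x / x \<le> (theta_one m x / q + x powr q * ln x) / x"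
      using elim by (intro divide_right_mono) auto
    also have "\<dots> = theta_one m x / x * (1 / q) + x powr q * ln x / x" by (simp add: add_divide_distrib)
    finally show ?case by (simp add: q_def)
  qed
qed

lemma prime_count_eq: "prime_count x = count_in (class_one 1) x"
  unfolding prime_count_def count_in_def class_one_def by simp

text \<open>Both counts are compared with x / ln x; for modulus 1 this is the prime number
  theorem.\<close>

theorem class_one_density:
  assumes m: "m > 0" shows "has_rel_density (class_one m) (1 / real (totient m))"
proof -
  have "((\<lambda>x. (count_in (class_one m) x * ln x / x) / (count_in (class_one 1) x * ln x / x)) \<longlongrightarrow>
     (1 / real (totient m)) / (1 / real (totient 1))) at_top"
    by (intro tendsto_divide count_class_one_lim m) auto
  moreover have "eventually (\<lambda>x. (count_in (class_one m) x * ln x / x) / (count_in (class_one 1) x * ln x / x) =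
      count_in (class_one m) x / prime_count x) at_top"
    using eventually_gt_at_top[of 1] by eventually_elim (simp add: prime_count_eq)
  ultimately show ?thesis unfolding has_rel_density_def by (auto intro: Lim_transform_eventually)
qed

section \<open>Densities of sieved sets\<close>

text \<open>This form is closed under inclusion-exclusion: forbidding one more \<open>s\<close>
  subtracts the set of the modulus \<open>lcm m s\<close>. Inductions on \<open>S\<close> therefore
  let \<open>m\<close> vary.\<close>

definition sieved :: "nat \<Rightarrow> nat set \<Rightarrow> nat set" where
  "sieved m S = {p. prime p \<and> [p = 1] (mod m) \<and> (\<forall>s\<in>S. \<not> [p = 1] (mod s))}"

lemma has_rel_density_unique: "has_rel_density P r \<Longrightarrow> has_rel_density P r' \<Longrightarrow> r = r'"
  unfolding has_rel_density_def using tendsto_unique[OF trivial_limit_at_top_linorder] by blast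

lemma rel_densityI: "has_rel_density P r \<Longrightarrow> rel_density P = r"
  unfolding rel_density_def using has_rel_density_unique by blast

lemma has_rel_density_nonneg:
  assumes "has_rel_density P r" shows "r \<ge> 0"
  by (rule tendsto_lowerbound[OF assms[unfolded has_rel_density_def]])
     (auto intro!: always_eventually simp: count_in_def prime_count_def)

lemma has_rel_density_Diff:
  assumes P: "has_rel_density P r" and P': "has_rel_density P' r'" and sub: "P' \<subseteq> P"
  shows "has_rel_density (P - P') (r - r')"
proof -
  have eq: "count_in (P - P') x = count_in P x - count_in P' x" for x
  proof -
    let ?f = "\<lambda>P. {p. p \<in> P \<and> prime p \<and> real p \<le> x}"
    have fin: "finite (?f P)" for P using finite_le_real[of "\<lambda>p. p \<in> P \<and> prime p"] by (simp add: conj_assoc)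
    have "?f P' \<subseteq> ?f P" using sub by auto
    moreover have "?f (P - P') = ?f P - ?f P'" by auto
    ultimately show ?thesis unfolding count_in_def
      using card_Diff_subset[OF fin] card_mono[OF fin] by (simp add: of_nat_diff)
  qed
  show ?thesis using tendsto_diff[OF P[unfolded has_rel_density_def] P'[unfolded has_rel_density_def]]
    by (simp add: has_rel_density_def eq diff_divide_distrib)
qed

lemma cong_1_lcm_iff:
  fixes p m s :: nat assumes "prime p" shows "[p = 1] (mod lcm m s) \<longleftrightarrow> [p = 1] (mod m) \<and> [p = 1] (mod s)"
proof -
  have "[p = 1] (mod d) \<longleftrightarrow> d dvd p - 1" for d
    using prime_ge_1_nat[OF assms] by (metis cong_altdef_nat)
  then show ?thesis by simp
qed

lemma sieved_insert: "sieved m (insert s S) = sieved m S - sieved (lcm m s) S"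
  unfolding sieved_def using cong_1_lcm_iff by auto

lemma sieved_lcm_subset: "sieved (lcm m s) S \<subseteq> sieved m S"
  unfolding sieved_def using cong_1_lcm_iff by auto

lemma sieved_density_exists:
  assumes "finite S" "m > 0" "0 \<notin> S"
  shows "has_rel_density (sieved m S) (rel_density (sieved m S))"
  using assms
proof (induction S arbitrary: m rule: finite_induct)
  case empty
  have "has_rel_density (sieved m {}) (1 / real (totient m))"
    using class_one_density[OF \<open>m > 0\<close>] by (simp add: sieved_def class_one_def)
  then show ?case using rel_densityI by metis
next
  case (insert s S)
  have "lcm m s > 0" using insert by (simp add: lcm_pos_nat)
  then have "has_rel_density (sieved m S) (rel_density (sieved m S))" "has_rel_density (sieved (lcm m s) S) (rel_density (sieved (lcm m s) S))"
    using insert by auto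
  from has_rel_density_Diff[OF this sieved_lcm_subset]
  show ?case unfolding sieved_insert[symmetric] using rel_densityI by metis
qed

lemma sieved_density_insert:
  assumes "finite S" "m > 0" "0 \<notin> insert s S"
  shows "rel_density (sieved m (insert s S)) = rel_density (sieved m S) - rel_density (sieved (lcm m s) S)"
  unfolding sieved_insert
  by (intro rel_densityI has_rel_density_Diff sieved_density_exists sieved_lcm_subset) (use assms in \<open>auto simp: lcm_pos_nat\<close>)

lemma rel_density_sieved_empty: "m > 0 \<Longrightarrow> rel_density (sieved m {}) = 1 / real (totient m)"
  using rel_densityI[OF class_one_density[of m]] by (simp add: sieved_def class_one_def)

text \<open>For prime \<open>q\<close> the quotient of \<open>totient (q * m)\<close> by
  \<open>totient m\<close>, hence the inverse of the conditional density of the class of 1 modulo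
  \<open>q * m\<close> within that modulo \<open>m\<close>.\<close>

definition totient_factor :: "nat \<Rightarrow> nat \<Rightarrow> nat" where
  "totient_factor q m = (if q dvd m then q else q - 1)"

lemma totient_prime_mult:
  assumes q: "prime q" shows "totient (q * m) = totient_factor q m * totient m"
proof (cases "q dvd m")
  case True
  then have "gcd q m = q" by (simp add: gcd_nat.absorb1)
  then show ?thesis using totient_mult[of q m] True prime_gt_1_nat[OF q]
    by (simp add: totient_factor_def totient_prime[OF q] mult_ac)
next
  case False
  then have "coprime q m" using q prime_imp_coprime by blast
  then show ?thesis using False by (simp add: totient_factor_def totient_mult_coprime totient_prime[OF q])
qed

text \<open>If no \<open>s \<in> S\<close> has a higher power of \<open>q\<close> than \<open>m\<close>, being \<open>1\<close> modulo \<open>q m\<close> is independent of \<open>S\<close>.\<close>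
lemma sieved_density_independent:
  assumes q: "prime q" and "finite S" "m > 0" "0 \<notin> S"
    and "\<And>s. s \<in> S \<Longrightarrow> \<not> q * m dvd lcm m s"
  shows "rel_density (sieved m S) = real (totient_factor q m) * rel_density (sieved (q * m) S)"
  using assms(2-)
proof (induction S arbitrary: m rule: finite_induct)
  case empty
  have "q * m > 0" using q empty by (simp add: prime_gt_0_nat)
  moreover have "totient_factor q m > 0" using prime_gt_1_nat[OF q] by (simp add: totient_factor_def)
  ultimately show ?case using empty by (simp add: rel_density_sieved_empty totient_prime_mult[OF q])
next
  case (insert s S)
  have q0: "q > 0" using q by (simp add: prime_gt_0_nat)
  obtain u where u: "lcm m s = m * u" using dvd_lcm1 by blast
  \<comment> \<open>The exponent of \<open>q\<close> in \<open>lcm m s\<close> is the one in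
    \<open>m\<close>. So the lcm has the same totient factor and again satisfies the hypothesis for
    the rest of \<open>S\<close>, and the induction applies to both terms of the difference.\<close>
  have qu: "\<not> q dvd u"
  proof
    assume "q dvd u"
    then have "q * m dvd lcm m s" unfolding u by (metis mult.commute mult_dvd_mono dvd_refl)
    then show False using insert.prems(3)[of s] by simp
  qed
  have M0: "lcm m s > 0" using insert.prems by (simp add: lcm_pos_nat)
  have lcm_q: "lcm (q * m) s = q * lcm m s"
  proof -
    have "lcm (q * m) s = lcm (q * m) (lcm m s)" 
      by (metis dvd_triv_right lcm.assoc lcm_proj1_if_dvd_nat)
    also have "\<dots> = lcm (m * q) (m * u)" by (simp add: u mult.commute)
    also have "\<dots> = m * lcm q u" by (simp add: lcm_mult_left)
    also have "lcm q u = q * u" using qu q by (simp add: lcm_coprime prime_imp_coprime)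
    finally show ?thesis by (simp add: u mult_ac)
  qed
  have tf: "totient_factor q (lcm m s) = totient_factor q m"
    using qu q by (simp add: totient_factor_def u prime_dvd_mult_iff)
  have IH1: "rel_density (sieved m S) = real (totient_factor q m) * rel_density (sieved (q * m) S)"
    using insert by auto
  have "\<not> q * lcm m s dvd lcm (lcm m s) s'" if s': "s' \<in> S" for s'
  proof
    assume d: "q * lcm m s dvd lcm (lcm m s) s'"
    obtain u' where u': "lcm m s' = m * u'" using dvd_lcm1 by blast
    have qu': "\<not> q dvd u'"
    proof
      assume "q dvd u'"
      then have "q * m dvd lcm m s'" unfolding u' by (metis mult.commute mult_dvd_mono dvd_refl)
      then show False using insert.prems(3)[of s'] s' by simp
    qed
    have "lcm (lcm m s) s' = lcm (lcm m s) (lcm m s')"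
      by (metis dvd_lcm1 lcm.assoc lcm.commute lcm_proj2_if_dvd_nat)
    also have "\<dots> = m * lcm u u'" by (simp add: u u' lcm_mult_left)
    finally have "m * (q * u) dvd m * lcm u u'" using d by (simp add: u mult_ac)
    then have "q * u dvd lcm u u'" using insert.prems(1) by simp
    then have "q dvd lcm u u'" using dvd_mult_left by blast
    then have "q dvd u * u'" using dvd_trans[OF _ lcm_least[of u "u * u'" u']] by simp
    then show False using qu qu' q by (simp add: prime_dvd_mult_iff)
  qed
  then have IH2: "rel_density (sieved (lcm m s) S) = real (totient_factor q (lcm m s)) * rel_density (sieved (q * lcm m s) S)"
    using insert M0 by auto
  have "rel_density (sieved m (insert s S)) = rel_density (sieved m S) - rel_density (sieved (lcm m s) S)"
    by (rule sieved_density_insert[OF insert.hyps(1) insert.prems(1,2)])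
  also have "\<dots> = real (totient_factor q m) * (rel_density (sieved (q * m) S) - rel_density (sieved (lcm (q * m) s) S))"
    unfolding IH1 IH2 tf lcm_q by (simp add: algebra_simps)
  also have "rel_density (sieved (q * m) S) - rel_density (sieved (lcm (q * m) s) S) = rel_density (sieved (q * m) (insert s S))"
    using sieved_density_insert[OF insert.hyps(1) _ insert.prems(2), of "q * m"] q0 insert.prems(1) by simp
  finally show ?case .
qed

text \<open>The moduli outside \<open>T\<close> remove the same set of primes, of density D say,
  from both classes. If d is the density of \<open>sieved m T\<close> and r =
  \<open>totient_factor q m\<close>, independence turns the left side into d - r D, while the right
  side is d - D, and r \<ge> 1.\<close>

lemma conditional_density_prime_step:
  assumes q: "prime q" and S: "finite S" "0 \<notin> S" and m: "m > 0"
  shows "real (totient_factor q m) * rel_density (sieved (q * m) S) \<le> rel_density (sieved m S)"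
proof -
  define T where "T = {s\<in>S. \<not> q * m dvd lcm m s}"
  have qm: "q * m > 0" using q m by (simp add: prime_gt_0_nat)
  have T: "finite T" "0 \<notin> T" "T \<subseteq> S" using S by (auto simp: T_def)
  have r: "real (totient_factor q m) \<ge> 1" using prime_gt_1_nat[OF q] by (auto simp: totient_factor_def)
  have dens: "has_rel_density (sieved n T) (rel_density (sieved n T))" "has_rel_density (sieved n S) (rel_density (sieved n S))"
    if "n > 0" for n
    using sieved_density_exists[OF T(1) that T(2)] sieved_density_exists[OF S(1) that S(2)] .
  have sub: "sieved n S \<subseteq> sieved n T" for n using T by (auto simp: sieved_def)
  have cm: "[p = 1] (mod m)" if "[p = 1] (mod (q * m))" for p using that cong_modulus_mult_nat by (metis mult.commute)
  have "sieved m T - sieved m S = sieved (q * m) T - sieved (q * m) S"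
  proof (intro equalityI subsetI)
    fix p assume p: "p \<in> sieved m T - sieved m S"
    then obtain s where s: "s \<in> S" "[p = 1] (mod s)" by (auto simp: sieved_def)
    then have "s \<notin> T" using p by (auto simp: sieved_def)
    then have "q * m dvd lcm m s" using s by (simp add: T_def)
    moreover have "[p = 1] (mod lcm m s)" using p s cong_1_lcm_iff by (auto simp: sieved_def)
    ultimately have "[p = 1] (mod (q * m))" using cong_dvd_modulus_nat by blast
    then show "p \<in> sieved (q * m) T - sieved (q * m) S" using p s by (auto simp: sieved_def)
  next
    fix p assume "p \<in> sieved (q * m) T - sieved (q * m) S"
    then show "p \<in> sieved m T - sieved m S" using cm by (auto simp: sieved_def)
  qed
  moreover have X1: "has_rel_density (sieved m T - sieved m S) (rel_density (sieved m T) - rel_density (sieved m S))"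
    by (rule has_rel_density_Diff[OF dens(1)[OF m] dens(2)[OF m] sub])
  moreover have "has_rel_density (sieved (q * m) T - sieved (q * m) S) (rel_density (sieved (q * m) T) - rel_density (sieved (q * m) S))"
    by (rule has_rel_density_Diff[OF dens(1)[OF qm] dens(2)[OF qm] sub])
  ultimately have eq: "rel_density (sieved m T) - rel_density (sieved m S) = rel_density (sieved (q * m) T) - rel_density (sieved (q * m) S)"
    using has_rel_density_unique by metis
  have nn: "rel_density (sieved m T) - rel_density (sieved m S) \<ge> 0" by (rule has_rel_density_nonneg[OF X1])
  have ind: "rel_density (sieved m T) = real (totient_factor q m) * rel_density (sieved (q * m) T)"
    by (rule sieved_density_independent[OF q T(1) m T(2)]) (auto simp: T_def)
  have "real (totient_factor q m) * rel_density (sieved (q * m) S) =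
     rel_density (sieved m T) - real (totient_factor q m) * (rel_density (sieved m T) - rel_density (sieved m S))"
  proof -
    have "rel_density (sieved (q * m) S) = rel_density (sieved (q * m) T) - (rel_density (sieved m T) - rel_density (sieved m S))"
      using eq by simp
    then show ?thesis unfolding ind[symmetric] by (metis ind right_diff_distrib)
  qed
  also have "\<dots> \<le> rel_density (sieved m T) - 1 * (rel_density (sieved m T) - rel_density (sieved m S))"
    by (intro diff_left_mono mult_right_mono r nn)
  finally show ?thesis by simp
qed

text \<open>Conditioning on a larger modulus makes the avoided congruences more likely.\<close>
lemma conditional_density_antimono:
  assumes S: "finite S" "0 \<notin> S" and m: "m > 0" and t: "t > 0"
  shows "real (totient (t * m)) * rel_density (sieved (t * m) S) \<le> real (totient m) * rel_density (sieved m S)"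
  using t
proof (induction t rule: less_induct)
  case (less t)
  show ?case
  proof (cases "t = 1")
    case False
    then obtain q t' where q: "prime q" and t': "t = q * t'" using prime_factor_nat[of t] by (auto simp: dvd_def)
    have "t' > 0" using less.prems t' by (cases "t' = 0") auto
    moreover have "t' < t" using prime_gt_1_nat[OF q] \<open>t' > 0\<close> by (simp add: t')
    ultimately have IH: "real (totient (t' * m)) * rel_density (sieved (t' * m) S) \<le> real (totient m) * rel_density (sieved m S)"
      by (intro less.IH)
    have tm: "t' * m > 0" using \<open>t' > 0\<close> m by simp
    have "real (totient (t * m)) * rel_density (sieved (t * m) S) =
       real (totient (t' * m)) * (real (totient_factor q (t' * m)) * rel_density (sieved (q * (t' * m)) S))"
      using totient_prime_mult[OF q, of "t' * m"] by (simp add: t' mult.assoc)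
    also have "\<dots> \<le> real (totient (t' * m)) * rel_density (sieved (t' * m) S)"
      by (intro mult_left_mono conditional_density_prime_step[OF q S tm]) auto
    also note IH
    finally show ?thesis .
  qed auto
qed

text \<open>As \<open>m\<close> divides \<open>a (Suc k)\<close>, forbidding this modulus subtracts
  the sieved density of its own class, which by \<open>conditional_density_antimono\<close> is at
  most \<open>totient m / totient (a (Suc k))\<close> times the current density.\<close>

lemma sieved_density_lower:
  fixes k :: nat and a :: "nat \<Rightarrow> nat"
  assumes m: "m > 0" and a: "\<And>i. i \<in> {1..k} \<Longrightarrow> a i > 0 \<and> m dvd a i"
  shows "rel_density (sieved m (a ` {1..k})) \<ge> 1 / real (totient m) * (\<Prod>i=1..k. 1 - real (totient m) / real (totient (a i)))"
  using a
proof (induction k)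
  case 0
  then show ?case by (simp add: rel_density_sieved_empty[OF m])
next
  case (Suc k)
  let ?S = "a ` {1..k}" and ?s = "a (Suc k)"
  have s: "?s > 0" "m dvd ?s" using Suc.prems[of "Suc k"] by auto
  have S: "finite ?S" "0 \<notin> ?S" using Suc.prems by fastforce+
  have IH: "1 / real (totient m) * (\<Prod>i=1..k. 1 - real (totient m) / real (totient (a i))) \<le> rel_density (sieved m ?S)"
    by (rule Suc.IH) (use Suc.prems in auto)
  obtain t where t: "?s = t * m" using s(2) by (metis dvd_def mult.commute)
  have t0: "t > 0" using s(1) t by (cases "t = 0") auto
  have phi: "totient m > 0" "totient ?s > 0" using m s by auto
  \<comment> \<open>Nonnegativity of the new factor allows the induction hypothesis to be multiplied
    by it.\<close>
  have f: "1 - real (totient m) / real (totient ?s) \<ge> 0"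
    using totient_dvd_mono[OF s(2,1)] phi by simp
  have "1 / real (totient m) * (\<Prod>i=1..Suc k. 1 - real (totient m) / real (totient (a i))) =
     (1 / real (totient m) * (\<Prod>i=1..k. 1 - real (totient m) / real (totient (a i)))) * (1 - real (totient m) / real (totient ?s))"
    by simp
  also have "\<dots> \<le> rel_density (sieved m ?S) * (1 - real (totient m) / real (totient ?s))"
    by (rule mult_right_mono[OF IH f])
  also have "\<dots> = rel_density (sieved m ?S) - real (totient m) * rel_density (sieved m ?S) / real (totient ?s)"
    by (simp add: right_diff_distrib mult_ac)
  also have "\<dots> \<le> rel_density (sieved m ?S) - rel_density (sieved ?s ?S)"
    using conditional_density_antimono[OF S m t0] phi unfolding t by (simp add: field_simps)
  also have "\<dots> = rel_density (sieved m (insert ?s ?S))"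
    using sieved_density_insert[OF S(1) m, of ?s] S(2) s lcm_proj2_if_dvd_nat[OF s(2)] by auto
  also have "insert ?s ?S = a ` {1..Suc k}" by (simp add: atLeastAtMostSuc_conv)
  finally show ?case .
qed

theorem theorem2p2:
  fixes k :: nat and a :: "nat \<Rightarrow> nat"
  assumes pos: "\<And>i. i \<le> k \<Longrightarrow> a i > 0"
    and dvd: "\<And>i. 1 \<le> i \<Longrightarrow> i \<le> k \<Longrightarrow> a 0 dvd a i"
  defines "Q \<equiv> {p::nat. prime p \<and> [p = 1] (mod a 0) \<and> (\<forall>i\<in>{1..k}. \<not> [p = 1] (mod a i))}"
  shows "(\<exists>r. has_rel_density Q r) \<and>
    rel_density Q \<ge> (1 / real (totient (a 0))) *
      (\<Prod>i=1..k. (1 - real (totient (a 0)) / real (totient (a i))))"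
proof -
  have Q: "Q = sieved (a 0) (a ` {1..k})" by (auto simp: Q_def sieved_def)
  have "has_rel_density Q (rel_density Q)"
    unfolding Q
  proof (rule sieved_density_exists)
    show "0 \<notin> a ` {1..k}"
    proof
      assume "0 \<in> a ` {1..k}"
      then obtain i where "a i = 0" "i \<le> k" by auto
      then show False using pos[of i] by simp
    qed
  qed (use pos in auto)
  moreover have "rel_density Q \<ge> (1 / real (totient (a 0))) * (\<Prod>i=1..k. (1 - real (totient (a 0)) / real (totient (a i))))"
    unfolding Q by (rule sieved_density_lower) (use pos dvd in auto)
  ultimately show ?thesis by blast
qed

end
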